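(* For any symmetric monoidal category $\mathcal A$, the arrow $v^*:\mathcal A\to[\mathcal I,\mathcal A]$ in $\mathrm{SMC}$ that is dual to $v:\mathcal I\to[\mathcal A,\mathcal A]$ has as right adjoint in the 2-category $\mathrm{SMC}$ the evaluation functor at $\star$, $ev_\star:[\mathcal I,\mathcal A]\to\mathcal A$. Moreover the composite $ev_\star\circ v^*$ is the identity at $\mathcal A$.
   Context: All symmetric monoidal categories are small, with tensor $\otimes$, unit $I$ and natural isomorphisms $ass_{a,b,c}:a\otimes(b\otimes c)\to(a\otimes b)\otimes c$, $r_a:a\otimes I\to a$, $l_a:I\otimes a\to a$, $s_{a,b}:a\otimes b\to b\otimes a$ satisfying the usual coherence axioms. A symmetric monoidal functor $F:\mathcal A\to\mathcal B$ is a lax one: a functor with an arrow $F^0:I\to F(I)$ and a natural family $F^2_{x,y}:Fx\otimes Fy\to F(x\otimes y)$ satisfying the usual associativity, unit and symmetry axioms; it is strict if $F^0$ and all $F^2_{x,y}$ are identities. $\mathrm{SMC}$ is the 2-category of symmetric monoidal categories, symmetric monoidal functors and monoidal natural transformations. $[\mathcal A,\mathcal B]$ is the category $\mathrm{SMC}(\mathcal A,\mathcal B)$ with the pointwise symmetric monoidal structure: $(F\Box G)(a)=Fa\otimes Ga$, $(F\Box G)^0$ is $I\cong I\otimes I\xrightarrow{F^0\otimes G^0}F(I)\otimes G(I)$, $(F\Box G)^2_{a,b}$ is the canonical interchange $(Fa\otimes Ga)\otimes(Fb\otimes Gb)\cong(Fa\otimes Fb)\otimes(Ga\otimes Gb)$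 followed by $F^2_{a,b}\otimes G^2_{a,b}$; $(\sigma\Box\tau)_a=\sigma_a\otimes\tau_a$; the unit is the constant functor at $I_{\mathcal B}$ (with $I\to I$ the identity and $I\otimes I\to I$ the canonical arrow); $ass,r,l,s$ are pointwise. For an object $a$ of $\mathcal A$, $ev_a:[\mathcal A,\mathcal B]\to\mathcal B$ is the strict symmetric monoidal functor $F\mapsto Fa$, $\sigma\mapsto\sigma_a$. For $F:\mathcal A\to[\mathcal B,\mathcal C]$ in $\mathrm{SMC}$, its dual $F^*:\mathcal B\to[\mathcal A,\mathcal C]$ is given by $F^*(b)(a)=F(a)(b)$, $F^*(b)(f)=F(f)_b$, $(F^*b)^0=(F^0)_b$, $(F^*b)^2_{a,a'}=(F^2_{a,a'})_b$, $F^*(g)_a=F(a)(g)$, $((F^* )^0)_a=(Fa)^0$, $((F^* )^2_{b,b'})_a=(Fa)^2_{b,b'}$. $\mathcal I$ is the free symmetric monoidal category on one generating object $\star$ (the free one over the terminal category): its objects are the formal words freely generated from $I$ and $\star$ under a formal binary operation $\otimes$, its arrows are generated under composition and tensoring with objects by formal canonical arrows $ass,r,l$ (with inverses) and $s$, modulo exactly the relations required for a symmetric monoidal category. For each symmetric monoidal category $\mathcal X$ and object $x$ there is a unique strict symmetric monoidal functor $\mathcal I\to\mathcal X$ sending $\star$ to $x$. $v:\mathcal I\to[\mathcal A,\mathcal A]$ is the unique strict symmetric monoidal functor with $v(\star)=1_{\mathcal A}$ (the identity functor with its strict structure). *)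

theory Defs
  imports "HOL-Library.FuncSet"
begin

section \<open>Symmetric monoidal categories\<close>

text \<open>
  A small category is given by a set of objects and a set of arrows; \<^term>\<open>Dom\<close>, \<^term>\<open>Cod\<close> and the
  operations are only meaningful on these sets.
\<close>

record ('o, 'a) smc =
  Obj :: "'o set"
  Arr :: "'a set"
  Dom :: "'a \<Rightarrow> 'o"
  Cod :: "'a \<Rightarrow> 'o"
  Idt :: "'o \<Rightarrow> 'a"  ("\<one>\<index>")
  Cmp :: "'a \<Rightarrow> 'a \<Rightarrow> 'a"  (infixl "\<cdot>\<index>" 65)
  Unit :: "'o"  ("\<I>\<index>")
  Tobj :: "'o \<Rightarrow> 'o \<Rightarrow> 'o"  (infixl "\<otimes>\<index>" 70)
  Tarr :: "'a \<Rightarrow> 'a \<Rightarrow> 'a"  (infixl "\<boxtimes>\<index>" 70)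
  Ass :: "'o \<Rightarrow> 'o \<Rightarrow> 'o \<Rightarrow> 'a"
  Run :: "'o \<Rightarrow> 'a"
  Lun :: "'o \<Rightarrow> 'a"
  Sym :: "'o \<Rightarrow> 'o \<Rightarrow> 'a"

definition Hom :: "('o, 'a) smc \<Rightarrow> 'o \<Rightarrow> 'o \<Rightarrow> 'a set" where
  "Hom C a b = {f \<in> Arr C. Dom C f = a \<and> Cod C f = b}"

definition inverse_arrows :: "('o, 'a) smc \<Rightarrow> 'a \<Rightarrow> 'a \<Rightarrow> bool" where
  "inverse_arrows C f g \<longleftrightarrow>
     f \<in> Arr C \<and> g \<in> Hom C (Cod C f) (Dom C f) \<and>
     g \<cdot>\<^bsub>C\<^esub> f = \<one>\<^bsub>C\<^esub> (Dom C f) \<and> f \<cdot>\<^bsub>C\<^esub> g = \<one>\<^bsub>C\<^esub> (Cod C f)"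

definition iso :: "('o, 'a) smc \<Rightarrow> 'a \<Rightarrow> bool" where
  "iso C f \<longleftrightarrow> (\<exists>g. inverse_arrows C f g)"

definition Inv :: "('o, 'a) smc \<Rightarrow> 'a \<Rightarrow> 'a" where
  "Inv C f = (THE g. inverse_arrows C f g)"

locale category =
  fixes C :: "('o, 'a) smc" (structure)
  assumes dom_obj: "f \<in> Arr C \<Longrightarrow> Dom C f \<in> Obj C"
    and cod_obj: "f \<in> Arr C \<Longrightarrow> Cod C f \<in> Obj C"
    and idt_hom: "a \<in> Obj C \<Longrightarrow> \<one> a \<in> Hom C a a"
    and cmp_hom: "f \<in> Hom C a b \<Longrightarrow> g \<in> Hom C b c \<Longrightarrow> g \<cdot> f \<in> Hom C a c"
    and cmp_idt_left: "f \<in> Hom C a b \<Longrightarrow> \<one> b \<cdot> f = f"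
    and cmp_idt_right: "f \<in> Hom C a b \<Longrightarrow> f \<cdot> \<one> a = f"
    and cmp_assoc: "f \<in> Hom C a b \<Longrightarrow> g \<in> Hom C b c \<Longrightarrow> h \<in> Hom C c d \<Longrightarrow>
                    (h \<cdot> g) \<cdot> f = h \<cdot> (g \<cdot> f)"

locale symmetric_monoidal_category = category +
  assumes unit_obj: "\<I> \<in> Obj C"
    and tobj_obj: "a \<in> Obj C \<Longrightarrow> b \<in> Obj C \<Longrightarrow> a \<otimes> b \<in> Obj C"
    and tarr_hom: "f \<in> Hom C a a' \<Longrightarrow> g \<in> Hom C b b' \<Longrightarrow> f \<boxtimes> g \<in> Hom C (a \<otimes> b) (a' \<otimes> b')"
    and tarr_idt: "a \<in> Obj C \<Longrightarrow> b \<in> Obj C \<Longrightarrow> \<one> a \<boxtimes> \<one> b = \<one> (a \<otimes> b)"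
    and tarr_cmp: "f \<in> Hom C a a' \<Longrightarrow> f' \<in> Hom C a' a'' \<Longrightarrow>
                   g \<in> Hom C b b' \<Longrightarrow> g' \<in> Hom C b' b'' \<Longrightarrow>
                   (f' \<cdot> f) \<boxtimes> (g' \<cdot> g) = (f' \<boxtimes> g') \<cdot> (f \<boxtimes> g)"
    and ass_hom: "a \<in> Obj C \<Longrightarrow> b \<in> Obj C \<Longrightarrow> c \<in> Obj C \<Longrightarrow>
                  Ass C a b c \<in> Hom C (a \<otimes> (b \<otimes> c)) ((a \<otimes> b) \<otimes> c)"
    and ass_iso: "a \<in> Obj C \<Longrightarrow> b \<in> Obj C \<Longrightarrow> c \<in> Obj C \<Longrightarrow> iso C (Ass C a b c)"
    and ass_natural: "f \<in> Hom C a a' \<Longrightarrow> g \<in> Hom C b b' \<Longrightarrow> h \<in> Hom C c c' \<Longrightarrow>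
                      Ass C a' b' c' \<cdot> (f \<boxtimes> (g \<boxtimes> h)) = ((f \<boxtimes> g) \<boxtimes> h) \<cdot> Ass C a b c"
    and run_hom: "a \<in> Obj C \<Longrightarrow> Run C a \<in> Hom C (a \<otimes> \<I>) a"
    and run_iso: "a \<in> Obj C \<Longrightarrow> iso C (Run C a)"
    and run_natural: "f \<in> Hom C a a' \<Longrightarrow> Run C a' \<cdot> (f \<boxtimes> \<one> \<I>) = f \<cdot> Run C a"
    and lun_hom: "a \<in> Obj C \<Longrightarrow> Lun C a \<in> Hom C (\<I> \<otimes> a) a"
    and lun_iso: "a \<in> Obj C \<Longrightarrow> iso C (Lun C a)"
    and lun_natural: "f \<in> Hom C a a' \<Longrightarrow> Lun C a' \<cdot> (\<one> \<I> \<boxtimes> f) = f \<cdot> Lun C a"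
    and sym_hom: "a \<in> Obj C \<Longrightarrow> b \<in> Obj C \<Longrightarrow> Sym C a b \<in> Hom C (a \<otimes> b) (b \<otimes> a)"
    and sym_natural: "f \<in> Hom C a a' \<Longrightarrow> g \<in> Hom C b b' \<Longrightarrow>
                      Sym C a' b' \<cdot> (f \<boxtimes> g) = (g \<boxtimes> f) \<cdot> Sym C a b"
    and pentagon: "a \<in> Obj C \<Longrightarrow> b \<in> Obj C \<Longrightarrow> c \<in> Obj C \<Longrightarrow> d \<in> Obj C \<Longrightarrow>
                   Ass C (a \<otimes> b) c d \<cdot> Ass C a b (c \<otimes> d) =
                   (Ass C a b c \<boxtimes> \<one> d) \<cdot> Ass C a (b \<otimes> c) d \<cdot> (\<one> a \<boxtimes> Ass C b c d)"
    and triangle: "a \<in> Obj C \<Longrightarrow> b \<in> Obj C \<Longrightarrow>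
                   (Run C a \<boxtimes> \<one> b) \<cdot> Ass C a \<I> b = \<one> a \<boxtimes> Lun C b"
    and sym_sym: "a \<in> Obj C \<Longrightarrow> b \<in> Obj C \<Longrightarrow> Sym C b a \<cdot> Sym C a b = \<one> (a \<otimes> b)"
    and sym_unit: "a \<in> Obj C \<Longrightarrow> Lun C a \<cdot> Sym C a \<I> = Run C a"
    and hexagon: "a \<in> Obj C \<Longrightarrow> b \<in> Obj C \<Longrightarrow> c \<in> Obj C \<Longrightarrow>
                  Ass C c a b \<cdot> Sym C (a \<otimes> b) c \<cdot> Ass C a b c =
                  (Sym C a c \<boxtimes> \<one> b) \<cdot> Ass C a c b \<cdot> (\<one> a \<boxtimes> Sym C b c)"


section \<open>The 2-category of symmetric monoidal categories\<close>

text \<open>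
  All function components of functors and transformations are required to be extensional
  (\<^const>\<open>undefined\<close> outside the relevant carrier), so that equality of records is equality of
  functors and of transformations.
\<close>

record ('o, 'a, 'p, 'b) smfun =
  FObj :: "'o \<Rightarrow> 'p"
  FArr :: "'a \<Rightarrow> 'b"
  FUnit :: "'b"
  FTen :: "'o \<times> 'o \<Rightarrow> 'b"

locale sm_functor =
  A: symmetric_monoidal_category A + B: symmetric_monoidal_category B
  for A :: "('o, 'a) smc" and B :: "('p, 'b) smc" and F :: "('o, 'a, 'p, 'b) smfun" +
  assumes fobj: "FObj F \<in> Obj A \<rightarrow>\<^sub>E Obj B"
    and farr_ext: "FArr F \<in> extensional (Arr A)"
    and farr_hom: "f \<in> Hom A x y \<Longrightarrow> FArr F f \<in> Hom B (FObj F x) (FObj F y)"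
    and farr_idt: "x \<in> Obj A \<Longrightarrow> FArr F (\<one>\<^bsub>A\<^esub> x) = \<one>\<^bsub>B\<^esub> (FObj F x)"
    and farr_cmp: "f \<in> Hom A x y \<Longrightarrow> g \<in> Hom A y z \<Longrightarrow>
                   FArr F (g \<cdot>\<^bsub>A\<^esub> f) = FArr F g \<cdot>\<^bsub>B\<^esub> FArr F f"
    and funit_hom: "FUnit F \<in> Hom B \<I>\<^bsub>B\<^esub> (FObj F \<I>\<^bsub>A\<^esub>)"
    and ften_ext: "FTen F \<in> extensional (Obj A \<times> Obj A)"
    and ften_hom: "x \<in> Obj A \<Longrightarrow> y \<in> Obj A \<Longrightarrow>
                   FTen F (x, y) \<in> Hom B (FObj F x \<otimes>\<^bsub>B\<^esub> FObj F y) (FObj F (x \<otimes>\<^bsub>A\<^esub> y))"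
    and ften_natural: "f \<in> Hom A x x' \<Longrightarrow> g \<in> Hom A y y' \<Longrightarrow>
                       FTen F (x', y') \<cdot>\<^bsub>B\<^esub> (FArr F f \<boxtimes>\<^bsub>B\<^esub> FArr F g) =
                       FArr F (f \<boxtimes>\<^bsub>A\<^esub> g) \<cdot>\<^bsub>B\<^esub> FTen F (x, y)"
    and ften_ass: "x \<in> Obj A \<Longrightarrow> y \<in> Obj A \<Longrightarrow> z \<in> Obj A \<Longrightarrow>
                   FArr F (Ass A x y z) \<cdot>\<^bsub>B\<^esub> FTen F (x, y \<otimes>\<^bsub>A\<^esub> z) \<cdot>\<^bsub>B\<^esub> (\<one>\<^bsub>B\<^esub> (FObj F x) \<boxtimes>\<^bsub>B\<^esub> FTen F (y, z)) =
                   FTen F (x \<otimes>\<^bsub>A\<^esub> y, z) \<cdot>\<^bsub>B\<^esub> (FTen F (x, y) \<boxtimes>\<^bsub>B\<^esub> \<one>\<^bsub>B\<^esub> (FObj F z)) \<cdot>\<^bsub>B\<^esub>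
                     Ass B (FObj F x) (FObj F y) (FObj F z)"
    and ften_run: "x \<in> Obj A \<Longrightarrow>
                   FArr F (Run A x) \<cdot>\<^bsub>B\<^esub> FTen F (x, \<I>\<^bsub>A\<^esub>) \<cdot>\<^bsub>B\<^esub> (\<one>\<^bsub>B\<^esub> (FObj F x) \<boxtimes>\<^bsub>B\<^esub> FUnit F) =
                   Run B (FObj F x)"
    and ften_lun: "x \<in> Obj A \<Longrightarrow>
                   FArr F (Lun A x) \<cdot>\<^bsub>B\<^esub> FTen F (\<I>\<^bsub>A\<^esub>, x) \<cdot>\<^bsub>B\<^esub> (FUnit F \<boxtimes>\<^bsub>B\<^esub> \<one>\<^bsub>B\<^esub> (FObj F x)) =
                   Lun B (FObj F x)"
    and ften_sym: "x \<in> Obj A \<Longrightarrow> y \<in> Obj A \<Longrightarrow>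
                   FArr F (Sym A x y) \<cdot>\<^bsub>B\<^esub> FTen F (x, y) =
                   FTen F (y, x) \<cdot>\<^bsub>B\<^esub> Sym B (FObj F x) (FObj F y)"

locale strict_sm_functor = sm_functor +
  assumes funit_idt: "FUnit F = \<one>\<^bsub>B\<^esub> \<I>\<^bsub>B\<^esub>"
    and ften_idt: "x \<in> Obj A \<Longrightarrow> y \<in> Obj A \<Longrightarrow> FTen F (x, y) = \<one>\<^bsub>B\<^esub> (FObj F x \<otimes>\<^bsub>B\<^esub> FObj F y)"

record ('o, 'a, 'p, 'b) smtrans =
  TSrc :: "('o, 'a, 'p, 'b) smfun"
  TTgt :: "('o, 'a, 'p, 'b) smfun"
  TCmp :: "'o \<Rightarrow> 'b"

locale sm_transformation =
  F: sm_functor A B "TSrc \<sigma>" + G: sm_functor A B "TTgt \<sigma>"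
  for A :: "('o, 'a) smc" and B :: "('p, 'b) smc" and \<sigma> :: "('o, 'a, 'p, 'b) smtrans" +
  assumes tcmp_ext: "TCmp \<sigma> \<in> extensional (Obj A)"
    and tcmp_hom: "x \<in> Obj A \<Longrightarrow> TCmp \<sigma> x \<in> Hom B (FObj (TSrc \<sigma>) x) (FObj (TTgt \<sigma>) x)"
    and tcmp_natural: "f \<in> Hom A x y \<Longrightarrow>
                       TCmp \<sigma> y \<cdot>\<^bsub>B\<^esub> FArr (TSrc \<sigma>) f = FArr (TTgt \<sigma>) f \<cdot>\<^bsub>B\<^esub> TCmp \<sigma> x"
    and tcmp_unit: "TCmp \<sigma> \<I>\<^bsub>A\<^esub> \<cdot>\<^bsub>B\<^esub> FUnit (TSrc \<sigma>) = FUnit (TTgt \<sigma>)"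
    and tcmp_ten: "x \<in> Obj A \<Longrightarrow> y \<in> Obj A \<Longrightarrow>
                   TCmp \<sigma> (x \<otimes>\<^bsub>A\<^esub> y) \<cdot>\<^bsub>B\<^esub> FTen (TSrc \<sigma>) (x, y) =
                   FTen (TTgt \<sigma>) (x, y) \<cdot>\<^bsub>B\<^esub> (TCmp \<sigma> x \<boxtimes>\<^bsub>B\<^esub> TCmp \<sigma> y)"

definition id_fun :: "('o, 'a) smc \<Rightarrow> ('o, 'a, 'o, 'a) smfun" where
  "id_fun A = \<lparr>
     FObj = (\<lambda>x\<in>Obj A. x),
     FArr = (\<lambda>f\<in>Arr A. f),
     FUnit = \<one>\<^bsub>A\<^esub> \<I>\<^bsub>A\<^esub>,
     FTen = (\<lambda>(x, y)\<in>Obj A \<times> Obj A. \<one>\<^bsub>A\<^esub> (x \<otimes>\<^bsub>A\<^esub> y))\<rparr>"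

definition comp_fun ::
  "('o, 'a) smc \<Rightarrow> ('q, 'c) smc \<Rightarrow> ('p, 'b, 'q, 'c) smfun \<Rightarrow> ('o, 'a, 'p, 'b) smfun
     \<Rightarrow> ('o, 'a, 'q, 'c) smfun" where
  "comp_fun A C G F = \<lparr>
     FObj = (\<lambda>x\<in>Obj A. FObj G (FObj F x)),
     FArr = (\<lambda>f\<in>Arr A. FArr G (FArr F f)),
     FUnit = FArr G (FUnit F) \<cdot>\<^bsub>C\<^esub> FUnit G,
     FTen = (\<lambda>(x, y)\<in>Obj A \<times> Obj A. FArr G (FTen F (x, y)) \<cdot>\<^bsub>C\<^esub> FTen G (FObj F x, FObj F y))\<rparr>"

definition whisker_left ::
  "('o, 'a) smc \<Rightarrow> ('q, 'c) smc \<Rightarrow> ('p, 'b, 'q, 'c) smfun \<Rightarrow> ('o, 'a, 'p, 'b) smtrans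
     \<Rightarrow> ('o, 'a, 'q, 'c) smtrans" where
  "whisker_left A C G \<sigma> = \<lparr>
     TSrc = comp_fun A C G (TSrc \<sigma>),
     TTgt = comp_fun A C G (TTgt \<sigma>),
     TCmp = (\<lambda>x\<in>Obj A. FArr G (TCmp \<sigma> x))\<rparr>"

definition whisker_right ::
  "('o, 'a) smc \<Rightarrow> ('q, 'c) smc \<Rightarrow> ('p, 'b, 'q, 'c) smtrans \<Rightarrow> ('o, 'a, 'p, 'b) smfun
     \<Rightarrow> ('o, 'a, 'q, 'c) smtrans" where
  "whisker_right A C \<sigma> F = \<lparr>
     TSrc = comp_fun A C (TSrc \<sigma>) F,
     TTgt = comp_fun A C (TTgt \<sigma>) F,
     TCmp = (\<lambda>x\<in>Obj A. TCmp \<sigma> (FObj F x))\<rparr>"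


section \<open>The internal hom\<close>

definition interchange :: "('o, 'a) smc \<Rightarrow> 'o \<Rightarrow> 'o \<Rightarrow> 'o \<Rightarrow> 'o \<Rightarrow> 'a" where
  \<comment> \<open>\<open>(w \<otimes> x) \<otimes> (y \<otimes> z) \<rightarrow> (w \<otimes> y) \<otimes> (x \<otimes> z)\<close>\<close>
  "interchange C w x y z =
     Ass C w y (x \<otimes>\<^bsub>C\<^esub> z) \<cdot>\<^bsub>C\<^esub>
     (\<one>\<^bsub>C\<^esub> w \<boxtimes>\<^bsub>C\<^esub> Inv C (Ass C y x z)) \<cdot>\<^bsub>C\<^esub>
     (\<one>\<^bsub>C\<^esub> w \<boxtimes>\<^bsub>C\<^esub> (Sym C x y \<boxtimes>\<^bsub>C\<^esub> \<one>\<^bsub>C\<^esub> z)) \<cdot>\<^bsub>C\<^esub>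
     (\<one>\<^bsub>C\<^esub> w \<boxtimes>\<^bsub>C\<^esub> Ass C x y z) \<cdot>\<^bsub>C\<^esub>
     Inv C (Ass C w x (y \<otimes>\<^bsub>C\<^esub> z))"

definition box_fun ::
  "('o, 'a) smc \<Rightarrow> ('p, 'b) smc \<Rightarrow> ('o, 'a, 'p, 'b) smfun \<Rightarrow> ('o, 'a, 'p, 'b) smfun
     \<Rightarrow> ('o, 'a, 'p, 'b) smfun" where
  "box_fun A B F G = \<lparr>
     FObj = (\<lambda>x\<in>Obj A. FObj F x \<otimes>\<^bsub>B\<^esub> FObj G x),
     FArr = (\<lambda>f\<in>Arr A. FArr F f \<boxtimes>\<^bsub>B\<^esub> FArr G f),
     FUnit = (FUnit F \<boxtimes>\<^bsub>B\<^esub> FUnit G) \<cdot>\<^bsub>B\<^esub> Inv B (Run B \<I>\<^bsub>B\<^esub>),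
     FTen = (\<lambda>(x, y)\<in>Obj A \<times> Obj A.
               (FTen F (x, y) \<boxtimes>\<^bsub>B\<^esub> FTen G (x, y)) \<cdot>\<^bsub>B\<^esub>
               interchange B (FObj F x) (FObj G x) (FObj F y) (FObj G y))\<rparr>"

definition const_fun :: "('o, 'a) smc \<Rightarrow> ('p, 'b) smc \<Rightarrow> ('o, 'a, 'p, 'b) smfun" where
  "const_fun A B = \<lparr>
     FObj = (\<lambda>x\<in>Obj A. \<I>\<^bsub>B\<^esub>),
     FArr = (\<lambda>f\<in>Arr A. \<one>\<^bsub>B\<^esub> \<I>\<^bsub>B\<^esub>),
     FUnit = \<one>\<^bsub>B\<^esub> \<I>\<^bsub>B\<^esub>,
     FTen = (\<lambda>(x, y)\<in>Obj A \<times> Obj A. Run B \<I>\<^bsub>B\<^esub>)\<rparr>"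

definition hom_smc ::
  "('o, 'a) smc \<Rightarrow> ('p, 'b) smc \<Rightarrow> (('o, 'a, 'p, 'b) smfun, ('o, 'a, 'p, 'b) smtrans) smc" where
  "hom_smc A B = \<lparr>
     Obj = {F. sm_functor A B F},
     Arr = {\<sigma>. sm_transformation A B \<sigma>},
     Dom = TSrc,
     Cod = TTgt,
     Idt = (\<lambda>F. \<lparr>TSrc = F, TTgt = F, TCmp = (\<lambda>x\<in>Obj A. \<one>\<^bsub>B\<^esub> (FObj F x))\<rparr>),
     Cmp = (\<lambda>\<tau> \<sigma>. \<lparr>TSrc = TSrc \<sigma>, TTgt = TTgt \<tau>, TCmp = (\<lambda>x\<in>Obj A. TCmp \<tau> x \<cdot>\<^bsub>B\<^esub> TCmp \<sigma> x)\<rparr>),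
     Unit = const_fun A B,
     Tobj = box_fun A B,
     Tarr = (\<lambda>\<sigma> \<tau>. \<lparr>TSrc = box_fun A B (TSrc \<sigma>) (TSrc \<tau>),
                    TTgt = box_fun A B (TTgt \<sigma>) (TTgt \<tau>),
                    TCmp = (\<lambda>x\<in>Obj A. TCmp \<sigma> x \<boxtimes>\<^bsub>B\<^esub> TCmp \<tau> x)\<rparr>),
     Ass = (\<lambda>F G H. \<lparr>TSrc = box_fun A B F (box_fun A B G H),
                     TTgt = box_fun A B (box_fun A B F G) H,
                     TCmp = (\<lambda>x\<in>Obj A. Ass B (FObj F x) (FObj G x) (FObj H x))\<rparr>),
     Run = (\<lambda>F. \<lparr>TSrc = box_fun A B F (const_fun A B),
                 TTgt = F,
                 TCmp = (\<lambda>x\<in>Obj A. Run B (FObj F x))\<rparr>),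
     Lun = (\<lambda>F. \<lparr>TSrc = box_fun A B (const_fun A B) F,
                 TTgt = F,
                 TCmp = (\<lambda>x\<in>Obj A. Lun B (FObj F x))\<rparr>),
     Sym = (\<lambda>F G. \<lparr>TSrc = box_fun A B F G,
                   TTgt = box_fun A B G F,
                   TCmp = (\<lambda>x\<in>Obj A. Sym B (FObj F x) (FObj G x))\<rparr>)\<rparr>"

definition ev ::
  "('o, 'a) smc \<Rightarrow> ('p, 'b) smc \<Rightarrow> 'o
     \<Rightarrow> (('o, 'a, 'p, 'b) smfun, ('o, 'a, 'p, 'b) smtrans, 'p, 'b) smfun" where
  "ev A B a = \<lparr>
     FObj = (\<lambda>F\<in>Obj (hom_smc A B). FObj F a),
     FArr = (\<lambda>\<sigma>\<in>Arr (hom_smc A B). TCmp \<sigma> a),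
     FUnit = \<one>\<^bsub>B\<^esub> \<I>\<^bsub>B\<^esub>,
     FTen = (\<lambda>(F, G)\<in>Obj (hom_smc A B) \<times> Obj (hom_smc A B). \<one>\<^bsub>B\<^esub> (FObj F a \<otimes>\<^bsub>B\<^esub> FObj G a))\<rparr>"

definition dual_obj ::
  "('o, 'a) smc \<Rightarrow> ('o, 'a, ('p, 'b, 'q, 'c) smfun, ('p, 'b, 'q, 'c) smtrans) smfun \<Rightarrow> 'p
     \<Rightarrow> ('o, 'a, 'q, 'c) smfun" where
  "dual_obj A F b = \<lparr>
     FObj = (\<lambda>a\<in>Obj A. FObj (FObj F a) b),
     FArr = (\<lambda>f\<in>Arr A. TCmp (FArr F f) b),
     FUnit = TCmp (FUnit F) b,
     FTen = (\<lambda>(a, a')\<in>Obj A \<times> Obj A. TCmp (FTen F (a, a')) b)\<rparr>"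

definition dual ::
  "('o, 'a) smc \<Rightarrow> ('p, 'b) smc \<Rightarrow> ('q, 'c) smc
     \<Rightarrow> ('o, 'a, ('p, 'b, 'q, 'c) smfun, ('p, 'b, 'q, 'c) smtrans) smfun
     \<Rightarrow> ('p, 'b, ('o, 'a, 'q, 'c) smfun, ('o, 'a, 'q, 'c) smtrans) smfun" where
  "dual A B C F = \<lparr>
     FObj = (\<lambda>b\<in>Obj B. dual_obj A F b),
     FArr = (\<lambda>g\<in>Arr B. \<lparr>TSrc = dual_obj A F (Dom B g),
                        TTgt = dual_obj A F (Cod B g),
                        TCmp = (\<lambda>a\<in>Obj A. FArr (FObj F a) g)\<rparr>),
     FUnit = \<lparr>TSrc = \<I>\<^bsub>hom_smc A C\<^esub>,
              TTgt = dual_obj A F \<I>\<^bsub>B\<^esub>,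
              TCmp = (\<lambda>a\<in>Obj A. FUnit (FObj F a))\<rparr>,
     FTen = (\<lambda>(b, b')\<in>Obj B \<times> Obj B.
               \<lparr>TSrc = dual_obj A F b \<otimes>\<^bsub>hom_smc A C\<^esub> dual_obj A F b',
                TTgt = dual_obj A F (b \<otimes>\<^bsub>B\<^esub> b'),
                TCmp = (\<lambda>a\<in>Obj A. FTen (FObj F a) (b, b'))\<rparr>)\<rparr>"


section \<open>Adjunctions in the 2-category of symmetric monoidal categories\<close>

text \<open>
  Vertical composition of 2-cells is composition in \<^term>\<open>hom_smc A B\<close>. In the triangle identities
  the composites \<open>(L R) L\<close> and \<open>L (R L)\<close> of 1-cells agree on the nose.
\<close>

locale sm_adjunction =
  L: sm_functor A B L + R: sm_functor B A R
  for A :: "('o, 'a) smc" and B :: "('p, 'b) smc"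
    and L :: "('o, 'a, 'p, 'b) smfun" and R :: "('p, 'b, 'o, 'a) smfun"
    and \<eta> :: "('o, 'a, 'o, 'a) smtrans" and \<epsilon> :: "('p, 'b, 'p, 'b) smtrans" +
  assumes unit_hom: "\<eta> \<in> Hom (hom_smc A A) (id_fun A) (comp_fun A A R L)"
    and counit_hom: "\<epsilon> \<in> Hom (hom_smc B B) (comp_fun B B L R) (id_fun B)"
    and triangle_left:
      "whisker_right A B \<epsilon> L \<cdot>\<^bsub>hom_smc A B\<^esub> whisker_left A B L \<eta> = \<one>\<^bsub>hom_smc A B\<^esub> L"
    and triangle_right:
      "whisker_left B A R \<epsilon> \<cdot>\<^bsub>hom_smc B A\<^esub> whisker_right B A \<eta> R = \<one>\<^bsub>hom_smc B A\<^esub> R"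

definition has_right_adjoint ::
  "('o, 'a) smc \<Rightarrow> ('p, 'b) smc \<Rightarrow> ('o, 'a, 'p, 'b) smfun \<Rightarrow> ('p, 'b, 'o, 'a) smfun \<Rightarrow> bool" where
  "has_right_adjoint A B L R \<longleftrightarrow> (\<exists>\<eta> \<epsilon>. sm_adjunction A B L R \<eta> \<epsilon>)"


section \<open>The free symmetric monoidal category on one object\<close>

datatype word = WUnit | Star | WTen word word

text \<open>\<open>TenL w t\<close> and \<open>TenR t w\<close> stand for the tensors of \<open>t\<close> with the object \<open>w\<close> on the left and right.\<close>

datatype aterm =
    TId word
  | TAss word word word
  | TAssInv word word word
  | TRun word
  | TRunInv word
  | TLun word
  | TLunInv word
  | TSym word word
  | TComp aterm aterm
  | TenL word aterm
  | TenR aterm word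

primrec tsrc :: "aterm \<Rightarrow> word" where
  "tsrc (TId a) = a"
| "tsrc (TAss a b c) = WTen a (WTen b c)"
| "tsrc (TAssInv a b c) = WTen (WTen a b) c"
| "tsrc (TRun a) = WTen a WUnit"
| "tsrc (TRunInv a) = a"
| "tsrc (TLun a) = WTen WUnit a"
| "tsrc (TLunInv a) = a"
| "tsrc (TSym a b) = WTen a b"
| "tsrc (TComp t u) = tsrc u"
| "tsrc (TenL a t) = WTen a (tsrc t)"
| "tsrc (TenR t a) = WTen (tsrc t) a"

primrec ttgt :: "aterm \<Rightarrow> word" where
  "ttgt (TId a) = a"
| "ttgt (TAss a b c) = WTen (WTen a b) c"
| "ttgt (TAssInv a b c) = WTen a (WTen b c)"
| "ttgt (TRun a) = a"
| "ttgt (TRunInv a) = WTen a WUnit"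
| "ttgt (TLun a) = a"
| "ttgt (TLunInv a) = WTen WUnit a"
| "ttgt (TSym a b) = WTen b a"
| "ttgt (TComp t u) = ttgt t"
| "ttgt (TenL a t) = WTen a (ttgt t)"
| "ttgt (TenR t a) = WTen (ttgt t) a"

primrec wf_term :: "aterm \<Rightarrow> bool" where
  "wf_term (TId a) \<longleftrightarrow> True"
| "wf_term (TAss a b c) \<longleftrightarrow> True"
| "wf_term (TAssInv a b c) \<longleftrightarrow> True"
| "wf_term (TRun a) \<longleftrightarrow> True"
| "wf_term (TRunInv a) \<longleftrightarrow> True"
| "wf_term (TLun a) \<longleftrightarrow> True"
| "wf_term (TLunInv a) \<longleftrightarrow> True"
| "wf_term (TSym a b) \<longleftrightarrow> True"
| "wf_term (TComp t u) \<longleftrightarrow> wf_term t \<and> wf_term u \<and> tsrc t = ttgt u"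
| "wf_term (TenL a t) \<longleftrightarrow> wf_term t"
| "wf_term (TenR t a) \<longleftrightarrow> wf_term t"

text \<open>The least congruence on well-formed terms that yields a symmetric monoidal category.\<close>

inductive teq :: "aterm \<Rightarrow> aterm \<Rightarrow> bool" (infix "\<approx>" 50) where
  refl: "wf_term t \<Longrightarrow> t \<approx> t"
| sym: "t \<approx> u \<Longrightarrow> u \<approx> t"
| trans: "t \<approx> u \<Longrightarrow> u \<approx> v \<Longrightarrow> t \<approx> v"
| cong_comp: "t \<approx> t' \<Longrightarrow> u \<approx> u' \<Longrightarrow> tsrc t = ttgt u \<Longrightarrow> TComp t u \<approx> TComp t' u'"
| cong_tenL: "t \<approx> t' \<Longrightarrow> TenL a t \<approx> TenL a t'"
| cong_tenR: "t \<approx> t' \<Longrightarrow> TenR t a \<approx> TenR t' a"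
| id_left: "wf_term t \<Longrightarrow> TComp (TId (ttgt t)) t \<approx> t"
| id_right: "wf_term t \<Longrightarrow> TComp t (TId (tsrc t)) \<approx> t"
| assoc: "wf_term t \<Longrightarrow> wf_term u \<Longrightarrow> wf_term v \<Longrightarrow> tsrc t = ttgt u \<Longrightarrow> tsrc u = ttgt v \<Longrightarrow>
    TComp (TComp t u) v \<approx> TComp t (TComp u v)"
| tenL_id: "TenL a (TId b) \<approx> TId (WTen a b)"
| tenR_id: "TenR (TId a) b \<approx> TId (WTen a b)"
| tenL_comp: "wf_term t \<Longrightarrow> wf_term u \<Longrightarrow> tsrc t = ttgt u \<Longrightarrow>
    TenL a (TComp t u) \<approx> TComp (TenL a t) (TenL a u)"
| tenR_comp: "wf_term t \<Longrightarrow> wf_term u \<Longrightarrow> tsrc t = ttgt u \<Longrightarrow>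
    TenR (TComp t u) a \<approx> TComp (TenR t a) (TenR u a)"
| tenL_tenR: "wf_term t \<Longrightarrow> wf_term u \<Longrightarrow>
    TComp (TenR t (ttgt u)) (TenL (tsrc t) u) \<approx> TComp (TenL (ttgt t) u) (TenR t (tsrc u))"
| ass_inv1: "TComp (TAssInv a b c) (TAss a b c) \<approx> TId (WTen a (WTen b c))"
| ass_inv2: "TComp (TAss a b c) (TAssInv a b c) \<approx> TId (WTen (WTen a b) c)"
| run_inv1: "TComp (TRunInv a) (TRun a) \<approx> TId (WTen a WUnit)"
| run_inv2: "TComp (TRun a) (TRunInv a) \<approx> TId a"
| lun_inv1: "TComp (TLunInv a) (TLun a) \<approx> TId (WTen WUnit a)"
| lun_inv2: "TComp (TLun a) (TLunInv a) \<approx> TId a"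
| ass_nat1: "wf_term t \<Longrightarrow>
    TComp (TAss (ttgt t) b c) (TenR t (WTen b c)) \<approx> TComp (TenR (TenR t b) c) (TAss (tsrc t) b c)"
| ass_nat2: "wf_term t \<Longrightarrow>
    TComp (TAss a (ttgt t) c) (TenL a (TenR t c)) \<approx> TComp (TenR (TenL a t) c) (TAss a (tsrc t) c)"
| ass_nat3: "wf_term t \<Longrightarrow>
    TComp (TAss a b (ttgt t)) (TenL a (TenL b t)) \<approx> TComp (TenL (WTen a b) t) (TAss a b (tsrc t))"
| run_nat: "wf_term t \<Longrightarrow> TComp (TRun (ttgt t)) (TenR t WUnit) \<approx> TComp t (TRun (tsrc t))"
| lun_nat: "wf_term t \<Longrightarrow> TComp (TLun (ttgt t)) (TenL WUnit t) \<approx> TComp t (TLun (tsrc t))"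
| sym_nat1: "wf_term t \<Longrightarrow> TComp (TSym (ttgt t) b) (TenR t b) \<approx> TComp (TenL b t) (TSym (tsrc t) b)"
| sym_nat2: "wf_term t \<Longrightarrow> TComp (TSym a (ttgt t)) (TenL a t) \<approx> TComp (TenR t a) (TSym a (tsrc t))"
| pentagon: "TComp (TAss (WTen a b) c d) (TAss a b (WTen c d)) \<approx>
    TComp (TComp (TenR (TAss a b c) d) (TAss a (WTen b c) d)) (TenL a (TAss b c d))"
| triangle: "TComp (TenR (TRun a) b) (TAss a WUnit b) \<approx> TenL a (TLun b)"
| sym_sym: "TComp (TSym b a) (TSym a b) \<approx> TId (WTen a b)"
| sym_unit: "TComp (TLun a) (TSym a WUnit) \<approx> TRun a"
| hexagon: "TComp (TComp (TAss c a b) (TSym (WTen a b) c)) (TAss a b c) \<approx>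
    TComp (TComp (TenR (TSym a c) b) (TAss a c b)) (TenL a (TSym b c))"

lemma teq_typed: "t \<approx> u \<Longrightarrow> wf_term t \<and> wf_term u \<and> tsrc t = tsrc u \<and> ttgt t = ttgt u"
  by (induction rule: teq.induct) auto

quotient_type farr = aterm / partial: teq
proof (rule part_equivpI)
  show "\<exists>t. t \<approx> t"
    using teq.refl[of "TId WUnit"] by auto
  show "symp (\<approx>)"
    by (rule sympI) (rule teq.sym)
  show "transp (\<approx>)"
    by (rule transpI) (rule teq.trans)
qed

lift_definition fdom :: "farr \<Rightarrow> word" is tsrc
  by (simp add: teq_typed)

lift_definition fcod :: "farr \<Rightarrow> word" is ttgt
  by (simp add: teq_typed)

text \<open>The value for non-composable arguments is junk.\<close>

lift_definition fcomp :: "farr \<Rightarrow> farr \<Rightarrow> farr" is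
  "\<lambda>t u. if tsrc t = ttgt u then TComp t u else TId WUnit"
proof -
  fix t t' u u'
  assume "t \<approx> t'" "u \<approx> u'"
  moreover from this have "ttgt u' = ttgt u" "tsrc t' = tsrc t"
    by (simp_all add: teq_typed)
  ultimately show "(if tsrc t = ttgt u then TComp t u else TId WUnit) \<approx>
                   (if tsrc t' = ttgt u' then TComp t' u' else TId WUnit)"
    by (simp add: teq.cong_comp teq.refl)
qed

lift_definition ften :: "farr \<Rightarrow> farr \<Rightarrow> farr" is
  "\<lambda>t u. TComp (TenR t (ttgt u)) (TenL (tsrc t) u)"
proof -
  fix t t' u u'
  assume "t \<approx> t'" "u \<approx> u'"
  moreover from this have "ttgt u' = ttgt u" "tsrc t' = tsrc t"
    by (simp_all add: teq_typed)
  ultimately show "TComp (TenR t (ttgt u)) (TenL (tsrc t) u) \<approx>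
                   TComp (TenR t' (ttgt u')) (TenL (tsrc t') u')"
    by (simp add: teq.cong_comp teq.cong_tenL teq.cong_tenR)
qed

lift_definition fid :: "word \<Rightarrow> farr" is TId by (simp add: teq.refl)
lift_definition fass :: "word \<Rightarrow> word \<Rightarrow> word \<Rightarrow> farr" is TAss by (simp add: teq.refl)
lift_definition frun :: "word \<Rightarrow> farr" is TRun by (simp add: teq.refl)
lift_definition flun :: "word \<Rightarrow> farr" is TLun by (simp add: teq.refl)
lift_definition fsym :: "word \<Rightarrow> word \<Rightarrow> farr" is TSym by (simp add: teq.refl)

definition free_smc :: "(word, farr) smc" where
  "free_smc = \<lparr>
     Obj = UNIV, Arr = UNIV, Dom = fdom, Cod = fcod, Idt = fid, Cmp = fcomp,
     Unit = WUnit, Tobj = WTen, Tarr = ften,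
     Ass = fass, Run = frun, Lun = flun, Sym = fsym\<rparr>"

definition free_ext :: "('o, 'a) smc \<Rightarrow> 'o \<Rightarrow> (word, farr, 'o, 'a) smfun" where
  "free_ext X x = (THE F. strict_sm_functor free_smc X F \<and> FObj F Star = x)"

definition v_fun ::
  "('o, 'a) smc \<Rightarrow> (word, farr, ('o, 'a, 'o, 'a) smfun, ('o, 'a, 'o, 'a) smtrans) smfun" where
  "v_fun A = free_ext (hom_smc A A) (id_fun A)"

end

theory Submission
  imports Defs
begin

text \<open>
  Let \<open>\<I>\<close> be the free symmetric monoidal category \<open>free_smc\<close>. The functor \<open>v\<^sup>*(a)\<close> is the strict
  functor \<open>\<I> \<rightarrow> \<A>\<close> with value \<open>a\<close> at \<open>\<star>\<close>: it sends a word to the tensor power of \<open>a\<close> of that shape.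
  The reason for the adjunction is that \<open>\<I>\<close> is free also with respect to lax functors and
  transformations: if \<open>S : \<I> \<rightarrow> \<A>\<close> is strict and \<open>F : \<I> \<rightarrow> \<A>\<close> is lax, then every arrow \<open>S \<star> \<rightarrow> F \<star>\<close>
  is the component at \<open>\<star>\<close> of exactly one monoidal transformation \<open>S \<rightarrow> F\<close>. It exists because the
  components at \<open>I\<close> and at \<open>w \<otimes> w'\<close> may be read off from \<open>F\<^sup>0\<close> and \<open>F\<^sup>2\<close>, and naturality need only
  be checked on the generating arrows of \<open>\<I>\<close> (\<open>extension_transformation\<close>). It is unique because
  the monoidality axioms force those components (\<open>transformation_unique\<close>). So evaluation at \<open>\<star>\<close> is
  a bijection from the transformations \<open>v\<^sup>*(a) \<rightarrow> F\<close> to the arrows \<open>a \<rightarrow> F \<star>\<close>.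

  Accordingly the unit of the adjunction is an identity, and the counit at \<open>F\<close> is the extension of
  the identity of \<open>F \<star>\<close>. One triangle identity says just that its component at \<open>\<star>\<close> is an identity.
  The other one, like naturality and monoidality of the counit, is an equation between monoidal
  transformations out of a functor on \<open>\<I>\<close> that is strong (its structure arrows are invertible), so
  it suffices to compare the components at \<open>\<star>\<close>, which agree at sight. Uniqueness has to be stated
  for strong sources and not just for strict ones because of monoidality: there the source is a
  pointwise tensor of two strict functors, whose structure arrows involve the interchange.

  Three facts make this meaningful: \<open>[\<A>, \<B>]\<close> is a symmetric monoidal category
  (\<open>hom_smc_symmetric_monoidal\<close>), \<open>\<I>\<close> is one and has its universal property
  (\<open>free_smc_symmetric_monoidal\<close>, \<open>free_ext_strict\<close>), and duals are symmetric monoidal functors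
  (\<open>dual_functor\<close>). The first and the last are pointwise verifications once the coherence
  equations are known for the interchange \<open>(w \<otimes> x) \<otimes> (y \<otimes> z) \<rightarrow> (w \<otimes> y) \<otimes> (x \<otimes> z)\<close>, which say that
  it makes \<open>\<otimes>\<close> itself a symmetric monoidal functor. They are proved by letting the category act on
  itself: an arrow \<open>f\<close> is determined by the arrows \<open>f \<otimes> q\<close>, and once tensor products acting on \<open>q\<close>
  are rebracketed as \<open>a \<otimes> (b \<otimes> (c \<otimes> \<dots> q))\<close>, associativity and unit arrows turn into identities and
  only transpositions \<open>a \<otimes> (b \<otimes> q) \<rightarrow> b \<otimes> (a \<otimes> q)\<close> are left.
\<close>

section \<open>Calculating with arrows\<close>

lemma Hom_iff: "f \<in> Hom C a b \<longleftrightarrow> f \<in> Arr C \<and> Dom C f = a \<and> Cod C f = b"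
  by (simp add: Hom_def)

context category
begin

lemma idt_simps [simp]:
  assumes "a \<in> Obj C"
  shows "\<one> a \<in> Arr C" "Dom C (\<one> a) = a" "Cod C (\<one> a) = a"
  using idt_hom[OF assms] by (simp_all add: Hom_iff)

lemma cmp_simps [simp]:
  assumes "f \<in> Arr C" "g \<in> Arr C" "Dom C g = Cod C f"
  shows "g \<cdot> f \<in> Arr C" "Dom C (g \<cdot> f) = Dom C f" "Cod C (g \<cdot> f) = Cod C g"
  using cmp_hom[of f "Dom C f" "Cod C f" g "Cod C g"] assms by (simp_all add: Hom_iff)

lemma cmp_idt_simps [simp]:
  assumes "f \<in> Arr C"
  shows "Cod C f = b \<Longrightarrow> \<one> b \<cdot> f = f" "Dom C f = a \<Longrightarrow> f \<cdot> \<one> a = f"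
  using cmp_idt_left[of f "Dom C f" b] cmp_idt_right[of f a "Cod C f"] assms
  by (simp_all add: Hom_iff)

lemma assoc_simp [simp]:
  assumes "f \<in> Arr C" "g \<in> Arr C" "h \<in> Arr C" "Dom C g = Cod C f" "Dom C h = Cod C g"
  shows "(h \<cdot> g) \<cdot> f = h \<cdot> (g \<cdot> f)"
  using cmp_assoc[of f "Dom C f" "Cod C f" g "Cod C g" h "Cod C h"] assms by (simp add: Hom_iff)

declare dom_obj [simp] cod_obj [simp]

lemma inverse_arrows_unique:
  assumes "inverse_arrows C f g" "inverse_arrows C f h"
  shows "g = h"
proof -
  have "g = \<one> (Dom C f) \<cdot> g"
    using assms(1) by (simp add: inverse_arrows_def Hom_iff)
  also have "\<dots> = (h \<cdot> f) \<cdot> g"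
    using assms(2) by (simp add: inverse_arrows_def)
  also have "\<dots> = h \<cdot> (f \<cdot> g)"
    using assms by (intro assoc_simp) (simp_all add: inverse_arrows_def Hom_iff)
  also have "\<dots> = h"
    using assms by (simp add: inverse_arrows_def Hom_iff)
  finally show ?thesis .
qed

lemma Inv_eq: "inverse_arrows C f g \<Longrightarrow> Inv C f = g"
  unfolding Inv_def using inverse_arrows_unique by blast

lemma iso_Inv: "iso C f \<Longrightarrow> inverse_arrows C f (Inv C f)"
  using Inv_eq by (auto simp: iso_def)

lemma iso_simps [simp]:
  assumes "iso C f"
  shows "f \<in> Arr C" "Inv C f \<in> Arr C" "Dom C (Inv C f) = Cod C f" "Cod C (Inv C f) = Dom C f"
    "Inv C f \<cdot> f = \<one> (Dom C f)" "f \<cdot> Inv C f = \<one> (Cod C f)"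
  using iso_Inv[OF assms] by (simp_all add: inverse_arrows_def Hom_iff)

lemma iso_cancel_simps [simp]:
  assumes "iso C f" "h \<in> Arr C"
  shows "Cod C h = Dom C f \<Longrightarrow> Inv C f \<cdot> (f \<cdot> h) = h"
    "Cod C h = Cod C f \<Longrightarrow> f \<cdot> (Inv C f \<cdot> h) = h"
  using assms by (simp_all flip: assoc_simp)

lemma isoI:
  assumes "f \<in> Arr C" "g \<in> Arr C" "Dom C g = Cod C f" "Cod C g = Dom C f"
    "g \<cdot> f = \<one> (Dom C f)" "f \<cdot> g = \<one> (Cod C f)"
  shows "iso C f" "Inv C f = g"
proof -
  have "inverse_arrows C f g"
    using assms by (simp add: inverse_arrows_def Hom_iff)
  then show "iso C f" "Inv C f = g"
    by (auto simp: iso_def Inv_eq)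
qed

lemma iso_idt [simp]: "a \<in> Obj C \<Longrightarrow> iso C (\<one> a)"
  and Inv_idt [simp]: "a \<in> Obj C \<Longrightarrow> Inv C (\<one> a) = \<one> a"
  by (rule isoI[where g = "\<one> a"]; simp)+

lemma iso_Inv_iso [simp]: "iso C f \<Longrightarrow> iso C (Inv C f)"
  by (rule isoI(1)[where g = f]) simp_all

lemma iso_cmp [simp]:
  assumes "iso C f" "iso C g" "Dom C g = Cod C f"
  shows "iso C (g \<cdot> f)"
  using assms by (intro isoI(1)[where g = "Inv C f \<cdot> Inv C g"]) simp_all

lemma Inv_cmp [simp]:
  assumes "iso C f" "iso C g" "Dom C g = Cod C f"
  shows "Inv C (g \<cdot> f) = Inv C f \<cdot> Inv C g"
  using assms by (intro isoI(2)) simp_all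

lemma Inv_Inv [simp]: "iso C f \<Longrightarrow> Inv C (Inv C f) = f"
  by (rule isoI(2)) simp_all

lemma iso_epi:
  assumes "g \<cdot> f = h \<cdot> f" "iso C f" "g \<in> Arr C" "h \<in> Arr C" "Dom C g = Cod C f" "Dom C h = Cod C f"
  shows "g = h"
proof -
  have "(g \<cdot> f) \<cdot> Inv C f = (h \<cdot> f) \<cdot> Inv C f"
    by (simp add: assms(1))
  then show ?thesis
    using assms(2-) by simp
qed

lemma iso_mono:
  assumes "f \<cdot> g = f \<cdot> h" "iso C f" "g \<in> Arr C" "h \<in> Arr C" "Cod C g = Dom C f" "Cod C h = Dom C f"
  shows "g = h"
proof -
  have "Inv C f \<cdot> (f \<cdot> g) = Inv C f \<cdot> (f \<cdot> h)"
    by (simp add: assms(1))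
  then show ?thesis
    using assms(2-) by simp
qed

end

context symmetric_monoidal_category
begin

declare unit_obj [simp] tobj_obj [simp] ass_iso [simp] run_iso [simp] lun_iso [simp] tarr_idt [simp]

lemma tarr_simps [simp]:
  assumes "f \<in> Arr C" "g \<in> Arr C"
  shows "f \<boxtimes> g \<in> Arr C" "Dom C (f \<boxtimes> g) = Dom C f \<otimes> Dom C g" "Cod C (f \<boxtimes> g) = Cod C f \<otimes> Cod C g"
  using tarr_hom[of f "Dom C f" "Cod C f" g "Dom C g" "Cod C g"] assms by (simp_all add: Hom_iff)

lemma structure_simps [simp]:
  "a \<in> Obj C \<Longrightarrow> b \<in> Obj C \<Longrightarrow> c \<in> Obj C \<Longrightarrow> Dom C (Ass C a b c) = a \<otimes> (b \<otimes> c)"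
  "a \<in> Obj C \<Longrightarrow> b \<in> Obj C \<Longrightarrow> c \<in> Obj C \<Longrightarrow> Cod C (Ass C a b c) = (a \<otimes> b) \<otimes> c"
  "a \<in> Obj C \<Longrightarrow> Dom C (Run C a) = a \<otimes> \<I>" "a \<in> Obj C \<Longrightarrow> Cod C (Run C a) = a"
  "a \<in> Obj C \<Longrightarrow> Dom C (Lun C a) = \<I> \<otimes> a" "a \<in> Obj C \<Longrightarrow> Cod C (Lun C a) = a"
  "a \<in> Obj C \<Longrightarrow> b \<in> Obj C \<Longrightarrow> Dom C (Sym C a b) = a \<otimes> b"
  "a \<in> Obj C \<Longrightarrow> b \<in> Obj C \<Longrightarrow> Cod C (Sym C a b) = b \<otimes> a"
  using ass_hom run_hom lun_hom sym_hom by (simp_all add: Hom_iff)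

lemma sym_iso [simp]: "a \<in> Obj C \<Longrightarrow> b \<in> Obj C \<Longrightarrow> iso C (Sym C a b)"
  and Inv_sym [simp]: "a \<in> Obj C \<Longrightarrow> b \<in> Obj C \<Longrightarrow> Inv C (Sym C a b) = Sym C b a"
proof -
  assume ab: "a \<in> Obj C" "b \<in> Obj C"
  have arr: "Sym C a b \<in> Arr C" "Sym C b a \<in> Arr C"
    using ab sym_hom by (simp_all add: Hom_iff)
  show "iso C (Sym C a b)"
    by (rule isoI(1)[where g = "Sym C b a"]) (simp_all add: ab arr sym_sym)
  show "Inv C (Sym C a b) = Sym C b a"
    by (rule isoI(2)) (simp_all add: ab arr sym_sym)
qed

lemma structure_arr [simp]:
  "a \<in> Obj C \<Longrightarrow> b \<in> Obj C \<Longrightarrow> c \<in> Obj C \<Longrightarrow> Ass C a b c \<in> Arr C"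
  "a \<in> Obj C \<Longrightarrow> Run C a \<in> Arr C" "a \<in> Obj C \<Longrightarrow> Lun C a \<in> Arr C"
  "a \<in> Obj C \<Longrightarrow> b \<in> Obj C \<Longrightarrow> Sym C a b \<in> Arr C"
  by (rule iso_simps(1), simp)+

text \<open>
  Oriented so that the simplifier pushes composition inside tensors; arrows acting on different
  factors then commute without further ado.
\<close>

lemma tarr_merge [simp]:
  assumes "f \<in> Arr C" "g \<in> Arr C" "f' \<in> Arr C" "g' \<in> Arr C" "Dom C f' = Cod C f" "Dom C g' = Cod C g"
  shows "(f' \<boxtimes> g') \<cdot> (f \<boxtimes> g) = (f' \<cdot> f) \<boxtimes> (g' \<cdot> g)"
  using tarr_cmp[of f "Dom C f" "Cod C f" f' "Cod C f'" g "Dom C g" "Cod C g" g' "Cod C g'"] assms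
  by (simp add: Hom_iff)

lemma tarr_merge_cmp [simp]:
  assumes "f \<in> Arr C" "g \<in> Arr C" "f' \<in> Arr C" "g' \<in> Arr C" "Dom C f' = Cod C f" "Dom C g' = Cod C g"
    "k \<in> Arr C" "Cod C k = Dom C f \<otimes> Dom C g"
  shows "(f' \<boxtimes> g') \<cdot> ((f \<boxtimes> g) \<cdot> k) = ((f' \<cdot> f) \<boxtimes> (g' \<cdot> g)) \<cdot> k"
  using assms by (simp flip: tarr_merge)

lemma iso_tarr [simp]:
  assumes "iso C f" "iso C g"
  shows "iso C (f \<boxtimes> g)" "Inv C (f \<boxtimes> g) = Inv C f \<boxtimes> Inv C g"
  by (rule isoI[where g = "Inv C f \<boxtimes> Inv C g"]; simp add: assms)+

lemma ass_nat:
  assumes "f \<in> Arr C" "g \<in> Arr C" "h \<in> Arr C"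
    "Cod C f = a'" "Cod C g = b'" "Cod C h = c'"
  shows "Ass C a' b' c' \<cdot> (f \<boxtimes> (g \<boxtimes> h)) = ((f \<boxtimes> g) \<boxtimes> h) \<cdot> Ass C (Dom C f) (Dom C g) (Dom C h)"
  using ass_natural[of f "Dom C f" a' g "Dom C g" b' h "Dom C h" c'] assms by (simp add: Hom_iff)

lemma ass_nat_cmp:
  assumes "f \<in> Arr C" "g \<in> Arr C" "h \<in> Arr C"
    "Cod C f = a'" "Cod C g = b'" "Cod C h = c'"
    "k \<in> Arr C" "Cod C k = Dom C f \<otimes> (Dom C g \<otimes> Dom C h)"
  shows "Ass C a' b' c' \<cdot> ((f \<boxtimes> (g \<boxtimes> h)) \<cdot> k) =
    ((f \<boxtimes> g) \<boxtimes> h) \<cdot> (Ass C (Dom C f) (Dom C g) (Dom C h) \<cdot> k)"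
proof -
  have "(Ass C a' b' c' \<cdot> (f \<boxtimes> (g \<boxtimes> h))) \<cdot> k = (((f \<boxtimes> g) \<boxtimes> h) \<cdot> Ass C (Dom C f) (Dom C g) (Dom C h)) \<cdot> k"
    using assms(1-6) by (simp only: ass_nat)
  then show ?thesis
    using assms by auto
qed

lemma run_nat:
  assumes "f \<in> Arr C" "Cod C f = a'"
  shows "Run C a' \<cdot> (f \<boxtimes> \<one> \<I>) = f \<cdot> Run C (Dom C f)"
  using run_natural[of f "Dom C f" a'] assms by (simp add: Hom_iff)

lemma lun_nat:
  assumes "f \<in> Arr C" "Cod C f = a'"
  shows "Lun C a' \<cdot> (\<one> \<I> \<boxtimes> f) = f \<cdot> Lun C (Dom C f)"
  using lun_natural[of f "Dom C f" a'] assms by (simp add: Hom_iff)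

lemma sym_nat:
  assumes "f \<in> Arr C" "g \<in> Arr C" "Cod C f = a'" "Cod C g = b'"
  shows "Sym C a' b' \<cdot> (f \<boxtimes> g) = (g \<boxtimes> f) \<cdot> Sym C (Dom C f) (Dom C g)"
  using sym_natural[of f "Dom C f" a' g "Dom C g" b'] assms by (simp add: Hom_iff)

text \<open>
  Tensoring with \<open>\<I>\<close> on the left is faithful, by naturality of \<open>Lun\<close>, so the equation may be
  checked after tensoring; there the pentagon for \<open>\<I>, \<I>, a, b\<close> and the triangle give it. The
  argument is Kelly's.
\<close>

lemma lun_tensor:
  assumes "a \<in> Obj C" "b \<in> Obj C"
  shows "(Lun C a \<boxtimes> \<one> b) \<cdot> Ass C \<I> a b = Lun C (a \<otimes> b)"
proof -
  let ?f = "(Lun C a \<boxtimes> \<one> b) \<cdot> Ass C \<I> a b" and ?g = "Lun C (a \<otimes> b)"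
  note ab = assms
  have "Ass C \<I> a b \<cdot> (\<one> \<I> \<boxtimes> ?f) = (Ass C \<I> a b \<cdot> (\<one> \<I> \<boxtimes> (Lun C a \<boxtimes> \<one> b))) \<cdot> (\<one> \<I> \<boxtimes> Ass C \<I> a b)"
    using ab by simp
  also have "\<dots> = ((\<one> \<I> \<boxtimes> Lun C a) \<boxtimes> \<one> b) \<cdot> (Ass C \<I> (\<I> \<otimes> a) b \<cdot> (\<one> \<I> \<boxtimes> Ass C \<I> a b))"
    using ab by (subst ass_nat) simp_all
  also have "\<dots> = ((Run C \<I> \<boxtimes> \<one> a) \<boxtimes> \<one> b) \<cdot> ((Ass C \<I> \<I> a \<boxtimes> \<one> b) \<cdot> Ass C \<I> (\<I> \<otimes> a) b \<cdot> (\<one> \<I> \<boxtimes> Ass C \<I> a b))"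
    using ab by (simp flip: triangle)
  also have "\<dots> = (((Run C \<I> \<boxtimes> \<one> a) \<boxtimes> \<one> b) \<cdot> Ass C (\<I> \<otimes> \<I>) a b) \<cdot> Ass C \<I> \<I> (a \<otimes> b)"
    using ab by (subst pentagon[symmetric]) (simp_all del: tarr_merge_cmp)
  also have "\<dots> = Ass C \<I> a b \<cdot> ((Run C \<I> \<boxtimes> \<one> (a \<otimes> b)) \<cdot> Ass C \<I> \<I> (a \<otimes> b))"
    using ab ass_nat_cmp[of "Run C \<I>" "\<one> a" "\<one> b" \<I> a b] by simp
  also have "\<dots> = Ass C \<I> a b \<cdot> (\<one> \<I> \<boxtimes> ?g)"
    using ab by (simp add: triangle)
  finally have "\<one> \<I> \<boxtimes> ?f = \<one> \<I> \<boxtimes> ?g"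
    using ab by (elim iso_mono) simp_all
  then have "?f \<cdot> Lun C (\<I> \<otimes> (a \<otimes> b)) = ?g \<cdot> Lun C (\<I> \<otimes> (a \<otimes> b))"
    using ab lun_nat[of ?f "a \<otimes> b"] lun_nat[of ?g "a \<otimes> b"] by simp
  then show ?thesis
    using ab by (elim iso_epi) simp_all
qed

end

section \<open>Coherence by action\<close>

text \<open>
  A tree is a bracketed tensor product of objects in which the unit may occur. The category acts
  on itself by \<open>q \<mapsto> a \<otimes> q\<close>; a tree acts by the composite of the actions of its leaves, read from
  left to right, which forgets both the bracketing and the units.
\<close>

datatype 'o tree = Empty | Leaf 'o | Node "'o tree" "'o tree"

context symmetric_monoidal_category
begin

primrec over :: "'a tree \<Rightarrow> bool" where
  "over Empty \<longleftrightarrow> True"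
| "over (Leaf a) \<longleftrightarrow> a \<in> Obj C"
| "over (Node s t) \<longleftrightarrow> over s \<and> over t"

primrec tens :: "'a tree \<Rightarrow> 'a" where
  "tens Empty = \<I>"
| "tens (Leaf a) = a"
| "tens (Node s t) = tens s \<otimes> tens t"

primrec act :: "'a tree \<Rightarrow> 'a \<Rightarrow> 'a" where
  "act Empty q = q"
| "act (Leaf a) q = a \<otimes> q"
| "act (Node s t) q = act s (act t q)"

primrec act_arr :: "'a tree \<Rightarrow> 'b \<Rightarrow> 'b" where
  "act_arr Empty f = f"
| "act_arr (Leaf a) f = \<one> a \<boxtimes> f"
| "act_arr (Node s t) f = act_arr s (act_arr t f)"

text \<open>
  The canonical isomorphism \<open>act t q \<rightarrow> tens t \<otimes> q\<close>.
\<close>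

primrec collapse :: "'a tree \<Rightarrow> 'a \<Rightarrow> 'b" where
  "collapse Empty q = Inv C (Lun C q)"
| "collapse (Leaf a) q = \<one> (a \<otimes> q)"
| "collapse (Node s t) q = Ass C (tens s) (tens t) q \<cdot> ((\<one> (tens s) \<boxtimes> collapse t q) \<cdot> collapse s (act t q))"

lemma tens_obj [simp]: "over t \<Longrightarrow> tens t \<in> Obj C"
  by (induction t) auto

lemma act_obj [simp]: "over t \<Longrightarrow> q \<in> Obj C \<Longrightarrow> act t q \<in> Obj C"
  by (induction t arbitrary: q) auto

lemma act_arr_simps [simp]:
  assumes "over t"
  shows "f \<in> Arr C \<Longrightarrow> act_arr t f \<in> Arr C"
    "f \<in> Arr C \<Longrightarrow> Dom C (act_arr t f) = act t (Dom C f)"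
    "f \<in> Arr C \<Longrightarrow> Cod C (act_arr t f) = act t (Cod C f)"
  using assms by (induction t arbitrary: f) auto

lemma act_arr_idt [simp]: "over t \<Longrightarrow> q \<in> Obj C \<Longrightarrow> act_arr t (\<one> q) = \<one> (act t q)"
  by (induction t arbitrary: q) auto

lemma collapse_iso [simp]:
  assumes "over t" "q \<in> Obj C"
  shows "iso C (collapse t q)" "Dom C (collapse t q) = act t q" "Cod C (collapse t q) = tens t \<otimes> q"
proof -
  have "iso C (collapse t q) \<and> Dom C (collapse t q) = act t q \<and> Cod C (collapse t q) = tens t \<otimes> q"
    using assms by (induction t arbitrary: q) auto
  then show "iso C (collapse t q)" "Dom C (collapse t q) = act t q" "Cod C (collapse t q) = tens t \<otimes> q"
    by auto
qed

lemma collapse_arr [simp]: "over t \<Longrightarrow> q \<in> Obj C \<Longrightarrow> collapse t q \<in> Arr C"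
  by (rule iso_simps(1)) simp

lemma lun_inv_nat:
  assumes "f \<in> Arr C"
  shows "Inv C (Lun C (Cod C f)) \<cdot> f = (\<one> \<I> \<boxtimes> f) \<cdot> Inv C (Lun C (Dom C f))"
proof (rule iso_mono[where f = "Lun C (Cod C f)"])
  have "Lun C (Cod C f) \<cdot> ((\<one> \<I> \<boxtimes> f) \<cdot> Inv C (Lun C (Dom C f))) =
    (Lun C (Cod C f) \<cdot> (\<one> \<I> \<boxtimes> f)) \<cdot> Inv C (Lun C (Dom C f))"
    using assms by simp
  also have "\<dots> = f"
    using assms by (subst lun_nat) simp_all
  finally show "Lun C (Cod C f) \<cdot> (Inv C (Lun C (Cod C f)) \<cdot> f) =
    Lun C (Cod C f) \<cdot> ((\<one> \<I> \<boxtimes> f) \<cdot> Inv C (Lun C (Dom C f)))"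
    using assms by simp
qed (use assms in simp_all)

lemma collapse_natural:
  assumes "over t" "f \<in> Arr C"
  shows "collapse t (Cod C f) \<cdot> act_arr t f = (\<one> (tens t) \<boxtimes> f) \<cdot> collapse t (Dom C f)"
  using assms
proof (induction t arbitrary: f)
  case Empty
  then show ?case by (simp add: lun_inv_nat)
next
  case (Leaf a)
  then show ?case by simp
next
  case (Node s t)
  let ?S = "tens s" and ?T = "tens t" and ?p = "Dom C f" and ?q = "Cod C f"
  have "collapse (Node s t) ?q \<cdot> act_arr (Node s t) f =
    Ass C ?S ?T ?q \<cdot> ((\<one> ?S \<boxtimes> collapse t ?q) \<cdot> (collapse s (act t ?q) \<cdot> act_arr s (act_arr t f)))"
    using Node.prems by simp
  also have "collapse s (act t ?q) \<cdot> act_arr s (act_arr t f) = (\<one> ?S \<boxtimes> act_arr t f) \<cdot> collapse s (act t ?p)"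
    using Node.IH(1)[of "act_arr t f"] Node.prems by simp
  also have "(\<one> ?S \<boxtimes> collapse t ?q) \<cdot> \<dots> = (\<one> ?S \<boxtimes> (\<one> ?T \<boxtimes> f)) \<cdot> ((\<one> ?S \<boxtimes> collapse t ?p) \<cdot> collapse s (act t ?p))"
    using Node.IH(2)[of f] Node.prems by simp
  also have "Ass C ?S ?T ?q \<cdot> \<dots> = (\<one> (?S \<otimes> ?T) \<boxtimes> f) \<cdot> collapse (Node s t) ?p"
    using Node.prems by (subst ass_nat_cmp) simp_all
  finally show ?case by simp
qed

text \<open>
  The family \<open>\<phi>\<close> is what \<open>f \<otimes> q\<close> becomes between the rebracketed objects. Structural arrows are
  represented by simpler families than themselves, and \<open>f\<close> is determined by \<open>\<phi>\<close>; so an equation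
  between structural arrows can be checked on the representing families.
\<close>

definition represents :: "'a tree \<Rightarrow> 'a tree \<Rightarrow> 'b \<Rightarrow> ('a \<Rightarrow> 'b) \<Rightarrow> bool" where
  "represents s t f \<phi> \<longleftrightarrow> over s \<and> over t \<and> f \<in> Hom C (tens s) (tens t) \<and>
     (\<forall>q\<in>Obj C. \<phi> q \<in> Hom C (act s q) (act t q) \<and>
        (f \<boxtimes> \<one> q) \<cdot> collapse s q = collapse t q \<cdot> \<phi> q)"

text \<open>
  At \<open>q = \<I>\<close> the family determines \<open>f \<otimes> \<I>\<close>, hence \<open>f\<close> by naturality of \<open>Run\<close>.
\<close>

lemma represents_unique:
  assumes "represents s t f \<phi>" "represents s t g \<psi>" "\<And>q. q \<in> Obj C \<Longrightarrow> \<phi> q = \<psi> q"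
  shows "f = g"
proof -
  have st: "over s" "over t" "f \<in> Arr C" "Dom C f = tens s" "Cod C f = tens t"
    "g \<in> Arr C" "Dom C g = tens s" "Cod C g = tens t"
    using assms(1,2) by (simp_all add: represents_def Hom_iff)
  have "(f \<boxtimes> \<one> \<I>) \<cdot> collapse s \<I> = (g \<boxtimes> \<one> \<I>) \<cdot> collapse s \<I>"
    using assms by (simp add: represents_def)
  then have "f \<boxtimes> \<one> \<I> = g \<boxtimes> \<one> \<I>"
    using st by (elim iso_epi) simp_all
  then have "f \<cdot> Run C (tens s) = g \<cdot> Run C (tens s)"
    using st run_nat[of f "tens t"] run_nat[of g "tens t"] by simp
  then show ?thesis
    using st by (elim iso_epi) simp_all
qed

lemma represents_idt:
  assumes "over s"
  shows "represents s s (\<one> (tens s)) (\<lambda>q. \<one> (act s q))"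
  using assms by (simp add: represents_def Hom_iff)

lemma represents_cmp:
  assumes "represents s t f \<phi>" "represents t u g \<psi>"
  shows "represents s u (g \<cdot> f) (\<lambda>q. \<psi> q \<cdot> \<phi> q)"
proof -
  have st: "over s" "over t" "over u" "f \<in> Arr C" "Dom C f = tens s" "Cod C f = tens t"
    "g \<in> Arr C" "Dom C g = tens t" "Cod C g = tens u"
    using assms by (simp_all add: represents_def Hom_iff)
  have "((g \<cdot> f) \<boxtimes> \<one> q) \<cdot> collapse s q = collapse u q \<cdot> (\<psi> q \<cdot> \<phi> q)" if q: "q \<in> Obj C" for q
  proof -
    have \<phi>: "\<phi> q \<in> Arr C" "Dom C (\<phi> q) = act s q" "Cod C (\<phi> q) = act t q"
      "(f \<boxtimes> \<one> q) \<cdot> collapse s q = collapse t q \<cdot> \<phi> q"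
      and \<psi>: "\<psi> q \<in> Arr C" "Dom C (\<psi> q) = act t q" "Cod C (\<psi> q) = act u q"
      "(g \<boxtimes> \<one> q) \<cdot> collapse t q = collapse u q \<cdot> \<psi> q"
      using assms q by (simp_all add: represents_def Hom_iff)
    have "((g \<cdot> f) \<boxtimes> \<one> q) \<cdot> collapse s q = (g \<boxtimes> \<one> q) \<cdot> ((f \<boxtimes> \<one> q) \<cdot> collapse s q)"
      using st q by simp
    also have "\<dots> = ((g \<boxtimes> \<one> q) \<cdot> collapse t q) \<cdot> \<phi> q"
      using st q \<phi> by simp
    also have "\<dots> = collapse u q \<cdot> (\<psi> q \<cdot> \<phi> q)"
      unfolding \<psi>(4) using st q \<phi> \<psi> by simp
    finally show ?thesis .
  qed
  then show ?thesis
    using assms by (simp add: represents_def Hom_iff)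
qed

lemma represents_tenL:
  assumes "represents s t f \<phi>" "over u"
  shows "represents (Node u s) (Node u t) (\<one> (tens u) \<boxtimes> f) (\<lambda>q. act_arr u (\<phi> q))"
proof -
  have st: "over s" "over t" "f \<in> Arr C" "Dom C f = tens s" "Cod C f = tens t"
    using assms by (simp_all add: represents_def Hom_iff)
  have "((\<one> (tens u) \<boxtimes> f) \<boxtimes> \<one> q) \<cdot> collapse (Node u s) q = collapse (Node u t) q \<cdot> act_arr u (\<phi> q)"
    if q: "q \<in> Obj C" for q
  proof -
    have \<phi>: "\<phi> q \<in> Arr C" "Dom C (\<phi> q) = act s q" "Cod C (\<phi> q) = act t q"
      "(f \<boxtimes> \<one> q) \<cdot> collapse s q = collapse t q \<cdot> \<phi> q"
      using assms q by (simp_all add: represents_def Hom_iff)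
    let ?u = "tens u"
    have "((\<one> ?u \<boxtimes> f) \<boxtimes> \<one> q) \<cdot> collapse (Node u s) q =
      ((\<one> ?u \<boxtimes> f) \<boxtimes> \<one> q) \<cdot> (Ass C ?u (tens s) q \<cdot> ((\<one> ?u \<boxtimes> collapse s q) \<cdot> collapse u (act s q)))"
      by simp
    also have "\<dots> = Ass C ?u (tens t) q \<cdot> ((\<one> ?u \<boxtimes> (f \<boxtimes> \<one> q)) \<cdot> ((\<one> ?u \<boxtimes> collapse s q) \<cdot> collapse u (act s q)))"
      using st q assms(2) by (subst ass_nat_cmp) simp_all
    also have "(\<one> ?u \<boxtimes> (f \<boxtimes> \<one> q)) \<cdot> ((\<one> ?u \<boxtimes> collapse s q) \<cdot> collapse u (act s q)) =
      (\<one> ?u \<boxtimes> collapse t q) \<cdot> ((\<one> ?u \<boxtimes> \<phi> q) \<cdot> collapse u (act s q))"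
      using st q assms(2) \<phi> by simp
    also have "(\<one> ?u \<boxtimes> \<phi> q) \<cdot> collapse u (act s q) = collapse u (act t q) \<cdot> act_arr u (\<phi> q)"
      using collapse_natural[of u "\<phi> q"] st q assms(2) \<phi> by simp
    finally show ?thesis
      using st q assms(2) \<phi> by simp
  qed
  then show ?thesis
    using assms by (simp add: represents_def Hom_iff)
qed

lemma represents_tenR:
  assumes "represents s t f \<phi>" "over u"
  shows "represents (Node s u) (Node t u) (f \<boxtimes> \<one> (tens u)) (\<lambda>q. \<phi> (act u q))"
proof -
  have st: "over s" "over t" "f \<in> Arr C" "Dom C f = tens s" "Cod C f = tens t"
    using assms by (simp_all add: represents_def Hom_iff)
  have "((f \<boxtimes> \<one> (tens u)) \<boxtimes> \<one> q) \<cdot> collapse (Node s u) q = collapse (Node t u) q \<cdot> \<phi> (act u q)"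
    if q: "q \<in> Obj C" for q
  proof -
    let ?u = "tens u" and ?r = "act u q"
    have \<phi>: "\<phi> ?r \<in> Arr C" "Dom C (\<phi> ?r) = act s ?r" "Cod C (\<phi> ?r) = act t ?r"
      "(f \<boxtimes> \<one> ?r) \<cdot> collapse s ?r = collapse t ?r \<cdot> \<phi> ?r"
      using assms q by (simp_all add: represents_def Hom_iff)
    have "((f \<boxtimes> \<one> ?u) \<boxtimes> \<one> q) \<cdot> collapse (Node s u) q =
      ((f \<boxtimes> \<one> ?u) \<boxtimes> \<one> q) \<cdot> (Ass C (tens s) ?u q \<cdot> ((\<one> (tens s) \<boxtimes> collapse u q) \<cdot> collapse s ?r))"
      by simp
    also have "\<dots> = Ass C (tens t) ?u q \<cdot> ((f \<boxtimes> (\<one> ?u \<boxtimes> \<one> q)) \<cdot> ((\<one> (tens s) \<boxtimes> collapse u q) \<cdot> collapse s ?r))"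
      using st q assms(2) by (subst ass_nat_cmp) (simp_all del: tarr_idt)
    also have "(f \<boxtimes> (\<one> ?u \<boxtimes> \<one> q)) \<cdot> ((\<one> (tens s) \<boxtimes> collapse u q) \<cdot> collapse s ?r) =
      (\<one> (tens t) \<boxtimes> collapse u q) \<cdot> ((f \<boxtimes> \<one> ?r) \<cdot> collapse s ?r)"
      using st q assms(2) \<phi>(1-3) by simp
    also have "(f \<boxtimes> \<one> ?r) \<cdot> collapse s ?r = collapse t ?r \<cdot> \<phi> ?r"
      by (rule \<phi>(4))
    finally show ?thesis
      using st q assms(2) \<phi>(1-3) by simp
  qed
  then show ?thesis
    using assms by (simp add: represents_def Hom_iff)
qed

text \<open>
  The associativity arrow acts as the identity: this is the pentagon with \<open>q\<close> as its last object.
  In the same way the triangle makes \<open>Run\<close> act as the identity, and \<open>lun_tensor\<close> does so for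
  \<open>Lun\<close>.
\<close>

lemma represents_ass:
  assumes "over s" "over t" "over u"
  shows "represents (Node s (Node t u)) (Node (Node s t) u) (Ass C (tens s) (tens t) (tens u))
    (\<lambda>q. \<one> (act s (act t (act u q))))"
proof -
  let ?s = "tens s" and ?t = "tens t" and ?u = "tens u"
  have "(Ass C ?s ?t ?u \<boxtimes> \<one> q) \<cdot> collapse (Node s (Node t u)) q = collapse (Node (Node s t) u) q"
    if q: "q \<in> Obj C" for q
  proof -
    let ?r = "collapse s (act t (act u q))"
    let ?k = "(\<one> ?s \<boxtimes> ((\<one> ?t \<boxtimes> collapse u q) \<cdot> collapse t (act u q))) \<cdot> ?r"
    have "(Ass C ?s ?t ?u \<boxtimes> \<one> q) \<cdot> collapse (Node s (Node t u)) q =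
      ((Ass C ?s ?t ?u \<boxtimes> \<one> q) \<cdot> Ass C ?s (?t \<otimes> ?u) q \<cdot> (\<one> ?s \<boxtimes> Ass C ?t ?u q)) \<cdot> ?k"
      using assms q by simp
    also have "\<dots> = (Ass C (?s \<otimes> ?t) ?u q \<cdot> Ass C ?s ?t (?u \<otimes> q)) \<cdot> ?k"
      using assms q by (subst pentagon) simp_all
    also have "\<dots> = Ass C (?s \<otimes> ?t) ?u q \<cdot> (Ass C ?s ?t (?u \<otimes> q) \<cdot> ((\<one> ?s \<boxtimes> (\<one> ?t \<boxtimes> collapse u q)) \<cdot>
       ((\<one> ?s \<boxtimes> collapse t (act u q)) \<cdot> ?r)))"
      using assms q by simp
    also have "\<dots> = collapse (Node (Node s t) u) q"
      using assms q by (subst ass_nat_cmp) simp_all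
    finally show ?thesis .
  qed
  then show ?thesis
    using assms by (simp add: represents_def Hom_iff del: collapse.simps)
qed

lemma represents_run:
  assumes "over s"
  shows "represents (Node s Empty) s (Run C (tens s)) (\<lambda>q. \<one> (act s q))"
proof -
  let ?s = "tens s"
  have "(Run C ?s \<boxtimes> \<one> q) \<cdot> collapse (Node s Empty) q = collapse s q" if q: "q \<in> Obj C" for q
  proof -
    have "(Run C ?s \<boxtimes> \<one> q) \<cdot> collapse (Node s Empty) q =
      ((Run C ?s \<boxtimes> \<one> q) \<cdot> Ass C ?s \<I> q) \<cdot> ((\<one> ?s \<boxtimes> Inv C (Lun C q)) \<cdot> collapse s q)"
      using assms q by simp
    also have "\<dots> = collapse s q"
      using assms q by (subst triangle) simp_all
    finally show ?thesis .
  qed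
  then show ?thesis
    using assms by (simp add: represents_def Hom_iff)
qed

lemma represents_lun:
  assumes "over s"
  shows "represents (Node Empty s) s (Lun C (tens s)) (\<lambda>q. \<one> (act s q))"
proof -
  let ?s = "tens s"
  have "(Lun C ?s \<boxtimes> \<one> q) \<cdot> collapse (Node Empty s) q = collapse s q" if q: "q \<in> Obj C" for q
  proof -
    have "(Lun C ?s \<boxtimes> \<one> q) \<cdot> collapse (Node Empty s) q =
      ((Lun C ?s \<boxtimes> \<one> q) \<cdot> Ass C \<I> ?s q) \<cdot> ((\<one> \<I> \<boxtimes> collapse s q) \<cdot> Inv C (Lun C (act s q)))"
      using assms q by simp
    also have "\<dots> = (Lun C (?s \<otimes> q) \<cdot> (\<one> \<I> \<boxtimes> collapse s q)) \<cdot> Inv C (Lun C (act s q))"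
      using assms q by (subst lun_tensor) simp_all
    also have "\<dots> = collapse s q"
      using assms q by (subst lun_nat) simp_all
    finally show ?thesis .
  qed
  then show ?thesis
    using assms by (simp add: represents_def Hom_iff)
qed

lemma represents_iso:
  assumes "represents s t f \<phi>" "iso C f" "q \<in> Obj C"
  shows "iso C (\<phi> q)"
proof -
  have st: "over s" "over t" "f \<in> Arr C" "Dom C f = tens s" "Cod C f = tens t"
    and \<phi>: "\<phi> q \<in> Arr C" "Dom C (\<phi> q) = act s q" "Cod C (\<phi> q) = act t q"
      "(f \<boxtimes> \<one> q) \<cdot> collapse s q = collapse t q \<cdot> \<phi> q"
    using assms by (simp_all add: represents_def Hom_iff)
  have "\<phi> q = Inv C (collapse t q) \<cdot> (collapse t q \<cdot> \<phi> q)"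
    using st \<phi>(1-3) assms by simp
  also have "\<dots> = Inv C (collapse t q) \<cdot> ((f \<boxtimes> \<one> q) \<cdot> collapse s q)"
    by (simp only: \<phi>(4))
  finally show ?thesis
    using st assms by simp
qed

lemma represents_inverse:
  assumes "represents s t f \<phi>" "iso C f"
  shows "represents t s (Inv C f) (\<lambda>q. Inv C (\<phi> q))"
proof -
  have st: "over s" "over t" "f \<in> Arr C" "Dom C f = tens s" "Cod C f = tens t"
    using assms by (simp_all add: represents_def Hom_iff)
  have "(Inv C f \<boxtimes> \<one> q) \<cdot> collapse t q = collapse s q \<cdot> Inv C (\<phi> q)" if q: "q \<in> Obj C" for q
  proof -
    have \<phi>: "Dom C (\<phi> q) = act s q" "Cod C (\<phi> q) = act t q" "iso C (\<phi> q)"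
      "(f \<boxtimes> \<one> q) \<cdot> collapse s q = collapse t q \<cdot> \<phi> q"
      using assms q represents_iso[OF assms] by (auto simp: represents_def Hom_iff)
    have "(Inv C f \<boxtimes> \<one> q) \<cdot> collapse t q = (Inv C f \<boxtimes> \<one> q) \<cdot> ((collapse t q \<cdot> \<phi> q) \<cdot> Inv C (\<phi> q))"
      using st q \<phi>(1-3) by simp
    also have "\<dots> = collapse s q \<cdot> Inv C (\<phi> q)"
      unfolding \<phi>(4)[symmetric] using st q assms(2) \<phi>(1-3) by simp
    finally show ?thesis .
  qed
  then show ?thesis
    using assms st represents_iso[OF assms] by (simp add: represents_def Hom_iff)
qed

lemma represents_cong:
  assumes "represents s t f \<phi>" "\<And>q. q \<in> Obj C \<Longrightarrow> \<phi> q = \<psi> q"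
  shows "represents s t f \<psi>"
  using assms by (simp add: represents_def)

lemma represents_ass_inv:
  assumes "over s" "over t" "over u"
  shows "represents (Node (Node s t) u) (Node s (Node t u)) (Inv C (Ass C (tens s) (tens t) (tens u)))
    (\<lambda>q. \<one> (act s (act t (act u q))))"
  using assms represents_inverse[OF represents_ass[OF assms]] by (simp add: represents_def)

lemma represents_run_inv:
  assumes "over s"
  shows "represents s (Node s Empty) (Inv C (Run C (tens s))) (\<lambda>q. \<one> (act s q))"
  using assms represents_inverse[OF represents_run[OF assms]] by (simp add: represents_def)

lemma represents_lun_inv:
  assumes "over s"
  shows "represents s (Node Empty s) (Inv C (Lun C (tens s))) (\<lambda>q. \<one> (act s q))"
  using assms represents_inverse[OF represents_lun[OF assms]] by (simp add: represents_def)

lemma represents_typed: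
  assumes "represents s t f \<phi>"
  shows "over s" "over t" "f \<in> Arr C" "Dom C f = tens s" "Cod C f = tens t"
    "q \<in> Obj C \<Longrightarrow> \<phi> q \<in> Arr C" "q \<in> Obj C \<Longrightarrow> Dom C (\<phi> q) = act s q"
    "q \<in> Obj C \<Longrightarrow> Cod C (\<phi> q) = act t q"
  using assms by (simp_all add: represents_def Hom_iff)

lemma represents_tarr:
  assumes "represents s t f \<phi>" "represents u v g \<psi>"
  shows "represents (Node s u) (Node t v) (f \<boxtimes> g) (\<lambda>q. act_arr t (\<psi> q) \<cdot> \<phi> (act u q))"
  using represents_cmp[OF represents_tenR[OF assms(1) represents_typed(1)[OF assms(2)]]
      represents_tenL[OF assms(2) represents_typed(2)[OF assms(1)]]]
    represents_typed[OF assms(1)] represents_typed[OF assms(2)]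
  by simp

lemma represents_arrow:
  assumes "f \<in> Arr C"
  shows "represents (Leaf (Dom C f)) (Leaf (Cod C f)) f (\<lambda>q. f \<boxtimes> \<one> q)"
  using assms by (simp add: represents_def Hom_iff)

lemma act_arr_iso [simp]:
  assumes "over t" "iso C f"
  shows "iso C (act_arr t f)" "Inv C (act_arr t f) = act_arr t (Inv C f)"
proof -
  have "iso C (act_arr t f) \<and> Inv C (act_arr t f) = act_arr t (Inv C f)"
    using assms by (induction t arbitrary: f) auto
  then show "iso C (act_arr t f)" "Inv C (act_arr t f) = act_arr t (Inv C f)"
    by auto
qed

text \<open>
  The transposition \<open>a \<otimes> (b \<otimes> q) \<rightarrow> b \<otimes> (a \<otimes> q)\<close>, by which the symmetry of two leaves acts.
\<close>

definition swap :: "'a \<Rightarrow> 'a \<Rightarrow> 'a \<Rightarrow> 'b" where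
  "swap a b q = Inv C (Ass C b a q) \<cdot> ((Sym C a b \<boxtimes> \<one> q) \<cdot> Ass C a b q)"

lemma swap_simps [simp]:
  assumes "a \<in> Obj C" "b \<in> Obj C" "q \<in> Obj C"
  shows "swap a b q \<in> Arr C" "Dom C (swap a b q) = a \<otimes> (b \<otimes> q)" "Cod C (swap a b q) = b \<otimes> (a \<otimes> q)"
    "swap b a q \<cdot> swap a b q = \<one> (a \<otimes> (b \<otimes> q))"
  using assms by (simp_all add: swap_def sym_sym)

lemma swap_swap_cmp [simp]:
  assumes "a \<in> Obj C" "b \<in> Obj C" "q \<in> Obj C" "k \<in> Arr C" "Cod C k = a \<otimes> (b \<otimes> q)"
  shows "swap b a q \<cdot> (swap a b q \<cdot> k) = k"
  using assms by (simp flip: assoc_simp)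

lemma swap_natural:
  assumes "f \<in> Arr C" "g \<in> Arr C" "h \<in> Arr C" "Cod C f = a'" "Cod C g = b'" "Cod C h = c'"
  shows "swap a' b' c' \<cdot> (f \<boxtimes> (g \<boxtimes> h)) = (g \<boxtimes> (f \<boxtimes> h)) \<cdot> swap (Dom C f) (Dom C g) (Dom C h)"
proof (rule iso_mono[where f = "Ass C b' a' c'"])
  have "Ass C b' a' c' \<cdot> (swap a' b' c' \<cdot> (f \<boxtimes> (g \<boxtimes> h))) =
    (Sym C a' b' \<boxtimes> \<one> c') \<cdot> (Ass C a' b' c' \<cdot> (f \<boxtimes> (g \<boxtimes> h)))"
    using assms by (auto simp: swap_def)
  also have "\<dots> = ((Sym C a' b' \<cdot> (f \<boxtimes> g)) \<boxtimes> h) \<cdot> Ass C (Dom C f) (Dom C g) (Dom C h)"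
    using assms by (subst ass_nat) auto
  also have "\<dots> = ((g \<boxtimes> f) \<boxtimes> h) \<cdot> ((Sym C (Dom C f) (Dom C g) \<boxtimes> \<one> (Dom C h)) \<cdot> Ass C (Dom C f) (Dom C g) (Dom C h))"
    using assms by (subst sym_nat) auto
  also have "\<dots> = ((g \<boxtimes> f) \<boxtimes> h) \<cdot> (Ass C (Dom C g) (Dom C f) (Dom C h) \<cdot> swap (Dom C f) (Dom C g) (Dom C h))"
    using assms by (simp add: swap_def)
  also have "\<dots> = Ass C b' a' c' \<cdot> ((g \<boxtimes> (f \<boxtimes> h)) \<cdot> swap (Dom C f) (Dom C g) (Dom C h))"
    using assms by (subst ass_nat_cmp) auto
  finally show "Ass C b' a' c' \<cdot> (swap a' b' c' \<cdot> (f \<boxtimes> (g \<boxtimes> h))) =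
    Ass C b' a' c' \<cdot> ((g \<boxtimes> (f \<boxtimes> h)) \<cdot> swap (Dom C f) (Dom C g) (Dom C h))" .
qed (use assms in auto)

text \<open>
  Naturality of \<open>swap\<close> in its last argument, in the shape to which the simplifier brings a
  composite of transpositions: the arrow \<open>h\<close> slides out of the transposition.
\<close>

lemma swap_slide:
  assumes "a \<in> Obj C" "b \<in> Obj C" "h \<in> Arr C" "k \<in> Arr C" "Cod C k = b \<otimes> Dom C h" "Cod C h = c"
  shows "swap a b c \<cdot> (\<one> a \<boxtimes> ((\<one> b \<boxtimes> h) \<cdot> k)) =
    (\<one> b \<boxtimes> (\<one> a \<boxtimes> h)) \<cdot> (swap a b (Dom C h) \<cdot> (\<one> a \<boxtimes> k))"
proof -
  have "swap a b c \<cdot> (\<one> a \<boxtimes> ((\<one> b \<boxtimes> h) \<cdot> k)) = (swap a b c \<cdot> (\<one> a \<boxtimes> (\<one> b \<boxtimes> h))) \<cdot> (\<one> a \<boxtimes> k)"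
    using assms by auto
  also have "\<dots> = (\<one> b \<boxtimes> (\<one> a \<boxtimes> h)) \<cdot> (swap a b (Dom C h) \<cdot> (\<one> a \<boxtimes> k))"
    using assms by (subst swap_natural) auto
  finally show ?thesis .
qed

lemma represents_sym:
  assumes "a \<in> Obj C" "b \<in> Obj C"
  shows "represents (Node (Leaf a) (Leaf b)) (Node (Leaf b) (Leaf a)) (Sym C a b) (swap a b)"
  using assms by (simp add: represents_def Hom_iff) (simp add: swap_def)

text \<open>
  The hexagon, solved for the symmetry of a tensor product: moving \<open>u\<close> past \<open>s \<otimes> t\<close> amounts to
  moving it past \<open>t\<close> and then past \<open>s\<close>.
\<close>

lemma represents_sym_tenL:
  assumes "represents (Node s u) (Node u s) (Sym C (tens s) (tens u)) \<phi>"
    "represents (Node t u) (Node u t) (Sym C (tens t) (tens u)) \<psi>"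
  shows "represents (Node (Node s t) u) (Node u (Node s t)) (Sym C (tens (Node s t)) (tens u))
    (\<lambda>q. \<phi> (act t q) \<cdot> act_arr s (\<psi> q))"
proof -
  have o: "over s" "over t" "over u"
    using assms by (simp_all add: represents_def)
  let ?s = "tens s" and ?t = "tens t" and ?u = "tens u"
  have "Inv C (Ass C ?u ?s ?t) \<cdot> (Ass C ?u ?s ?t \<cdot> Sym C (?s \<otimes> ?t) ?u \<cdot> Ass C ?s ?t ?u) \<cdot> Inv C (Ass C ?s ?t ?u) =
    Inv C (Ass C ?u ?s ?t) \<cdot> ((Sym C ?s ?u \<boxtimes> \<one> ?t) \<cdot> Ass C ?s ?u ?t \<cdot> (\<one> ?s \<boxtimes> Sym C ?t ?u)) \<cdot> Inv C (Ass C ?s ?t ?u)"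
    using o by (simp only: hexagon tens_obj)
  then have "Sym C (tens (Node s t)) ?u = Inv C (Ass C ?u ?s ?t) \<cdot> ((Sym C ?s ?u \<boxtimes> \<one> ?t) \<cdot> (Ass C ?s ?u ?t \<cdot>
    ((\<one> ?s \<boxtimes> Sym C ?t ?u) \<cdot> Inv C (Ass C ?s ?t ?u))))"
    using o by simp
  moreover have "represents (Node (Node s t) u) (Node u (Node s t)) \<dots>
    (\<lambda>q. \<one> (act u (act s (act t q))) \<cdot> (\<phi> (act t q) \<cdot> (\<one> (act s (act u (act t q))) \<cdot> (act_arr s (\<psi> q) \<cdot> \<one> (act s (act t (act u q)))))))"
    using o
    by (intro represents_cmp[OF represents_cmp[OF represents_cmp[OF represents_cmp
      [OF represents_ass_inv represents_tenL[OF assms(2)]] represents_ass] represents_tenR[OF assms(1)]]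
      represents_ass_inv])
  ultimately show ?thesis
    using o represents_typed[OF assms(1)] represents_typed[OF assms(2)]
    by (elim ssubst represents_cong) simp
qed

text \<open>
  The mirror image of the hexagon, obtained by inverting all arrows in the previous lemma.
\<close>

lemma represents_sym_tenR:
  assumes "represents (Node s u) (Node u s) (Sym C (tens s) (tens u)) \<phi>"
    "represents (Node s t) (Node t s) (Sym C (tens s) (tens t)) \<psi>"
  shows "represents (Node s (Node u t)) (Node (Node u t) s) (Sym C (tens s) (tens (Node u t)))
    (\<lambda>q. act_arr u (\<psi> q) \<cdot> \<phi> (act t q))"
proof -
  have o: "over s" "over t" "over u"
    using assms by (simp_all add: represents_def)
  have "represents (Node u s) (Node s u) (Sym C (tens u) (tens s)) (\<lambda>q. Inv C (\<phi> q))"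
    "represents (Node t s) (Node s t) (Sym C (tens t) (tens s)) (\<lambda>q. Inv C (\<psi> q))"
    using represents_inverse[OF assms(1)] represents_inverse[OF assms(2)] o by simp_all
  from represents_inverse[OF represents_sym_tenL[OF this]]
  have "represents (Node s (Node u t)) (Node (Node u t) s) (Sym C (tens s) (tens (Node u t)))
    (\<lambda>q. Inv C (Inv C (\<phi> (act t q)) \<cdot> act_arr u (Inv C (\<psi> q))))"
    using o by simp
  then show ?thesis
    using o represents_iso[OF assms(1)] represents_iso[OF assms(2)]
      represents_typed[OF assms(1)] represents_typed[OF assms(2)]
    by (elim represents_cong) simp_all
qed

lemma represents_sym_unit:
  assumes "over s"
  shows "represents (Node s Empty) (Node Empty s) (Sym C (tens s) \<I>) (\<lambda>q. \<one> (act s q))"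
    "represents (Node Empty s) (Node s Empty) (Sym C \<I> (tens s)) (\<lambda>q. \<one> (act s q))"
proof -
  have "Sym C (tens s) \<I> = Inv C (Lun C (tens s)) \<cdot> Run C (tens s)"
    using assms by (simp flip: sym_unit)
  moreover have "represents (Node s Empty) (Node Empty s) \<dots> (\<lambda>q. \<one> (act s q) \<cdot> \<one> (act s q))"
    using assms by (intro represents_cmp[OF represents_run represents_lun_inv])
  ultimately show *: "represents (Node s Empty) (Node Empty s) (Sym C (tens s) \<I>) (\<lambda>q. \<one> (act s q))"
    using assms by (elim ssubst represents_cong) simp
  show "represents (Node Empty s) (Node s Empty) (Sym C \<I> (tens s)) (\<lambda>q. \<one> (act s q))"
    using represents_inverse[OF *] assms by (simp add: represents_def)
qed

text \<open>
  The interchange is the symmetry of the two middle factors up to rebracketing, so it acts by that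
  symmetry alone.
\<close>

lemma represents_interchange:
  assumes "represents (Node x y) (Node y x) (Sym C (tens x) (tens y)) \<phi>" "over w" "over z"
  shows "represents (Node (Node w x) (Node y z)) (Node (Node w y) (Node x z))
    (interchange C (tens w) (tens x) (tens y) (tens z)) (\<lambda>q. act_arr w (\<phi> (act z q)))"
proof -
  have o: "over w" "over x" "over y" "over z"
    using assms by (simp_all add: represents_def)
  then have o_pair: "over (Node y z)" "over (Node x z)"
    by simp_all
  have "represents (Node (Node w x) (Node y z)) (Node (Node w y) (Node x z))
    (interchange C (tens w) (tens x) (tens y) (tens z))
    (\<lambda>q. \<one> (act w (act y (act (Node x z) q))) \<cdot> act_arr w (\<one> (act y (act x (act z q)))) \<cdot>
       act_arr w (\<phi> (act z q)) \<cdot> act_arr w (\<one> (act x (act y (act z q)))) \<cdot> \<one> (act w (act x (act (Node y z) q))))"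
    unfolding interchange_def tens.simps(3)[symmetric]
    by (rule represents_cmp represents_ass represents_ass_inv represents_tenL represents_tenR assms(1) o o_pair)+
  then show ?thesis
    using o represents_typed[OF assms(1)] by (elim represents_cong) simp
qed

section \<open>Interchange\<close>

lemma interchange_represented:
  assumes "w \<in> Obj C" "x \<in> Obj C" "y \<in> Obj C" "z \<in> Obj C"
  shows "represents (Node (Node (Leaf w) (Leaf x)) (Node (Leaf y) (Leaf z))) (Node (Node (Leaf w) (Leaf y)) (Node (Leaf x) (Leaf z)))
    (interchange C w x y z) (\<lambda>q. \<one> w \<boxtimes> swap x y (z \<otimes> q))"
  using represents_interchange[of "Leaf x" "Leaf y" "swap x y" "Leaf w" "Leaf z"] represents_sym[of x y] assms
  by simp

lemma interchange_simps [simp]: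
  assumes "w \<in> Obj C" "x \<in> Obj C" "y \<in> Obj C" "z \<in> Obj C"
  shows "interchange C w x y z \<in> Arr C"
    "Dom C (interchange C w x y z) = (w \<otimes> x) \<otimes> (y \<otimes> z)"
    "Cod C (interchange C w x y z) = (w \<otimes> y) \<otimes> (x \<otimes> z)"
  using represents_typed[OF interchange_represented[OF assms]] by simp_all

lemma interchange_involution:
  assumes "w \<in> Obj C" "x \<in> Obj C" "y \<in> Obj C" "z \<in> Obj C"
  shows "interchange C w y x z \<cdot> interchange C w x y z = \<one> ((w \<otimes> x) \<otimes> (y \<otimes> z))"
proof -
  note lhs = represents_cmp[OF interchange_represented[of w x y z] interchange_represented[of w y x z]]
  note rhs = represents_idt[of "Node (Node (Leaf w) (Leaf x)) (Node (Leaf y) (Leaf z))"]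
  show ?thesis
    using represents_unique[OF lhs rhs] assms by simp
qed

lemma interchange_involution_cmp:
  assumes "w \<in> Obj C" "x \<in> Obj C" "y \<in> Obj C" "z \<in> Obj C"
    "k \<in> Arr C" "Cod C k = (w \<otimes> x) \<otimes> (y \<otimes> z)"
  shows "interchange C w y x z \<cdot> (interchange C w x y z \<cdot> k) = k"
  using assms by (simp add: interchange_involution flip: assoc_simp)

lemma interchange_iso [simp]:
  assumes "w \<in> Obj C" "x \<in> Obj C" "y \<in> Obj C" "z \<in> Obj C"
  shows "iso C (interchange C w x y z)" "Inv C (interchange C w x y z) = interchange C w y x z"
  by (rule isoI[where g = "interchange C w y x z"]; simp add: assms interchange_involution)+

text \<open>
  An arbitrary arrow is represented between leaves, so naturality is checked by the same method as
  the coherence equations.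
\<close>

lemma interchange_natural:
  assumes "f \<in> Arr C" "g \<in> Arr C" "h \<in> Arr C" "k \<in> Arr C"
    "Cod C f = w'" "Cod C g = x'" "Cod C h = y'" "Cod C k = z'"
  shows "interchange C w' x' y' z' \<cdot> ((f \<boxtimes> g) \<boxtimes> (h \<boxtimes> k)) =
    ((f \<boxtimes> h) \<boxtimes> (g \<boxtimes> k)) \<cdot> interchange C (Dom C f) (Dom C g) (Dom C h) (Dom C k)"
proof -
  note r = represents_arrow[OF assms(1)] represents_arrow[OF assms(2)]
    represents_arrow[OF assms(3)] represents_arrow[OF assms(4)]
  note o = cod_obj[OF assms(1)] cod_obj[OF assms(2)] cod_obj[OF assms(3)] cod_obj[OF assms(4)]
    dom_obj[OF assms(1)] dom_obj[OF assms(2)] dom_obj[OF assms(3)] dom_obj[OF assms(4)]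
  note lhs = represents_cmp[OF represents_tarr[OF represents_tarr[OF r(1,2)] represents_tarr[OF r(3,4)]]
    interchange_represented[OF o(1-4)]]
  note rhs = represents_cmp[OF interchange_represented[OF o(5-8)]
    represents_tarr[OF represents_tarr[OF r(1,3)] represents_tarr[OF r(2,4)]]]
  show ?thesis
    unfolding assms(5-8)[symmetric]
    by (rule represents_unique[OF lhs rhs]) (simp_all add: assms(1-4) swap_natural)
qed

text \<open>
  Both sides move \<open>b\<close> past \<open>a'\<close>, and \<open>c\<close> past \<open>b'\<close> and then past \<open>a'\<close>. They differ only in the
  order of the transposition of \<open>a'\<close> with \<open>b\<close> and that of \<open>b'\<close> with \<open>c\<close>, which commute by
  naturality.
\<close>

lemma interchange_ass:
  assumes "a \<in> Obj C" "a' \<in> Obj C" "b \<in> Obj C" "b' \<in> Obj C" "c \<in> Obj C" "c' \<in> Obj C"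
  shows "(Ass C a b c \<boxtimes> Ass C a' b' c') \<cdot> (interchange C a a' (b \<otimes> c) (b' \<otimes> c') \<cdot>
      (\<one> (a \<otimes> a') \<boxtimes> interchange C b b' c c')) =
    interchange C (a \<otimes> b) (a' \<otimes> b') c c' \<cdot> ((interchange C a a' b b' \<boxtimes> \<one> (c \<otimes> c')) \<cdot>
      Ass C (a \<otimes> a') (b \<otimes> b') (c \<otimes> c'))"
proof -
  note sym = represents_sym[of a' b] represents_sym[of a' c] represents_sym[of b' c]
  note m1 = represents_interchange[of "Leaf a'" "Node (Leaf b) (Leaf c)" _ "Leaf a" "Node (Leaf b') (Leaf c')", unfolded tens.simps,
      OF represents_sym_tenR[of "Leaf a'" "Leaf b" _ "Leaf c", unfolded tens.simps, OF sym(1,2)]]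
  note m2 = represents_interchange[of "Node (Leaf a') (Leaf b')" "Leaf c" _ "Node (Leaf a) (Leaf b)" "Leaf c'", unfolded tens.simps,
      OF represents_sym_tenL[of "Leaf a'" "Leaf c" _ "Leaf b'", unfolded tens.simps, OF sym(2,3)]]
  note lhs = represents_cmp[OF represents_cmp[OF
      represents_tenL[OF interchange_represented[of b b' c c'], of "Node (Leaf a) (Leaf a')", unfolded tens.simps] m1]
      represents_tarr[OF represents_ass[of "Leaf a" "Leaf b" "Leaf c"] represents_ass[of "Leaf a'" "Leaf b'" "Leaf c'"], unfolded tens.simps]]
  note rhs = represents_cmp[OF represents_cmp[OF represents_ass[of "Node (Leaf a) (Leaf a')" "Node (Leaf b) (Leaf b')" "Node (Leaf c) (Leaf c')"]
      represents_tenR[OF interchange_represented[of a a' b b'], of "Node (Leaf c) (Leaf c')"], unfolded tens.simps] m2]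
  show ?thesis
    by (rule represents_unique[OF lhs rhs]) (simp_all add: assms swap_natural swap_slide)
qed

text \<open>
  One of the two middle factors is the unit, and symmetry with the unit acts as the identity; so
  both sides do. The same holds for \<open>interchange_lun\<close>.
\<close>

lemma interchange_run:
  assumes "a \<in> Obj C" "b \<in> Obj C"
  shows "(Run C a \<boxtimes> Run C b) \<cdot> (interchange C a b \<I> \<I> \<cdot> (\<one> (a \<otimes> b) \<boxtimes> Inv C (Run C \<I>))) = Run C (a \<otimes> b)"
proof -
  note lhs = represents_cmp[OF represents_cmp[OF
      represents_tenL[OF represents_run_inv[of Empty], of "Node (Leaf a) (Leaf b)"]
      represents_interchange[OF represents_sym_unit(1)[of "Leaf b", folded tens.simps(1)], of "Leaf a" Empty]]
      represents_tarr[OF represents_run[of "Leaf a"] represents_run[of "Leaf b"]]]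
  show ?thesis
    using represents_unique[OF lhs represents_run[of "Node (Leaf a) (Leaf b)"]] assms by simp
qed

lemma interchange_lun:
  assumes "a \<in> Obj C" "b \<in> Obj C"
  shows "(Lun C a \<boxtimes> Lun C b) \<cdot> (interchange C \<I> \<I> a b \<cdot> (Inv C (Run C \<I>) \<boxtimes> \<one> (a \<otimes> b))) = Lun C (a \<otimes> b)"
proof -
  note lhs = represents_cmp[OF represents_cmp[OF
      represents_tenR[OF represents_run_inv[of Empty], of "Node (Leaf a) (Leaf b)"]
      represents_interchange[OF represents_sym_unit(2)[of "Leaf a", folded tens.simps(1)], of Empty "Leaf b"]]
      represents_tarr[OF represents_lun[of "Leaf a"] represents_lun[of "Leaf b"]]]
  show ?thesis
    using represents_unique[OF lhs represents_lun[of "Node (Leaf a) (Leaf b)"]] assms by simp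
qed

text \<open>
  The right-hand side consists of five transpositions. Two of them exchange \<open>a\<close> and \<open>b'\<close> and
  cancel, which leaves the three of the left-hand side.
\<close>

lemma interchange_sym:
  assumes "a \<in> Obj C" "a' \<in> Obj C" "b \<in> Obj C" "b' \<in> Obj C"
  shows "(Sym C a b \<boxtimes> Sym C a' b') \<cdot> interchange C a a' b b' =
    interchange C b b' a a' \<cdot> Sym C (a \<otimes> a') (b \<otimes> b')"
proof -
  note s1 = represents_sym_tenR[of "Leaf a" "Leaf b" _ "Leaf b'", simplified, OF represents_sym[of a b] represents_sym[of a b']]
  note s2 = represents_sym_tenR[of "Leaf a'" "Leaf b" _ "Leaf b'", simplified, OF represents_sym[of a' b] represents_sym[of a' b']]
  note lhs = represents_cmp[OF interchange_represented[of a a' b b'] represents_tarr[OF represents_sym[of a b] represents_sym[of a' b']]]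
  note rhs = represents_cmp[OF represents_sym_tenL[of "Leaf a" "Node (Leaf b) (Leaf b')" _ "Leaf a'", simplified, OF s1 s2] interchange_represented[of b b' a a']]
  show ?thesis
    by (rule represents_unique[OF lhs rhs]) (simp_all add: assms swap_natural swap_slide)
qed

lemma run_unit_eq_lun: "Run C \<I> = Lun C \<I>"
  using represents_unique[OF represents_run[of Empty] represents_lun[of Empty]] by simp

lemma sym_unit_unit: "Sym C \<I> \<I> = \<one> (\<I> \<otimes> \<I>)"
  using represents_unique[OF represents_sym_unit(1)[of Empty, folded tens.simps(1)] represents_idt[of "Node Empty Empty"]] by simp

lemma ass_unit_run:
  "Run C \<I> \<cdot> (\<one> \<I> \<boxtimes> Run C \<I>) = Run C \<I> \<cdot> ((Run C \<I> \<boxtimes> \<one> \<I>) \<cdot> Ass C \<I> \<I> \<I>)"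
proof -
  note lhs = represents_cmp[OF represents_tenL[OF represents_run[of Empty], of Empty] represents_run[of Empty]]
  note rhs = represents_cmp[OF represents_cmp[OF represents_ass[of Empty Empty Empty] represents_tenR[OF represents_run[of Empty], of Empty]] represents_run[of Empty]]
  show ?thesis
    using represents_unique[OF lhs rhs] by simp
qed

lemma ass_unit_run_inv:
  "Ass C \<I> \<I> \<I> \<cdot> ((\<one> \<I> \<boxtimes> Inv C (Run C \<I>)) \<cdot> Inv C (Run C \<I>)) = (Inv C (Run C \<I>) \<boxtimes> \<one> \<I>) \<cdot> Inv C (Run C \<I>)"
proof -
  note lhs = represents_cmp[OF represents_cmp[OF represents_run_inv[of Empty] represents_tenL[OF represents_run_inv[of Empty], of Empty]]
      represents_ass[of Empty Empty Empty]]
  note rhs = represents_cmp[OF represents_run_inv[of Empty] represents_tenR[OF represents_run_inv[of Empty], of Empty]]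
  show ?thesis
    using represents_unique[OF lhs rhs] by simp
qed

text \<open>
  Since the interchange is its own inverse with the middle arguments exchanged, the preceding
  equations can be solved for the structural arrow of the ambient tensor product. In this form
  they say that \<open>Ass\<close>, \<open>Run\<close>, \<open>Lun\<close> and \<open>Sym\<close> are monoidal transformations between pointwise
  tensor products.
\<close>

lemma interchange_ass':
  assumes "a \<in> Obj C" "a' \<in> Obj C" "b \<in> Obj C" "b' \<in> Obj C" "c \<in> Obj C" "c' \<in> Obj C"
  shows "Ass C (a \<otimes> a') (b \<otimes> b') (c \<otimes> c') \<cdot>
      ((\<one> (a \<otimes> a') \<boxtimes> interchange C b c b' c') \<cdot> interchange C a (b \<otimes> c) a' (b' \<otimes> c')) =
    (interchange C a b a' b' \<boxtimes> \<one> (c \<otimes> c')) \<cdot> (interchange C (a \<otimes> b) c (a' \<otimes> b') c' \<cdot>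
      (Ass C a b c \<boxtimes> Ass C a' b' c'))"
    (is "?lhs = ?R \<cdot> (?Q \<cdot> ?P)")
proof -
  let ?M = "interchange C a (b \<otimes> c) a' (b' \<otimes> c')" and ?N = "\<one> (a \<otimes> a') \<boxtimes> interchange C b c b' c'"
  have "?R \<cdot> (?Q \<cdot> ?P) = ?R \<cdot> (?Q \<cdot> ((?P \<cdot> (Inv C ?M \<cdot> Inv C ?N)) \<cdot> (?N \<cdot> ?M)))"
    using assms by (simp add: interchange_involution)
  also have "?P \<cdot> (Inv C ?M \<cdot> Inv C ?N) = Inv C ?Q \<cdot> (Inv C ?R \<cdot> Ass C (a \<otimes> a') (b \<otimes> b') (c \<otimes> c'))"
    using assms interchange_ass[OF assms] by simp
  also have "?R \<cdot> (?Q \<cdot> (\<dots> \<cdot> (?N \<cdot> ?M))) = ?lhs"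
    using assms by (simp add: interchange_involution interchange_involution_cmp)
  finally show ?thesis by simp
qed

lemma interchange_run':
  assumes "a \<in> Obj C" "b \<in> Obj C"
  shows "Run C (a \<otimes> b) \<cdot> ((\<one> (a \<otimes> b) \<boxtimes> Run C \<I>) \<cdot> interchange C a \<I> b \<I>) = Run C a \<boxtimes> Run C b"
  unfolding interchange_run[OF assms, symmetric] using assms by (simp add: interchange_involution)

lemma interchange_lun':
  assumes "a \<in> Obj C" "b \<in> Obj C"
  shows "Lun C (a \<otimes> b) \<cdot> ((Run C \<I> \<boxtimes> \<one> (a \<otimes> b)) \<cdot> interchange C \<I> a \<I> b) = Lun C a \<boxtimes> Lun C b"
  unfolding interchange_lun[OF assms, symmetric] using assms by (simp add: interchange_involution)

lemma interchange_sym':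
  assumes "a \<in> Obj C" "a' \<in> Obj C" "b \<in> Obj C" "b' \<in> Obj C"
  shows "Sym C (a \<otimes> a') (b \<otimes> b') \<cdot> interchange C a b a' b' =
    interchange C b a b' a' \<cdot> (Sym C a b \<boxtimes> Sym C a' b')"
proof -
  have "interchange C b a b' a' \<cdot> (Sym C a b \<boxtimes> Sym C a' b') =
    interchange C b a b' a' \<cdot> (((Sym C a b \<boxtimes> Sym C a' b') \<cdot> interchange C a a' b b') \<cdot> interchange C a b a' b')"
    using assms by (simp add: interchange_involution)
  also have "\<dots> = (interchange C b a b' a' \<cdot> interchange C b b' a a') \<cdot> (Sym C (a \<otimes> a') (b \<otimes> b') \<cdot> interchange C a b a' b')"
    unfolding interchange_sym[OF assms] using assms by simp
  also have "\<dots> = Sym C (a \<otimes> a') (b \<otimes> b') \<cdot> interchange C a b a' b'"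
    using assms by (simp add: interchange_involution del: assoc_simp)
  finally show ?thesis by simp
qed

end

section \<open>The internal hom is symmetric monoidal\<close>

context sm_functor
begin

lemma fobj_simp [simp]: "x \<in> Obj A \<Longrightarrow> FObj F x \<in> Obj B"
  using fobj by auto

lemma farr_simps [simp]:
  assumes "f \<in> Arr A"
  shows "FArr F f \<in> Arr B" "Dom B (FArr F f) = FObj F (Dom A f)" "Cod B (FArr F f) = FObj F (Cod A f)"
  using farr_hom[of f "Dom A f" "Cod A f"] assms by (simp_all add: Hom_iff)

declare farr_idt [simp]

lemma farr_cmp_simp [simp]:
  "f \<in> Arr A \<Longrightarrow> g \<in> Arr A \<Longrightarrow> Dom A g = Cod A f \<Longrightarrow>
    FArr F (g \<cdot>\<^bsub>A\<^esub> f) = FArr F g \<cdot>\<^bsub>B\<^esub> FArr F f"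
  using farr_cmp[of f "Dom A f" "Cod A f" g "Cod A g"] by (simp add: Hom_iff)

lemma funit_simps [simp]:
  "FUnit F \<in> Arr B" "Dom B (FUnit F) = \<I>\<^bsub>B\<^esub>" "Cod B (FUnit F) = FObj F \<I>\<^bsub>A\<^esub>"
  using funit_hom by (simp_all add: Hom_iff)

lemma ften_simps [simp]:
  assumes "x \<in> Obj A" "y \<in> Obj A"
  shows "FTen F (x, y) \<in> Arr B" "Dom B (FTen F (x, y)) = FObj F x \<otimes>\<^bsub>B\<^esub> FObj F y"
    "Cod B (FTen F (x, y)) = FObj F (x \<otimes>\<^bsub>A\<^esub> y)"
  using ften_hom[OF assms] by (simp_all add: Hom_iff)

lemma ften_nat:
  assumes "f \<in> Arr A" "g \<in> Arr A" "Cod A f = x'" "Cod A g = y'"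
  shows "FTen F (x', y') \<cdot>\<^bsub>B\<^esub> (FArr F f \<boxtimes>\<^bsub>B\<^esub> FArr F g) =
    FArr F (f \<boxtimes>\<^bsub>A\<^esub> g) \<cdot>\<^bsub>B\<^esub> FTen F (Dom A f, Dom A g)"
  using ften_natural[of f "Dom A f" x' g "Dom A g" y'] assms by (simp add: Hom_iff)

lemma ften_ass':
  assumes "x \<in> Obj A" "y \<in> Obj A" "z \<in> Obj A"
  shows "FArr F (Ass A x y z) \<cdot>\<^bsub>B\<^esub> (FTen F (x, y \<otimes>\<^bsub>A\<^esub> z) \<cdot>\<^bsub>B\<^esub> (\<one>\<^bsub>B\<^esub> (FObj F x) \<boxtimes>\<^bsub>B\<^esub> FTen F (y, z))) =
    FTen F (x \<otimes>\<^bsub>A\<^esub> y, z) \<cdot>\<^bsub>B\<^esub> ((FTen F (x, y) \<boxtimes>\<^bsub>B\<^esub> \<one>\<^bsub>B\<^esub> (FObj F z)) \<cdot>\<^bsub>B\<^esub>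
      Ass B (FObj F x) (FObj F y) (FObj F z))"
  using ften_ass[OF assms] assms by simp

lemma ften_run':
  "x \<in> Obj A \<Longrightarrow> FArr F (Run A x) \<cdot>\<^bsub>B\<^esub> (FTen F (x, \<I>\<^bsub>A\<^esub>) \<cdot>\<^bsub>B\<^esub> (\<one>\<^bsub>B\<^esub> (FObj F x) \<boxtimes>\<^bsub>B\<^esub> FUnit F)) = Run B (FObj F x)"
  using ften_run[of x] by simp

lemma ften_lun':
  "x \<in> Obj A \<Longrightarrow> FArr F (Lun A x) \<cdot>\<^bsub>B\<^esub> (FTen F (\<I>\<^bsub>A\<^esub>, x) \<cdot>\<^bsub>B\<^esub> (FUnit F \<boxtimes>\<^bsub>B\<^esub> \<one>\<^bsub>B\<^esub> (FObj F x))) = Lun B (FObj F x)"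
  using ften_lun[of x] by simp

end

context sm_transformation
begin

lemma tcmp_simps [simp]:
  assumes "x \<in> Obj A"
  shows "TCmp \<sigma> x \<in> Arr B" "Dom B (TCmp \<sigma> x) = FObj (TSrc \<sigma>) x" "Cod B (TCmp \<sigma> x) = FObj (TTgt \<sigma>) x"
  using tcmp_hom[OF assms] by (simp_all add: Hom_iff)

lemma tcmp_nat:
  assumes "f \<in> Arr A"
  shows "TCmp \<sigma> (Cod A f) \<cdot>\<^bsub>B\<^esub> FArr (TSrc \<sigma>) f = FArr (TTgt \<sigma>) f \<cdot>\<^bsub>B\<^esub> TCmp \<sigma> (Dom A f)"
  using tcmp_natural[of f "Dom A f" "Cod A f"] assms by (simp add: Hom_iff)

end

lemma smtrans_eqI:
  fixes \<sigma> \<tau> :: "('o, 'a, 'p, 'b) smtrans"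
  assumes "TSrc \<sigma> = TSrc \<tau>" "TTgt \<sigma> = TTgt \<tau>" "TCmp \<sigma> \<in> extensional X" "TCmp \<tau> \<in> extensional X"
    "\<And>x. x \<in> X \<Longrightarrow> TCmp \<sigma> x = TCmp \<tau> x"
  shows "\<sigma> = \<tau>"
  using assms extensionalityI[of "TCmp \<sigma>" X "TCmp \<tau>"] by (cases \<sigma>; cases \<tau>) auto

lemma smfun_eqI:
  fixes F G :: "('o, 'a, 'p, 'b) smfun"
  assumes "FObj F \<in> extensional X" "FObj G \<in> extensional X" "FArr F \<in> extensional Y" "FArr G \<in> extensional Y"
    "FTen F \<in> extensional (X \<times> X)" "FTen G \<in> extensional (X \<times> X)"
    "\<And>x. x \<in> X \<Longrightarrow> FObj F x = FObj G x" "\<And>f. f \<in> Y \<Longrightarrow> FArr F f = FArr G f" "FUnit F = FUnit G"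
    "\<And>x y. x \<in> X \<Longrightarrow> y \<in> X \<Longrightarrow> FTen F (x, y) = FTen G (x, y)"
  shows "F = G"
proof -
  have "FObj F = FObj G"
    by (rule extensionalityI[OF assms(1,2,7)])
  moreover have "FArr F = FArr G"
    by (rule extensionalityI[OF assms(3,4,8)])
  moreover have "FTen F = FTen G"
    by (rule extensionalityI[OF assms(5,6)]) (use assms(10) in auto)
  ultimately show ?thesis
    using assms(9) by (cases F; cases G) auto
qed

lemma hom_smc_simps [simp]:
  "F \<in> Obj (hom_smc A B) \<longleftrightarrow> sm_functor A B F"
  "\<sigma> \<in> Arr (hom_smc A B) \<longleftrightarrow> sm_transformation A B \<sigma>"
  "Dom (hom_smc A B) = TSrc" "Cod (hom_smc A B) = TTgt"
  "\<one>\<^bsub>hom_smc A B\<^esub> F = \<lparr>TSrc = F, TTgt = F, TCmp = (\<lambda>x\<in>Obj A. \<one>\<^bsub>B\<^esub> (FObj F x))\<rparr>"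
  "\<tau> \<cdot>\<^bsub>hom_smc A B\<^esub> \<sigma> =
    \<lparr>TSrc = TSrc \<sigma>, TTgt = TTgt \<tau>, TCmp = (\<lambda>x\<in>Obj A. TCmp \<tau> x \<cdot>\<^bsub>B\<^esub> TCmp \<sigma> x)\<rparr>"
  "\<I>\<^bsub>hom_smc A B\<^esub> = const_fun A B"
  "F \<otimes>\<^bsub>hom_smc A B\<^esub> G = box_fun A B F G"
  "\<sigma> \<boxtimes>\<^bsub>hom_smc A B\<^esub> \<tau> = \<lparr>TSrc = box_fun A B (TSrc \<sigma>) (TSrc \<tau>),
    TTgt = box_fun A B (TTgt \<sigma>) (TTgt \<tau>), TCmp = (\<lambda>x\<in>Obj A. TCmp \<sigma> x \<boxtimes>\<^bsub>B\<^esub> TCmp \<tau> x)\<rparr>"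
  "Ass (hom_smc A B) F G H = \<lparr>TSrc = box_fun A B F (box_fun A B G H),
    TTgt = box_fun A B (box_fun A B F G) H, TCmp = (\<lambda>x\<in>Obj A. Ass B (FObj F x) (FObj G x) (FObj H x))\<rparr>"
  "Run (hom_smc A B) F = \<lparr>TSrc = box_fun A B F (const_fun A B), TTgt = F, TCmp = (\<lambda>x\<in>Obj A. Run B (FObj F x))\<rparr>"
  "Lun (hom_smc A B) F = \<lparr>TSrc = box_fun A B (const_fun A B) F, TTgt = F, TCmp = (\<lambda>x\<in>Obj A. Lun B (FObj F x))\<rparr>"
  "Sym (hom_smc A B) F G = \<lparr>TSrc = box_fun A B F G, TTgt = box_fun A B G F,
    TCmp = (\<lambda>x\<in>Obj A. Sym B (FObj F x) (FObj G x))\<rparr>"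
  by (simp_all add: hom_smc_def)

lemma const_fun_simps [simp]:
  "x \<in> Obj A \<Longrightarrow> FObj (const_fun A B) x = \<I>\<^bsub>B\<^esub>"
  "f \<in> Arr A \<Longrightarrow> FArr (const_fun A B) f = \<one>\<^bsub>B\<^esub> \<I>\<^bsub>B\<^esub>"
  "FUnit (const_fun A B) = \<one>\<^bsub>B\<^esub> \<I>\<^bsub>B\<^esub>"
  "x \<in> Obj A \<Longrightarrow> y \<in> Obj A \<Longrightarrow> FTen (const_fun A B) (x, y) = Run B \<I>\<^bsub>B\<^esub>"
  by (simp_all add: const_fun_def)

lemma box_fun_simps [simp]:
  "x \<in> Obj A \<Longrightarrow> FObj (box_fun A B F G) x = FObj F x \<otimes>\<^bsub>B\<^esub> FObj G x"
  "f \<in> Arr A \<Longrightarrow> FArr (box_fun A B F G) f = FArr F f \<boxtimes>\<^bsub>B\<^esub> FArr G f"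
  "FUnit (box_fun A B F G) = (FUnit F \<boxtimes>\<^bsub>B\<^esub> FUnit G) \<cdot>\<^bsub>B\<^esub> Inv B (Run B \<I>\<^bsub>B\<^esub>)"
  "x \<in> Obj A \<Longrightarrow> y \<in> Obj A \<Longrightarrow> FTen (box_fun A B F G) (x, y) =
    (FTen F (x, y) \<boxtimes>\<^bsub>B\<^esub> FTen G (x, y)) \<cdot>\<^bsub>B\<^esub>
      interchange B (FObj F x) (FObj G x) (FObj F y) (FObj G y)"
  by (simp_all add: box_fun_def)

locale smc_pair =
  A: symmetric_monoidal_category A + B: symmetric_monoidal_category B
  for A :: "('o, 'a) smc" and B :: "('p, 'b) smc"
begin

lemma const_fun_functor: "sm_functor A B (const_fun A B)"
proof unfold_locales
  show "FObj (const_fun A B) \<in> Obj A \<rightarrow>\<^sub>E Obj B"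
    by (auto simp: const_fun_def)
  show "FArr (const_fun A B) \<in> extensional (Arr A)" "FTen (const_fun A B) \<in> extensional (Obj A \<times> Obj A)"
    by (simp_all add: const_fun_def)
  fix x y z
  assume "x \<in> Obj A" "y \<in> Obj A" "z \<in> Obj A"
  then show "FArr (const_fun A B) (Ass A x y z) \<cdot>\<^bsub>B\<^esub> FTen (const_fun A B) (x, y \<otimes>\<^bsub>A\<^esub> z) \<cdot>\<^bsub>B\<^esub>
      (\<one>\<^bsub>B\<^esub> (FObj (const_fun A B) x) \<boxtimes>\<^bsub>B\<^esub> FTen (const_fun A B) (y, z)) =
    FTen (const_fun A B) (x \<otimes>\<^bsub>A\<^esub> y, z) \<cdot>\<^bsub>B\<^esub> (FTen (const_fun A B) (x, y) \<boxtimes>\<^bsub>B\<^esub> \<one>\<^bsub>B\<^esub> (FObj (const_fun A B) z)) \<cdot>\<^bsub>B\<^esub>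
      Ass B (FObj (const_fun A B) x) (FObj (const_fun A B) y) (FObj (const_fun A B) z)"
    using B.ass_unit_run by simp
qed (auto simp: Hom_iff B.run_nat B.run_unit_eq_lun[symmetric] B.sym_unit_unit)

end

locale functor_pair = smc_pair A B + F: sm_functor A B F + G: sm_functor A B G
  for A :: "('o, 'a) smc" and B :: "('p, 'b) smc" and F G
begin

lemma box_ften_natural:
  assumes "f \<in> Arr A" "g \<in> Arr A"
  shows "FTen (box_fun A B F G) (Cod A f, Cod A g) \<cdot>\<^bsub>B\<^esub>
      (FArr (box_fun A B F G) f \<boxtimes>\<^bsub>B\<^esub> FArr (box_fun A B F G) g) =
    FArr (box_fun A B F G) (f \<boxtimes>\<^bsub>A\<^esub> g) \<cdot>\<^bsub>B\<^esub> FTen (box_fun A B F G) (Dom A f, Dom A g)"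
  using assms by (simp add: B.interchange_natural F.ften_nat G.ften_nat)

text \<open>
  Naturality of the interchange separates the structure arrows of \<open>F\<close> and \<open>G\<close> from two
  interchanges. The former satisfy the axiom factor by factor, and the latter satisfy
  \<open>interchange_ass\<close>. The unit axioms follow the same pattern.
\<close>

lemma box_ften_ass:
  assumes "x \<in> Obj A" "y \<in> Obj A" "z \<in> Obj A"
  shows "FArr (box_fun A B F G) (Ass A x y z) \<cdot>\<^bsub>B\<^esub> (FTen (box_fun A B F G) (x, y \<otimes>\<^bsub>A\<^esub> z) \<cdot>\<^bsub>B\<^esub>
      (\<one>\<^bsub>B\<^esub> (FObj (box_fun A B F G) x) \<boxtimes>\<^bsub>B\<^esub> FTen (box_fun A B F G) (y, z))) =
    FTen (box_fun A B F G) (x \<otimes>\<^bsub>A\<^esub> y, z) \<cdot>\<^bsub>B\<^esub> ((FTen (box_fun A B F G) (x, y) \<boxtimes>\<^bsub>B\<^esub> \<one>\<^bsub>B\<^esub> (FObj (box_fun A B F G) z)) \<cdot>\<^bsub>B\<^esub>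
      Ass B (FObj (box_fun A B F G) x) (FObj (box_fun A B F G) y) (FObj (box_fun A B F G) z))"
    (is "?lhs = ?rhs")
proof -
  note o = assms
  let ?m = "interchange B"
  let ?Fx = "FObj F x" and ?Fy = "FObj F y" and ?Fz = "FObj F z"
  let ?Gx = "FObj G x" and ?Gy = "FObj G y" and ?Gz = "FObj G z"
  let ?yz = "y \<otimes>\<^bsub>A\<^esub> z" and ?xy = "x \<otimes>\<^bsub>A\<^esub> y"
  let ?mr = "\<one>\<^bsub>B\<^esub> (?Fx \<otimes>\<^bsub>B\<^esub> ?Gx) \<boxtimes>\<^bsub>B\<^esub> ?m ?Fy ?Gy ?Fz ?Gz"
  let ?ml = "?m ?Fx ?Gx ?Fy ?Gy \<boxtimes>\<^bsub>B\<^esub> \<one>\<^bsub>B\<^esub> (?Fz \<otimes>\<^bsub>B\<^esub> ?Gz)"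
  have "?lhs = ((FArr F (Ass A x y z) \<cdot>\<^bsub>B\<^esub> FTen F (x, ?yz)) \<boxtimes>\<^bsub>B\<^esub> (FArr G (Ass A x y z) \<cdot>\<^bsub>B\<^esub> FTen G (x, ?yz))) \<cdot>\<^bsub>B\<^esub>
    ((?m ?Fx ?Gx (FObj F ?yz) (FObj G ?yz) \<cdot>\<^bsub>B\<^esub>
      ((\<one>\<^bsub>B\<^esub> ?Fx \<boxtimes>\<^bsub>B\<^esub> \<one>\<^bsub>B\<^esub> ?Gx) \<boxtimes>\<^bsub>B\<^esub> (FTen F (y, z) \<boxtimes>\<^bsub>B\<^esub> FTen G (y, z)))) \<cdot>\<^bsub>B\<^esub> ?mr)"
    using o by simp
  also have "\<dots> = ((FArr F (Ass A x y z) \<cdot>\<^bsub>B\<^esub> (FTen F (x, ?yz) \<cdot>\<^bsub>B\<^esub> (\<one>\<^bsub>B\<^esub> ?Fx \<boxtimes>\<^bsub>B\<^esub> FTen F (y, z)))) \<boxtimes>\<^bsub>B\<^esub>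
      (FArr G (Ass A x y z) \<cdot>\<^bsub>B\<^esub> (FTen G (x, ?yz) \<cdot>\<^bsub>B\<^esub> (\<one>\<^bsub>B\<^esub> ?Gx \<boxtimes>\<^bsub>B\<^esub> FTen G (y, z))))) \<cdot>\<^bsub>B\<^esub>
    (?m ?Fx ?Gx (?Fy \<otimes>\<^bsub>B\<^esub> ?Fz) (?Gy \<otimes>\<^bsub>B\<^esub> ?Gz) \<cdot>\<^bsub>B\<^esub> ?mr)"
    using o by (subst B.interchange_natural) simp_all
  also have "\<dots> = ((FTen F (?xy, z) \<cdot>\<^bsub>B\<^esub> (FTen F (x, y) \<boxtimes>\<^bsub>B\<^esub> \<one>\<^bsub>B\<^esub> ?Fz)) \<boxtimes>\<^bsub>B\<^esub> (FTen G (?xy, z) \<cdot>\<^bsub>B\<^esub> (FTen G (x, y) \<boxtimes>\<^bsub>B\<^esub> \<one>\<^bsub>B\<^esub> ?Gz))) \<cdot>\<^bsub>B\<^esub>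
    ((Ass B ?Fx ?Fy ?Fz \<boxtimes>\<^bsub>B\<^esub> Ass B ?Gx ?Gy ?Gz) \<cdot>\<^bsub>B\<^esub> (?m ?Fx ?Gx (?Fy \<otimes>\<^bsub>B\<^esub> ?Fz) (?Gy \<otimes>\<^bsub>B\<^esub> ?Gz) \<cdot>\<^bsub>B\<^esub> ?mr))"
    using o by (subst F.ften_ass', simp_all, subst G.ften_ass', simp_all)
  also have "\<dots> = ((FTen F (?xy, z) \<cdot>\<^bsub>B\<^esub> (FTen F (x, y) \<boxtimes>\<^bsub>B\<^esub> \<one>\<^bsub>B\<^esub> ?Fz)) \<boxtimes>\<^bsub>B\<^esub> (FTen G (?xy, z) \<cdot>\<^bsub>B\<^esub> (FTen G (x, y) \<boxtimes>\<^bsub>B\<^esub> \<one>\<^bsub>B\<^esub> ?Gz))) \<cdot>\<^bsub>B\<^esub>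
    (?m (?Fx \<otimes>\<^bsub>B\<^esub> ?Fy) (?Gx \<otimes>\<^bsub>B\<^esub> ?Gy) ?Fz ?Gz \<cdot>\<^bsub>B\<^esub> (?ml \<cdot>\<^bsub>B\<^esub> Ass B (?Fx \<otimes>\<^bsub>B\<^esub> ?Gx) (?Fy \<otimes>\<^bsub>B\<^esub> ?Gy) (?Fz \<otimes>\<^bsub>B\<^esub> ?Gz)))"
    using o by (subst B.interchange_ass) simp_all
  also have "\<dots> = (FTen F (?xy, z) \<boxtimes>\<^bsub>B\<^esub> FTen G (?xy, z)) \<cdot>\<^bsub>B\<^esub>
    ((((FTen F (x, y) \<boxtimes>\<^bsub>B\<^esub> \<one>\<^bsub>B\<^esub> ?Fz) \<boxtimes>\<^bsub>B\<^esub> (FTen G (x, y) \<boxtimes>\<^bsub>B\<^esub> \<one>\<^bsub>B\<^esub> ?Gz)) \<cdot>\<^bsub>B\<^esub> ?m (?Fx \<otimes>\<^bsub>B\<^esub> ?Fy) (?Gx \<otimes>\<^bsub>B\<^esub> ?Gy) ?Fz ?Gz) \<cdot>\<^bsub>B\<^esub>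
     (?ml \<cdot>\<^bsub>B\<^esub> Ass B (?Fx \<otimes>\<^bsub>B\<^esub> ?Gx) (?Fy \<otimes>\<^bsub>B\<^esub> ?Gy) (?Fz \<otimes>\<^bsub>B\<^esub> ?Gz)))"
    using o by simp
  also have "((FTen F (x, y) \<boxtimes>\<^bsub>B\<^esub> \<one>\<^bsub>B\<^esub> ?Fz) \<boxtimes>\<^bsub>B\<^esub> (FTen G (x, y) \<boxtimes>\<^bsub>B\<^esub> \<one>\<^bsub>B\<^esub> ?Gz)) \<cdot>\<^bsub>B\<^esub> ?m (?Fx \<otimes>\<^bsub>B\<^esub> ?Fy) (?Gx \<otimes>\<^bsub>B\<^esub> ?Gy) ?Fz ?Gz =
     ?m (FObj F ?xy) (FObj G ?xy) ?Fz ?Gz \<cdot>\<^bsub>B\<^esub> ((FTen F (x, y) \<boxtimes>\<^bsub>B\<^esub> FTen G (x, y)) \<boxtimes>\<^bsub>B\<^esub> (\<one>\<^bsub>B\<^esub> ?Fz \<boxtimes>\<^bsub>B\<^esub> \<one>\<^bsub>B\<^esub> ?Gz))"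
    using o by (subst B.interchange_natural) simp_all
  also have "(FTen F (?xy, z) \<boxtimes>\<^bsub>B\<^esub> FTen G (?xy, z)) \<cdot>\<^bsub>B\<^esub> ((\<dots>) \<cdot>\<^bsub>B\<^esub>
     (?ml \<cdot>\<^bsub>B\<^esub> Ass B (?Fx \<otimes>\<^bsub>B\<^esub> ?Gx) (?Fy \<otimes>\<^bsub>B\<^esub> ?Gy) (?Fz \<otimes>\<^bsub>B\<^esub> ?Gz))) = ?rhs"
    using o by simp
  finally show ?thesis .
qed

lemma box_ften_run:
  assumes "x \<in> Obj A"
  shows "FArr (box_fun A B F G) (Run A x) \<cdot>\<^bsub>B\<^esub> (FTen (box_fun A B F G) (x, \<I>\<^bsub>A\<^esub>) \<cdot>\<^bsub>B\<^esub>
      (\<one>\<^bsub>B\<^esub> (FObj (box_fun A B F G) x) \<boxtimes>\<^bsub>B\<^esub> FUnit (box_fun A B F G))) = Run B (FObj (box_fun A B F G) x)"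
    (is "?lhs = _")
proof -
  let ?m = "interchange B" and ?x = "FObj F x" and ?y = "FObj G x" and ?I = "\<I>\<^bsub>B\<^esub>"
  let ?i = "\<one>\<^bsub>B\<^esub> (?x \<otimes>\<^bsub>B\<^esub> ?y) \<boxtimes>\<^bsub>B\<^esub> Inv B (Run B ?I)"
  have "?lhs = ((FArr F (Run A x) \<cdot>\<^bsub>B\<^esub> FTen F (x, \<I>\<^bsub>A\<^esub>)) \<boxtimes>\<^bsub>B\<^esub> (FArr G (Run A x) \<cdot>\<^bsub>B\<^esub> FTen G (x, \<I>\<^bsub>A\<^esub>))) \<cdot>\<^bsub>B\<^esub>
    ((?m ?x ?y (FObj F \<I>\<^bsub>A\<^esub>) (FObj G \<I>\<^bsub>A\<^esub>) \<cdot>\<^bsub>B\<^esub>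
      ((\<one>\<^bsub>B\<^esub> ?x \<boxtimes>\<^bsub>B\<^esub> \<one>\<^bsub>B\<^esub> ?y) \<boxtimes>\<^bsub>B\<^esub> (FUnit F \<boxtimes>\<^bsub>B\<^esub> FUnit G))) \<cdot>\<^bsub>B\<^esub> ?i)"
    using assms by simp
  also have "\<dots> = ((FArr F (Run A x) \<cdot>\<^bsub>B\<^esub> (FTen F (x, \<I>\<^bsub>A\<^esub>) \<cdot>\<^bsub>B\<^esub> (\<one>\<^bsub>B\<^esub> ?x \<boxtimes>\<^bsub>B\<^esub> FUnit F))) \<boxtimes>\<^bsub>B\<^esub>
      (FArr G (Run A x) \<cdot>\<^bsub>B\<^esub> (FTen G (x, \<I>\<^bsub>A\<^esub>) \<cdot>\<^bsub>B\<^esub> (\<one>\<^bsub>B\<^esub> ?y \<boxtimes>\<^bsub>B\<^esub> FUnit G)))) \<cdot>\<^bsub>B\<^esub> (?m ?x ?y ?I ?I \<cdot>\<^bsub>B\<^esub> ?i)"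
    using assms by (subst B.interchange_natural) simp_all
  also have "\<dots> = Run B (?x \<otimes>\<^bsub>B\<^esub> ?y)"
    using assms by (simp add: F.ften_run' G.ften_run' B.interchange_run)
  finally show ?thesis
    using assms by simp
qed

lemma box_ften_lun:
  assumes "x \<in> Obj A"
  shows "FArr (box_fun A B F G) (Lun A x) \<cdot>\<^bsub>B\<^esub> (FTen (box_fun A B F G) (\<I>\<^bsub>A\<^esub>, x) \<cdot>\<^bsub>B\<^esub>
      (FUnit (box_fun A B F G) \<boxtimes>\<^bsub>B\<^esub> \<one>\<^bsub>B\<^esub> (FObj (box_fun A B F G) x))) = Lun B (FObj (box_fun A B F G) x)"
    (is "?lhs = _")
proof -
  let ?m = "interchange B" and ?x = "FObj F x" and ?y = "FObj G x" and ?I = "\<I>\<^bsub>B\<^esub>"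
  let ?i = "Inv B (Run B ?I) \<boxtimes>\<^bsub>B\<^esub> \<one>\<^bsub>B\<^esub> (?x \<otimes>\<^bsub>B\<^esub> ?y)"
  have "?lhs = ((FArr F (Lun A x) \<cdot>\<^bsub>B\<^esub> FTen F (\<I>\<^bsub>A\<^esub>, x)) \<boxtimes>\<^bsub>B\<^esub> (FArr G (Lun A x) \<cdot>\<^bsub>B\<^esub> FTen G (\<I>\<^bsub>A\<^esub>, x))) \<cdot>\<^bsub>B\<^esub>
    ((?m (FObj F \<I>\<^bsub>A\<^esub>) (FObj G \<I>\<^bsub>A\<^esub>) ?x ?y \<cdot>\<^bsub>B\<^esub>
      ((FUnit F \<boxtimes>\<^bsub>B\<^esub> FUnit G) \<boxtimes>\<^bsub>B\<^esub> (\<one>\<^bsub>B\<^esub> ?x \<boxtimes>\<^bsub>B\<^esub> \<one>\<^bsub>B\<^esub> ?y))) \<cdot>\<^bsub>B\<^esub> ?i)"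
    using assms by simp
  also have "\<dots> = ((FArr F (Lun A x) \<cdot>\<^bsub>B\<^esub> (FTen F (\<I>\<^bsub>A\<^esub>, x) \<cdot>\<^bsub>B\<^esub> (FUnit F \<boxtimes>\<^bsub>B\<^esub> \<one>\<^bsub>B\<^esub> ?x))) \<boxtimes>\<^bsub>B\<^esub>
      (FArr G (Lun A x) \<cdot>\<^bsub>B\<^esub> (FTen G (\<I>\<^bsub>A\<^esub>, x) \<cdot>\<^bsub>B\<^esub> (FUnit G \<boxtimes>\<^bsub>B\<^esub> \<one>\<^bsub>B\<^esub> ?y)))) \<cdot>\<^bsub>B\<^esub> (?m ?I ?I ?x ?y \<cdot>\<^bsub>B\<^esub> ?i)"
    using assms by (subst B.interchange_natural) simp_all
  also have "\<dots> = Lun B (?x \<otimes>\<^bsub>B\<^esub> ?y)"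
    using assms by (simp add: F.ften_lun' G.ften_lun' B.interchange_lun)
  finally show ?thesis
    using assms by simp
qed

lemma box_ften_sym:
  assumes "x \<in> Obj A" "y \<in> Obj A"
  shows "FArr (box_fun A B F G) (Sym A x y) \<cdot>\<^bsub>B\<^esub> FTen (box_fun A B F G) (x, y) =
    FTen (box_fun A B F G) (y, x) \<cdot>\<^bsub>B\<^esub> Sym B (FObj (box_fun A B F G) x) (FObj (box_fun A B F G) y)"
  using assms by (simp add: F.ften_sym G.ften_sym B.interchange_sym[symmetric])

lemma box_fun_functor: "sm_functor A B (box_fun A B F G)"
proof unfold_locales
  show "FObj (box_fun A B F G) \<in> Obj A \<rightarrow>\<^sub>E Obj B"
    by (auto simp: box_fun_def)
  show "FArr (box_fun A B F G) \<in> extensional (Arr A)" "FTen (box_fun A B F G) \<in> extensional (Obj A \<times> Obj A)"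
    by (simp_all add: box_fun_def)
  fix x y z
  assume o: "x \<in> Obj A" "y \<in> Obj A"
  show "FArr (box_fun A B F G) (Sym A x y) \<cdot>\<^bsub>B\<^esub> FTen (box_fun A B F G) (x, y) =
    FTen (box_fun A B F G) (y, x) \<cdot>\<^bsub>B\<^esub> Sym B (FObj (box_fun A B F G) x) (FObj (box_fun A B F G) y)"
    by (rule box_ften_sym[OF o])
  assume z: "z \<in> Obj A"
  show "FArr (box_fun A B F G) (Ass A x y z) \<cdot>\<^bsub>B\<^esub> FTen (box_fun A B F G) (x, y \<otimes>\<^bsub>A\<^esub> z) \<cdot>\<^bsub>B\<^esub>
      (\<one>\<^bsub>B\<^esub> (FObj (box_fun A B F G) x) \<boxtimes>\<^bsub>B\<^esub> FTen (box_fun A B F G) (y, z)) =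
    FTen (box_fun A B F G) (x \<otimes>\<^bsub>A\<^esub> y, z) \<cdot>\<^bsub>B\<^esub> (FTen (box_fun A B F G) (x, y) \<boxtimes>\<^bsub>B\<^esub> \<one>\<^bsub>B\<^esub> (FObj (box_fun A B F G) z)) \<cdot>\<^bsub>B\<^esub>
      Ass B (FObj (box_fun A B F G) x) (FObj (box_fun A B F G) y) (FObj (box_fun A B F G) z)"
    using box_ften_ass[OF o z] o z by simp
next
  fix x
  assume x: "x \<in> Obj A"
  show "FArr (box_fun A B F G) (Run A x) \<cdot>\<^bsub>B\<^esub> FTen (box_fun A B F G) (x, \<I>\<^bsub>A\<^esub>) \<cdot>\<^bsub>B\<^esub>
      (\<one>\<^bsub>B\<^esub> (FObj (box_fun A B F G) x) \<boxtimes>\<^bsub>B\<^esub> FUnit (box_fun A B F G)) = Run B (FObj (box_fun A B F G) x)"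
    using box_ften_run[OF x] x by simp
  show "FArr (box_fun A B F G) (Lun A x) \<cdot>\<^bsub>B\<^esub> FTen (box_fun A B F G) (\<I>\<^bsub>A\<^esub>, x) \<cdot>\<^bsub>B\<^esub>
      (FUnit (box_fun A B F G) \<boxtimes>\<^bsub>B\<^esub> \<one>\<^bsub>B\<^esub> (FObj (box_fun A B F G) x)) = Lun B (FObj (box_fun A B F G) x)"
    using box_ften_lun[OF x] x by simp
next
  fix f x x' g y y'
  assume "f \<in> Hom A x x'" "g \<in> Hom A y y'"
  then show "FTen (box_fun A B F G) (x', y') \<cdot>\<^bsub>B\<^esub> (FArr (box_fun A B F G) f \<boxtimes>\<^bsub>B\<^esub> FArr (box_fun A B F G) g) =
    FArr (box_fun A B F G) (f \<boxtimes>\<^bsub>A\<^esub> g) \<cdot>\<^bsub>B\<^esub> FTen (box_fun A B F G) (x, y)"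
    using box_ften_natural[of f g] by (auto simp: Hom_iff simp del: box_fun_simps)
qed (auto simp: Hom_iff)

end

lemma sm_transformationI:
  assumes "sm_functor A B F" "sm_functor A B G"
    and "\<And>x. x \<in> Obj A \<Longrightarrow> t x \<in> Arr B" "\<And>x. x \<in> Obj A \<Longrightarrow> Dom B (t x) = FObj F x"
      "\<And>x. x \<in> Obj A \<Longrightarrow> Cod B (t x) = FObj G x"
    and "\<And>f. f \<in> Arr A \<Longrightarrow> t (Cod A f) \<cdot>\<^bsub>B\<^esub> FArr F f = FArr G f \<cdot>\<^bsub>B\<^esub> t (Dom A f)"
    and "t \<I>\<^bsub>A\<^esub> \<cdot>\<^bsub>B\<^esub> FUnit F = FUnit G"
    and "\<And>x y. x \<in> Obj A \<Longrightarrow> y \<in> Obj A \<Longrightarrow>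
      t (x \<otimes>\<^bsub>A\<^esub> y) \<cdot>\<^bsub>B\<^esub> FTen F (x, y) = FTen G (x, y) \<cdot>\<^bsub>B\<^esub> (t x \<boxtimes>\<^bsub>B\<^esub> t y)"
  shows "sm_transformation A B \<lparr>TSrc = F, TTgt = G, TCmp = (\<lambda>x\<in>Obj A. t x)\<rparr>"
proof -
  interpret F: sm_functor A B F by fact
  show ?thesis
    using assms by (intro sm_transformation.intro sm_transformation_axioms.intro) (auto simp: Hom_iff)
qed

context smc_pair
begin

lemma hom_idt:
  assumes "sm_functor A B F"
  shows "sm_transformation A B \<lparr>TSrc = F, TTgt = F, TCmp = (\<lambda>x\<in>Obj A. \<one>\<^bsub>B\<^esub> (FObj F x))\<rparr>"
proof -
  interpret F: sm_functor A B F by fact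
  show ?thesis
    by (rule sm_transformationI) (simp_all add: assms)
qed

lemma hom_cmp:
  assumes "sm_transformation A B \<sigma>" "sm_transformation A B \<tau>" "TSrc \<tau> = TTgt \<sigma>"
  shows "sm_transformation A B
    \<lparr>TSrc = TSrc \<sigma>, TTgt = TTgt \<tau>, TCmp = (\<lambda>x\<in>Obj A. TCmp \<tau> x \<cdot>\<^bsub>B\<^esub> TCmp \<sigma> x)\<rparr>"
    (is "sm_transformation A B ?\<rho>")
proof -
  interpret S: sm_transformation A B \<sigma> by fact
  interpret T: sm_transformation A B \<tau> by fact
  note [simp] = assms(3)
  have nat: "(TCmp \<tau> (Cod A f) \<cdot>\<^bsub>B\<^esub> TCmp \<sigma> (Cod A f)) \<cdot>\<^bsub>B\<^esub> FArr (TSrc \<sigma>) f =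
    FArr (TTgt \<tau>) f \<cdot>\<^bsub>B\<^esub> (TCmp \<tau> (Dom A f) \<cdot>\<^bsub>B\<^esub> TCmp \<sigma> (Dom A f))" if f: "f \<in> Arr A" for f
  proof -
    have "(TCmp \<tau> (Cod A f) \<cdot>\<^bsub>B\<^esub> TCmp \<sigma> (Cod A f)) \<cdot>\<^bsub>B\<^esub> FArr (TSrc \<sigma>) f =
      (TCmp \<tau> (Cod A f) \<cdot>\<^bsub>B\<^esub> FArr (TSrc \<tau>) f) \<cdot>\<^bsub>B\<^esub> TCmp \<sigma> (Dom A f)"
      using f by (simp add: S.tcmp_nat)
    also have "\<dots> = FArr (TTgt \<tau>) f \<cdot>\<^bsub>B\<^esub> (TCmp \<tau> (Dom A f) \<cdot>\<^bsub>B\<^esub> TCmp \<sigma> (Dom A f))"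
      unfolding T.tcmp_nat[OF f] using f by simp
    finally show ?thesis .
  qed
  have ten: "(TCmp \<tau> (x \<otimes>\<^bsub>A\<^esub> y) \<cdot>\<^bsub>B\<^esub> TCmp \<sigma> (x \<otimes>\<^bsub>A\<^esub> y)) \<cdot>\<^bsub>B\<^esub> FTen (TSrc \<sigma>) (x, y) =
    FTen (TTgt \<tau>) (x, y) \<cdot>\<^bsub>B\<^esub> ((TCmp \<tau> x \<cdot>\<^bsub>B\<^esub> TCmp \<sigma> x) \<boxtimes>\<^bsub>B\<^esub> (TCmp \<tau> y \<cdot>\<^bsub>B\<^esub> TCmp \<sigma> y))"
    if o: "x \<in> Obj A" "y \<in> Obj A" for x y
  proof -
    have "(TCmp \<tau> (x \<otimes>\<^bsub>A\<^esub> y) \<cdot>\<^bsub>B\<^esub> TCmp \<sigma> (x \<otimes>\<^bsub>A\<^esub> y)) \<cdot>\<^bsub>B\<^esub> FTen (TSrc \<sigma>) (x, y) =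
      (TCmp \<tau> (x \<otimes>\<^bsub>A\<^esub> y) \<cdot>\<^bsub>B\<^esub> FTen (TSrc \<tau>) (x, y)) \<cdot>\<^bsub>B\<^esub> (TCmp \<sigma> x \<boxtimes>\<^bsub>B\<^esub> TCmp \<sigma> y)"
      using o by (simp add: S.tcmp_ten)
    also have "\<dots> = FTen (TTgt \<tau>) (x, y) \<cdot>\<^bsub>B\<^esub> ((TCmp \<tau> x \<cdot>\<^bsub>B\<^esub> TCmp \<sigma> x) \<boxtimes>\<^bsub>B\<^esub> (TCmp \<tau> y \<cdot>\<^bsub>B\<^esub> TCmp \<sigma> y))"
      unfolding T.tcmp_ten[OF o] using o by simp
    finally show ?thesis .
  qed
  have "(TCmp \<tau> \<I>\<^bsub>A\<^esub> \<cdot>\<^bsub>B\<^esub> TCmp \<sigma> \<I>\<^bsub>A\<^esub>) \<cdot>\<^bsub>B\<^esub> FUnit (TSrc \<sigma>) = FUnit (TTgt \<tau>)"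
    using S.tcmp_unit T.tcmp_unit by simp
  then show ?thesis
    by (intro sm_transformationI S.F.sm_functor_axioms T.G.sm_functor_axioms)
      (use nat ten in \<open>simp_all del: B.assoc_simp\<close>)
qed

text \<open>
  The inverse components of a monoidal transformation are again natural and monoidal, so
  isomorphisms in the internal hom are recognised componentwise.
\<close>

lemma hom_inverse:
  assumes "sm_transformation A B \<sigma>" "\<And>x. x \<in> Obj A \<Longrightarrow> iso B (TCmp \<sigma> x)"
  shows "sm_transformation A B
    \<lparr>TSrc = TTgt \<sigma>, TTgt = TSrc \<sigma>, TCmp = (\<lambda>x\<in>Obj A. Inv B (TCmp \<sigma> x))\<rparr>"
proof -
  interpret S: sm_transformation A B \<sigma> by fact
  note i [simp] = assms(2)
  have nat: "Inv B (TCmp \<sigma> (Cod A f)) \<cdot>\<^bsub>B\<^esub> FArr (TTgt \<sigma>) f =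
    FArr (TSrc \<sigma>) f \<cdot>\<^bsub>B\<^esub> Inv B (TCmp \<sigma> (Dom A f))" if f: "f \<in> Arr A" for f
  proof -
    have "FArr (TSrc \<sigma>) f \<cdot>\<^bsub>B\<^esub> Inv B (TCmp \<sigma> (Dom A f)) =
      Inv B (TCmp \<sigma> (Cod A f)) \<cdot>\<^bsub>B\<^esub> ((TCmp \<sigma> (Cod A f) \<cdot>\<^bsub>B\<^esub> FArr (TSrc \<sigma>) f) \<cdot>\<^bsub>B\<^esub> Inv B (TCmp \<sigma> (Dom A f)))"
      using f by simp
    also have "\<dots> = Inv B (TCmp \<sigma> (Cod A f)) \<cdot>\<^bsub>B\<^esub> FArr (TTgt \<sigma>) f"
      unfolding S.tcmp_nat[OF f] using f by simp
    finally show ?thesis by simp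
  qed
  have ten: "Inv B (TCmp \<sigma> (x \<otimes>\<^bsub>A\<^esub> y)) \<cdot>\<^bsub>B\<^esub> FTen (TTgt \<sigma>) (x, y) =
    FTen (TSrc \<sigma>) (x, y) \<cdot>\<^bsub>B\<^esub> (Inv B (TCmp \<sigma> x) \<boxtimes>\<^bsub>B\<^esub> Inv B (TCmp \<sigma> y))"
    if o: "x \<in> Obj A" "y \<in> Obj A" for x y
  proof -
    have "FTen (TSrc \<sigma>) (x, y) \<cdot>\<^bsub>B\<^esub> (Inv B (TCmp \<sigma> x) \<boxtimes>\<^bsub>B\<^esub> Inv B (TCmp \<sigma> y)) =
      Inv B (TCmp \<sigma> (x \<otimes>\<^bsub>A\<^esub> y)) \<cdot>\<^bsub>B\<^esub> ((TCmp \<sigma> (x \<otimes>\<^bsub>A\<^esub> y) \<cdot>\<^bsub>B\<^esub> FTen (TSrc \<sigma>) (x, y)) \<cdot>\<^bsub>B\<^esub>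
        (Inv B (TCmp \<sigma> x) \<boxtimes>\<^bsub>B\<^esub> Inv B (TCmp \<sigma> y)))"
      using o by simp
    also have "\<dots> = Inv B (TCmp \<sigma> (x \<otimes>\<^bsub>A\<^esub> y)) \<cdot>\<^bsub>B\<^esub> FTen (TTgt \<sigma>) (x, y)"
      unfolding S.tcmp_ten[OF o] using o by simp
    finally show ?thesis by simp
  qed
  have "Inv B (TCmp \<sigma> \<I>\<^bsub>A\<^esub>) \<cdot>\<^bsub>B\<^esub> FUnit (TTgt \<sigma>) = FUnit (TSrc \<sigma>)"
    unfolding S.tcmp_unit[symmetric] by simp
  then show ?thesis
    by (intro sm_transformationI S.F.sm_functor_axioms S.G.sm_functor_axioms)
      (use nat ten in simp_all)
qed

lemma hom_iso:
  assumes "sm_transformation A B \<sigma>" "\<And>x. x \<in> Obj A \<Longrightarrow> iso B (TCmp \<sigma> x)"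
  shows "iso (hom_smc A B) \<sigma>"
proof -
  interpret S: sm_transformation A B \<sigma> by fact
  have "inverse_arrows (hom_smc A B) \<sigma>
    \<lparr>TSrc = TTgt \<sigma>, TTgt = TSrc \<sigma>, TCmp = (\<lambda>x\<in>Obj A. Inv B (TCmp \<sigma> x))\<rparr>"
    using assms hom_inverse[OF assms]
    by (auto simp: inverse_arrows_def Hom_iff intro!: restrict_ext)
  then show ?thesis
    by (auto simp: iso_def)
qed

lemma hom_tarr:
  assumes "sm_transformation A B \<sigma>" "sm_transformation A B \<tau>"
  shows "sm_transformation A B \<lparr>TSrc = box_fun A B (TSrc \<sigma>) (TSrc \<tau>),
    TTgt = box_fun A B (TTgt \<sigma>) (TTgt \<tau>), TCmp = (\<lambda>x\<in>Obj A. TCmp \<sigma> x \<boxtimes>\<^bsub>B\<^esub> TCmp \<tau> x)\<rparr>"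
proof -
  interpret S: sm_transformation A B \<sigma> by fact
  interpret T: sm_transformation A B \<tau> by fact
  interpret SS: functor_pair A B "TSrc \<sigma>" "TSrc \<tau>" ..
  interpret TT: functor_pair A B "TTgt \<sigma>" "TTgt \<tau>" ..
  interpret FS: sm_functor A B "box_fun A B (TSrc \<sigma>) (TSrc \<tau>)" by (rule SS.box_fun_functor)
  interpret FT: sm_functor A B "box_fun A B (TTgt \<sigma>) (TTgt \<tau>)" by (rule TT.box_fun_functor)
  show ?thesis
    by (intro sm_transformationI FS.sm_functor_axioms FT.sm_functor_axioms)
      (simp_all add: S.tcmp_nat T.tcmp_nat S.tcmp_unit T.tcmp_unit S.tcmp_ten T.tcmp_ten B.interchange_natural)
qed

lemma hom_ass:
  assumes "sm_functor A B F" "sm_functor A B G" "sm_functor A B H"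
  shows "sm_transformation A B \<lparr>TSrc = box_fun A B F (box_fun A B G H),
    TTgt = box_fun A B (box_fun A B F G) H, TCmp = (\<lambda>x\<in>Obj A. Ass B (FObj F x) (FObj G x) (FObj H x))\<rparr>"
proof -
  interpret F: sm_functor A B F by fact
  interpret G: sm_functor A B G by fact
  interpret H: sm_functor A B H by fact
  interpret FG: functor_pair A B F G ..
  interpret GH: functor_pair A B G H ..
  interpret FGf: sm_functor A B "box_fun A B F G" by (rule FG.box_fun_functor)
  interpret GHf: sm_functor A B "box_fun A B G H" by (rule GH.box_fun_functor)
  interpret L: functor_pair A B F "box_fun A B G H" ..
  interpret R: functor_pair A B "box_fun A B F G" H ..
  interpret Lf: sm_functor A B "box_fun A B F (box_fun A B G H)" by (rule L.box_fun_functor)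
  interpret Rf: sm_functor A B "box_fun A B (box_fun A B F G) H" by (rule R.box_fun_functor)
  let ?I = "\<I>\<^bsub>B\<^esub>" and ?m = "interchange B"
  let ?r = "Inv B (Run B ?I)"
  have unit: "Ass B (FObj F \<I>\<^bsub>A\<^esub>) (FObj G \<I>\<^bsub>A\<^esub>) (FObj H \<I>\<^bsub>A\<^esub>) \<cdot>\<^bsub>B\<^esub> FUnit (box_fun A B F (box_fun A B G H)) =
    FUnit (box_fun A B (box_fun A B F G) H)" (is "?lhs = ?rhs")
  proof -
    have "?lhs = Ass B (FObj F \<I>\<^bsub>A\<^esub>) (FObj G \<I>\<^bsub>A\<^esub>) (FObj H \<I>\<^bsub>A\<^esub>) \<cdot>\<^bsub>B\<^esub>
      ((FUnit F \<boxtimes>\<^bsub>B\<^esub> (FUnit G \<boxtimes>\<^bsub>B\<^esub> FUnit H)) \<cdot>\<^bsub>B\<^esub> ((\<one>\<^bsub>B\<^esub> ?I \<boxtimes>\<^bsub>B\<^esub> ?r) \<cdot>\<^bsub>B\<^esub> ?r))"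
      by simp
    also have "\<dots> = ((FUnit F \<boxtimes>\<^bsub>B\<^esub> FUnit G) \<boxtimes>\<^bsub>B\<^esub> FUnit H) \<cdot>\<^bsub>B\<^esub> (Ass B ?I ?I ?I \<cdot>\<^bsub>B\<^esub> ((\<one>\<^bsub>B\<^esub> ?I \<boxtimes>\<^bsub>B\<^esub> ?r) \<cdot>\<^bsub>B\<^esub> ?r))"
      by (subst B.ass_nat_cmp) simp_all
    also have "\<dots> = ?rhs"
      unfolding B.ass_unit_run_inv by simp
    finally show ?thesis .
  qed
  have ten: "Ass B (FObj F (x \<otimes>\<^bsub>A\<^esub> y)) (FObj G (x \<otimes>\<^bsub>A\<^esub> y)) (FObj H (x \<otimes>\<^bsub>A\<^esub> y)) \<cdot>\<^bsub>B\<^esub>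
      FTen (box_fun A B F (box_fun A B G H)) (x, y) =
    FTen (box_fun A B (box_fun A B F G) H) (x, y) \<cdot>\<^bsub>B\<^esub>
      (Ass B (FObj F x) (FObj G x) (FObj H x) \<boxtimes>\<^bsub>B\<^esub> Ass B (FObj F y) (FObj G y) (FObj H y))"
    (is "?lhs = ?rhs") if o: "x \<in> Obj A" "y \<in> Obj A" for x y
  proof -
    let ?F = "FTen F (x, y)" and ?G = "FTen G (x, y)" and ?H = "FTen H (x, y)"
    let ?k = "(\<one>\<^bsub>B\<^esub> (FObj F x \<otimes>\<^bsub>B\<^esub> FObj F y) \<boxtimes>\<^bsub>B\<^esub> ?m (FObj G x) (FObj H x) (FObj G y) (FObj H y)) \<cdot>\<^bsub>B\<^esub>
      ?m (FObj F x) (FObj G x \<otimes>\<^bsub>B\<^esub> FObj H x) (FObj F y) (FObj G y \<otimes>\<^bsub>B\<^esub> FObj H y)"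
    have "?lhs = Ass B (FObj F (x \<otimes>\<^bsub>A\<^esub> y)) (FObj G (x \<otimes>\<^bsub>A\<^esub> y)) (FObj H (x \<otimes>\<^bsub>A\<^esub> y)) \<cdot>\<^bsub>B\<^esub>
      ((?F \<boxtimes>\<^bsub>B\<^esub> (?G \<boxtimes>\<^bsub>B\<^esub> ?H)) \<cdot>\<^bsub>B\<^esub> ?k)"
      using o by simp
    also have "\<dots> = ((?F \<boxtimes>\<^bsub>B\<^esub> ?G) \<boxtimes>\<^bsub>B\<^esub> ?H) \<cdot>\<^bsub>B\<^esub>
      (Ass B (FObj F x \<otimes>\<^bsub>B\<^esub> FObj F y) (FObj G x \<otimes>\<^bsub>B\<^esub> FObj G y) (FObj H x \<otimes>\<^bsub>B\<^esub> FObj H y) \<cdot>\<^bsub>B\<^esub> ?k)"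
      using o by (subst B.ass_nat_cmp) simp_all
    also have "\<dots> = ?rhs"
      using o by (subst B.interchange_ass') simp_all
    finally show ?thesis .
  qed
  show ?thesis
    by (intro sm_transformationI Lf.sm_functor_axioms Rf.sm_functor_axioms)
      (use unit ten in \<open>simp_all add: B.ass_nat del: box_fun_simps(3,4)\<close>)
qed

lemma hom_run:
  assumes "sm_functor A B F"
  shows "sm_transformation A B
    \<lparr>TSrc = box_fun A B F (const_fun A B), TTgt = F, TCmp = (\<lambda>x\<in>Obj A. Run B (FObj F x))\<rparr>"
proof -
  interpret F: sm_functor A B F by fact
  interpret K: sm_functor A B "const_fun A B" by (rule const_fun_functor)
  interpret FK: functor_pair A B F "const_fun A B" ..
  interpret L: sm_functor A B "box_fun A B F (const_fun A B)" by (rule FK.box_fun_functor)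
  let ?I = "\<I>\<^bsub>B\<^esub>"
  have unit: "Run B (FObj F \<I>\<^bsub>A\<^esub>) \<cdot>\<^bsub>B\<^esub> ((FUnit F \<boxtimes>\<^bsub>B\<^esub> \<one>\<^bsub>B\<^esub> ?I) \<cdot>\<^bsub>B\<^esub> Inv B (Run B ?I)) = FUnit F"
  proof -
    have "(Run B (FObj F \<I>\<^bsub>A\<^esub>) \<cdot>\<^bsub>B\<^esub> (FUnit F \<boxtimes>\<^bsub>B\<^esub> \<one>\<^bsub>B\<^esub> ?I)) \<cdot>\<^bsub>B\<^esub> Inv B (Run B ?I) = FUnit F"
      by (subst B.run_nat) (simp_all)
    then show ?thesis by simp
  qed
  have ten: "Run B (FObj F (x \<otimes>\<^bsub>A\<^esub> y)) \<cdot>\<^bsub>B\<^esub> ((FTen F (x, y) \<boxtimes>\<^bsub>B\<^esub> Run B ?I) \<cdot>\<^bsub>B\<^esub>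
      interchange B (FObj F x) ?I (FObj F y) ?I) =
    FTen F (x, y) \<cdot>\<^bsub>B\<^esub> (Run B (FObj F x) \<boxtimes>\<^bsub>B\<^esub> Run B (FObj F y))" (is "?lhs = ?rhs")
    if o: "x \<in> Obj A" "y \<in> Obj A" for x y
  proof -
    let ?n = "interchange B (FObj F x) ?I (FObj F y) ?I" and ?xy = "FObj F x \<otimes>\<^bsub>B\<^esub> FObj F y"
    have "?lhs = (Run B (FObj F (x \<otimes>\<^bsub>A\<^esub> y)) \<cdot>\<^bsub>B\<^esub> (FTen F (x, y) \<boxtimes>\<^bsub>B\<^esub> \<one>\<^bsub>B\<^esub> ?I)) \<cdot>\<^bsub>B\<^esub> ((\<one>\<^bsub>B\<^esub> ?xy \<boxtimes>\<^bsub>B\<^esub> Run B ?I) \<cdot>\<^bsub>B\<^esub> ?n)"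
      using o by simp
    also have "\<dots> = FTen F (x, y) \<cdot>\<^bsub>B\<^esub> (Run B ?xy \<cdot>\<^bsub>B\<^esub> ((\<one>\<^bsub>B\<^esub> ?xy \<boxtimes>\<^bsub>B\<^esub> Run B ?I) \<cdot>\<^bsub>B\<^esub> ?n))"
      using o by (subst B.run_nat) simp_all
    also have "\<dots> = ?rhs"
      using o by (simp add: B.interchange_run')
    finally show ?thesis .
  qed
  show ?thesis
    by (intro sm_transformationI F.sm_functor_axioms L.sm_functor_axioms)
      (use unit ten in \<open>simp_all add: B.run_nat\<close>)
qed

lemma hom_lun:
  assumes "sm_functor A B F"
  shows "sm_transformation A B
    \<lparr>TSrc = box_fun A B (const_fun A B) F, TTgt = F, TCmp = (\<lambda>x\<in>Obj A. Lun B (FObj F x))\<rparr>"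
proof -
  interpret F: sm_functor A B F by fact
  interpret K: sm_functor A B "const_fun A B" by (rule const_fun_functor)
  interpret FK: functor_pair A B "const_fun A B" F ..
  interpret L: sm_functor A B "box_fun A B (const_fun A B) F" by (rule FK.box_fun_functor)
  let ?I = "\<I>\<^bsub>B\<^esub>"
  have unit: "Lun B (FObj F \<I>\<^bsub>A\<^esub>) \<cdot>\<^bsub>B\<^esub> ((\<one>\<^bsub>B\<^esub> ?I \<boxtimes>\<^bsub>B\<^esub> FUnit F) \<cdot>\<^bsub>B\<^esub> Inv B (Run B ?I)) = FUnit F"
  proof -
    have "(Lun B (FObj F \<I>\<^bsub>A\<^esub>) \<cdot>\<^bsub>B\<^esub> (\<one>\<^bsub>B\<^esub> ?I \<boxtimes>\<^bsub>B\<^esub> FUnit F)) \<cdot>\<^bsub>B\<^esub> Inv B (Run B ?I) = FUnit F"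
      by (subst B.lun_nat) (simp_all add: B.run_unit_eq_lun)
    then show ?thesis by simp
  qed
  have ten: "Lun B (FObj F (x \<otimes>\<^bsub>A\<^esub> y)) \<cdot>\<^bsub>B\<^esub> ((Run B ?I \<boxtimes>\<^bsub>B\<^esub> FTen F (x, y)) \<cdot>\<^bsub>B\<^esub>
      interchange B ?I (FObj F x) ?I (FObj F y)) =
    FTen F (x, y) \<cdot>\<^bsub>B\<^esub> (Lun B (FObj F x) \<boxtimes>\<^bsub>B\<^esub> Lun B (FObj F y))" (is "?lhs = ?rhs")
    if o: "x \<in> Obj A" "y \<in> Obj A" for x y
  proof -
    let ?n = "interchange B ?I (FObj F x) ?I (FObj F y)" and ?xy = "FObj F x \<otimes>\<^bsub>B\<^esub> FObj F y"
    have "?lhs = (Lun B (FObj F (x \<otimes>\<^bsub>A\<^esub> y)) \<cdot>\<^bsub>B\<^esub> (\<one>\<^bsub>B\<^esub> ?I \<boxtimes>\<^bsub>B\<^esub> FTen F (x, y))) \<cdot>\<^bsub>B\<^esub> ((Run B ?I \<boxtimes>\<^bsub>B\<^esub> \<one>\<^bsub>B\<^esub> ?xy) \<cdot>\<^bsub>B\<^esub> ?n)"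
      using o by simp
    also have "\<dots> = FTen F (x, y) \<cdot>\<^bsub>B\<^esub> (Lun B ?xy \<cdot>\<^bsub>B\<^esub> ((Run B ?I \<boxtimes>\<^bsub>B\<^esub> \<one>\<^bsub>B\<^esub> ?xy) \<cdot>\<^bsub>B\<^esub> ?n))"
      using o by (subst B.lun_nat) simp_all
    also have "\<dots> = ?rhs"
      using o by (simp add: B.interchange_lun')
    finally show ?thesis .
  qed
  show ?thesis
    by (intro sm_transformationI F.sm_functor_axioms L.sm_functor_axioms)
      (use unit ten in \<open>simp_all add: B.lun_nat\<close>)
qed

lemma hom_sym:
  assumes "sm_functor A B F" "sm_functor A B G"
  shows "sm_transformation A B \<lparr>TSrc = box_fun A B F G, TTgt = box_fun A B G F,
    TCmp = (\<lambda>x\<in>Obj A. Sym B (FObj F x) (FObj G x))\<rparr>"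
proof -
  interpret F: sm_functor A B F by fact
  interpret G: sm_functor A B G by fact
  interpret FG: functor_pair A B F G ..
  interpret GF: functor_pair A B G F ..
  interpret L: sm_functor A B "box_fun A B F G" by (rule FG.box_fun_functor)
  interpret R: sm_functor A B "box_fun A B G F" by (rule GF.box_fun_functor)
  have unit: "Sym B (FObj F \<I>\<^bsub>A\<^esub>) (FObj G \<I>\<^bsub>A\<^esub>) \<cdot>\<^bsub>B\<^esub> ((FUnit F \<boxtimes>\<^bsub>B\<^esub> FUnit G) \<cdot>\<^bsub>B\<^esub> Inv B (Run B \<I>\<^bsub>B\<^esub>)) =
    (FUnit G \<boxtimes>\<^bsub>B\<^esub> FUnit F) \<cdot>\<^bsub>B\<^esub> Inv B (Run B \<I>\<^bsub>B\<^esub>)"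
    by (simp add: B.sym_nat B.sym_unit_unit flip: B.assoc_simp)
  have ten: "Sym B (FObj F (x \<otimes>\<^bsub>A\<^esub> y)) (FObj G (x \<otimes>\<^bsub>A\<^esub> y)) \<cdot>\<^bsub>B\<^esub> ((FTen F (x, y) \<boxtimes>\<^bsub>B\<^esub> FTen G (x, y)) \<cdot>\<^bsub>B\<^esub>
      interchange B (FObj F x) (FObj G x) (FObj F y) (FObj G y)) =
    (FTen G (x, y) \<boxtimes>\<^bsub>B\<^esub> FTen F (x, y)) \<cdot>\<^bsub>B\<^esub> (interchange B (FObj G x) (FObj F x) (FObj G y) (FObj F y) \<cdot>\<^bsub>B\<^esub>
      (Sym B (FObj F x) (FObj G x) \<boxtimes>\<^bsub>B\<^esub> Sym B (FObj F y) (FObj G y)))" (is "?lhs = ?rhs")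
    if o: "x \<in> Obj A" "y \<in> Obj A" for x y
  proof -
    have "?lhs = (Sym B (FObj F (x \<otimes>\<^bsub>A\<^esub> y)) (FObj G (x \<otimes>\<^bsub>A\<^esub> y)) \<cdot>\<^bsub>B\<^esub> (FTen F (x, y) \<boxtimes>\<^bsub>B\<^esub> FTen G (x, y))) \<cdot>\<^bsub>B\<^esub>
      interchange B (FObj F x) (FObj G x) (FObj F y) (FObj G y)"
      using o by simp
    also have "\<dots> = ?rhs"
      using o by (subst B.sym_nat) (simp_all add: B.interchange_sym')
    finally show ?thesis .
  qed
  show ?thesis
    by (intro sm_transformationI F.sm_functor_axioms L.sm_functor_axioms R.sm_functor_axioms)
      (use unit ten in \<open>simp_all add: B.sym_nat\<close>)
qed

lemma transformation_typed:
  assumes "sm_transformation A B \<sigma>"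
  shows "sm_functor A B (TSrc \<sigma>)" "sm_functor A B (TTgt \<sigma>)" "TCmp \<sigma> \<in> extensional (Obj A)"
    "x \<in> Obj A \<Longrightarrow> TCmp \<sigma> x \<in> Arr B" "x \<in> Obj A \<Longrightarrow> Dom B (TCmp \<sigma> x) = FObj (TSrc \<sigma>) x"
    "x \<in> Obj A \<Longrightarrow> Cod B (TCmp \<sigma> x) = FObj (TTgt \<sigma>) x"
proof -
  interpret S: sm_transformation A B \<sigma> by fact
  show "sm_functor A B (TSrc \<sigma>)" "sm_functor A B (TTgt \<sigma>)" "TCmp \<sigma> \<in> extensional (Obj A)"
    by (rule S.F.sm_functor_axioms S.G.sm_functor_axioms S.tcmp_ext)+
  show "TCmp \<sigma> x \<in> Arr B" "Dom B (TCmp \<sigma> x) = FObj (TSrc \<sigma>) x" "Cod B (TCmp \<sigma> x) = FObj (TTgt \<sigma>) x"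
    if "x \<in> Obj A"
    using that by simp_all
qed

lemma functor_obj: "sm_functor A B F \<Longrightarrow> x \<in> Obj A \<Longrightarrow> FObj F x \<in> Obj B"
  by (rule sm_functor.fobj_simp)

lemma box_functor: "sm_functor A B F \<Longrightarrow> sm_functor A B G \<Longrightarrow> sm_functor A B (box_fun A B F G)"
  by (rule functor_pair.box_fun_functor) (simp add: functor_pair_def smc_pair_axioms)

text \<open>
  Composition and tensor of transformations are pointwise, so the axioms hold because they hold in
  \<open>B\<close>.
\<close>

theorem hom_smc_symmetric_monoidal: "symmetric_monoidal_category (hom_smc A B)"
proof -
  note [simp] = transformation_typed functor_obj box_functor const_fun_functor
  note [intro!] = restrict_ext
  have cat: "category (hom_smc A B)"
  proof (rule category.intro)
    fix f g h a b c d
    show "f \<in> Hom (hom_smc A B) a b \<Longrightarrow> g \<in> Hom (hom_smc A B) b c \<Longrightarrow> g \<cdot>\<^bsub>hom_smc A B\<^esub> f \<in> Hom (hom_smc A B) a c"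
      by (auto simp: Hom_iff hom_cmp)
    show "f \<in> Hom (hom_smc A B) a b \<Longrightarrow> \<one>\<^bsub>hom_smc A B\<^esub> b \<cdot>\<^bsub>hom_smc A B\<^esub> f = f"
      by (auto simp: Hom_iff intro!: smtrans_eqI[where X = "Obj A"])
    show "f \<in> Hom (hom_smc A B) a b \<Longrightarrow> f \<cdot>\<^bsub>hom_smc A B\<^esub> \<one>\<^bsub>hom_smc A B\<^esub> a = f"
      by (auto simp: Hom_iff intro!: smtrans_eqI[where X = "Obj A"])
    show "f \<in> Hom (hom_smc A B) a b \<Longrightarrow> g \<in> Hom (hom_smc A B) b c \<Longrightarrow> h \<in> Hom (hom_smc A B) c d \<Longrightarrow>
      h \<cdot>\<^bsub>hom_smc A B\<^esub> g \<cdot>\<^bsub>hom_smc A B\<^esub> f = h \<cdot>\<^bsub>hom_smc A B\<^esub> (g \<cdot>\<^bsub>hom_smc A B\<^esub> f)"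
      by (auto simp: Hom_iff)
  qed (auto simp: Hom_iff hom_idt)
  show ?thesis
  proof (rule symmetric_monoidal_category.intro[OF cat], rule symmetric_monoidal_category_axioms.intro)
    fix a b c
    show "a \<in> Obj (hom_smc A B) \<Longrightarrow> b \<in> Obj (hom_smc A B) \<Longrightarrow> c \<in> Obj (hom_smc A B) \<Longrightarrow> iso (hom_smc A B) (Ass (hom_smc A B) a b c)"
      by (auto intro!: hom_iso hom_ass)
    show "a \<in> Obj (hom_smc A B) \<Longrightarrow> iso (hom_smc A B) (Run (hom_smc A B) a)"
      by (auto intro!: hom_iso hom_run)
    show "a \<in> Obj (hom_smc A B) \<Longrightarrow> iso (hom_smc A B) (Lun (hom_smc A B) a)"
      by (auto intro!: hom_iso hom_lun)
  qed (auto simp: Hom_iff hom_cmp hom_idt hom_tarr hom_ass hom_run hom_lun hom_sym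
      B.ass_nat B.run_nat B.lun_nat B.sym_nat B.pentagon B.triangle B.sym_sym B.sym_unit B.hexagon simp del: B.assoc_simp)
qed

end

section \<open>The free symmetric monoidal category\<close>

lemma teq_refl_iff: "t \<approx> t \<longleftrightarrow> wf_term t"
  using teq.refl teq_typed by blast

lemma abs_farr_eq: "t \<approx> u \<Longrightarrow> abs_farr t = abs_farr u"
  using Quotient3_rel[OF Quotient3_farr] by metis

lemma farr_cases:
  obtains t where "wf_term t" "f = abs_farr t"
  using Quotient3_abs_rep[OF Quotient3_farr] Quotient3_rep_reflp[OF Quotient3_farr]
  by (metis teq_refl_iff)

text \<open>
  The relations between terms are stated for tensors with a single object, so the equations are
  first collected for these whiskerings; the tensor of two arrows is a composite of two
  whiskerings.
\<close>

lift_definition fass_inv :: "word \<Rightarrow> word \<Rightarrow> word \<Rightarrow> farr" is TAssInv by (simp add: teq.refl)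
lift_definition frun_inv :: "word \<Rightarrow> farr" is TRunInv by (simp add: teq.refl)
lift_definition flun_inv :: "word \<Rightarrow> farr" is TLunInv by (simp add: teq.refl)
lift_definition whiskL :: "word \<Rightarrow> farr \<Rightarrow> farr" is TenL by (rule teq.cong_tenL)
lift_definition whiskR :: "farr \<Rightarrow> word \<Rightarrow> farr" is TenR by (rule teq.cong_tenR)

lemma abs_farr_simps:
  "fid a = abs_farr (TId a)" "fass a b c = abs_farr (TAss a b c)" "fass_inv a b c = abs_farr (TAssInv a b c)"
  "frun a = abs_farr (TRun a)" "frun_inv a = abs_farr (TRunInv a)"
  "flun a = abs_farr (TLun a)" "flun_inv a = abs_farr (TLunInv a)" "fsym a b = abs_farr (TSym a b)"
  by (simp_all add: fid_def fass_def fass_inv_def frun_def frun_inv_def flun_def flun_inv_def fsym_def)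

lemma abs_farr_ops:
  assumes "wf_term t"
  shows "fdom (abs_farr t) = tsrc t" "fcod (abs_farr t) = ttgt t"
    "whiskL a (abs_farr t) = abs_farr (TenL a t)" "whiskR (abs_farr t) a = abs_farr (TenR t a)"
    "wf_term u \<Longrightarrow> tsrc t = ttgt u \<Longrightarrow> fcomp (abs_farr t) (abs_farr u) = abs_farr (TComp t u)"
  using assms
  by (simp_all add: fdom.abs_eq fcod.abs_eq whiskL.abs_eq whiskR.abs_eq fcomp.abs_eq teq_refl_iff)

lemma ften_eq: "ften f g = fcomp (whiskR f (fcod g)) (whiskL (fdom f) g)"
proof -
  obtain t u where t: "wf_term t" "f = abs_farr t" and u: "wf_term u" "g = abs_farr u"
    by (metis farr_cases)
  then show ?thesis
    by (simp add: abs_farr_ops ften.abs_eq teq_refl_iff)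
qed

lemma farr_typing [simp]:
  "fdom (fid a) = a" "fcod (fid a) = a"
  "fdom (fass a b c) = WTen a (WTen b c)" "fcod (fass a b c) = WTen (WTen a b) c"
  "fdom (fass_inv a b c) = WTen (WTen a b) c" "fcod (fass_inv a b c) = WTen a (WTen b c)"
  "fdom (frun a) = WTen a WUnit" "fcod (frun a) = a" "fdom (frun_inv a) = a" "fcod (frun_inv a) = WTen a WUnit"
  "fdom (flun a) = WTen WUnit a" "fcod (flun a) = a" "fdom (flun_inv a) = a" "fcod (flun_inv a) = WTen WUnit a"
  "fdom (fsym a b) = WTen a b" "fcod (fsym a b) = WTen b a"
  by (simp_all add: abs_farr_simps abs_farr_ops)

lemma farr_typing_ops [simp]:
  "fdom (whiskL a f) = WTen a (fdom f)" "fcod (whiskL a f) = WTen a (fcod f)"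
  "fdom (whiskR f a) = WTen (fdom f) a" "fcod (whiskR f a) = WTen (fcod f) a"
  "fdom f = fcod g \<Longrightarrow> fdom (fcomp f g) = fdom g" "fdom f = fcod g \<Longrightarrow> fcod (fcomp f g) = fcod f"
proof -
  obtain t u where t: "wf_term t" "f = abs_farr t" and u: "wf_term u" "g = abs_farr u"
    by (metis farr_cases)
  then show "fdom (whiskL a f) = WTen a (fdom f)" "fcod (whiskL a f) = WTen a (fcod f)"
    "fdom (whiskR f a) = WTen (fdom f) a" "fcod (whiskR f a) = WTen (fcod f) a"
    "fdom f = fcod g \<Longrightarrow> fdom (fcomp f g) = fdom g" "fdom f = fcod g \<Longrightarrow> fcod (fcomp f g) = fcod f"
    by (simp_all add: abs_farr_ops)
qed

lemma farr_cat:
  "fcomp (fid (fcod f)) f = f" "fcomp f (fid (fdom f)) = f"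
  "fdom h = fcod g \<Longrightarrow> fdom g = fcod f \<Longrightarrow> fcomp (fcomp h g) f = fcomp h (fcomp g f)"
proof -
  obtain t u v where t: "wf_term t" "f = abs_farr t" and u: "wf_term u" "g = abs_farr u"
    and v: "wf_term v" "h = abs_farr v"
    by (metis farr_cases)
  then show "fcomp (fid (fcod f)) f = f" "fcomp f (fid (fdom f)) = f"
    "fdom h = fcod g \<Longrightarrow> fdom g = fcod f \<Longrightarrow> fcomp (fcomp h g) f = fcomp h (fcomp g f)"
    by (simp_all add: abs_farr_ops abs_farr_simps abs_farr_eq teq.id_left teq.id_right teq.assoc)
qed

lemma farr_whisk:
  "whiskL a (fid b) = fid (WTen a b)" "whiskR (fid a) b = fid (WTen a b)"
  "fdom f = fcod g \<Longrightarrow> whiskL a (fcomp f g) = fcomp (whiskL a f) (whiskL a g)"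
  "fdom f = fcod g \<Longrightarrow> whiskR (fcomp f g) a = fcomp (whiskR f a) (whiskR g a)"
  "fcomp (whiskR f (fcod g)) (whiskL (fdom f) g) = fcomp (whiskL (fcod f) g) (whiskR f (fdom g))"
proof -
  obtain t u where t: "wf_term t" "f = abs_farr t" and u: "wf_term u" "g = abs_farr u"
    by (metis farr_cases)
  then show "whiskL a (fid b) = fid (WTen a b)" "whiskR (fid a) b = fid (WTen a b)"
    "fdom f = fcod g \<Longrightarrow> whiskL a (fcomp f g) = fcomp (whiskL a f) (whiskL a g)"
    "fdom f = fcod g \<Longrightarrow> whiskR (fcomp f g) a = fcomp (whiskR f a) (whiskR g a)"
    "fcomp (whiskR f (fcod g)) (whiskL (fdom f) g) = fcomp (whiskL (fcod f) g) (whiskR f (fdom g))"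
    by (simp_all add: abs_farr_ops abs_farr_simps abs_farr_eq teq.tenL_id teq.tenR_id teq.tenL_comp
        teq.tenR_comp teq.tenL_tenR)
qed

lemma farr_inverses:
  "fcomp (fass_inv a b c) (fass a b c) = fid (WTen a (WTen b c))"
  "fcomp (fass a b c) (fass_inv a b c) = fid (WTen (WTen a b) c)"
  "fcomp (frun_inv a) (frun a) = fid (WTen a WUnit)" "fcomp (frun a) (frun_inv a) = fid a"
  "fcomp (flun_inv a) (flun a) = fid (WTen WUnit a)" "fcomp (flun a) (flun_inv a) = fid a"
  by (simp_all add: abs_farr_ops abs_farr_simps abs_farr_eq teq.ass_inv1 teq.ass_inv2 teq.run_inv1
      teq.run_inv2 teq.lun_inv1 teq.lun_inv2)

lemma farr_natural:
  "fcomp (fass (fcod f) b c) (whiskR f (WTen b c)) = fcomp (whiskR (whiskR f b) c) (fass (fdom f) b c)"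
  "fcomp (fass a (fcod f) c) (whiskL a (whiskR f c)) = fcomp (whiskR (whiskL a f) c) (fass a (fdom f) c)"
  "fcomp (fass a b (fcod f)) (whiskL a (whiskL b f)) = fcomp (whiskL (WTen a b) f) (fass a b (fdom f))"
  "fcomp (frun (fcod f)) (whiskR f WUnit) = fcomp f (frun (fdom f))"
  "fcomp (flun (fcod f)) (whiskL WUnit f) = fcomp f (flun (fdom f))"
  "fcomp (fsym (fcod f) b) (whiskR f b) = fcomp (whiskL b f) (fsym (fdom f) b)"
  "fcomp (fsym a (fcod f)) (whiskL a f) = fcomp (whiskR f a) (fsym a (fdom f))"
proof -
  obtain t where "wf_term t" "f = abs_farr t"
    by (rule farr_cases)
  then show
    "fcomp (fass (fcod f) b c) (whiskR f (WTen b c)) = fcomp (whiskR (whiskR f b) c) (fass (fdom f) b c)"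
    "fcomp (fass a (fcod f) c) (whiskL a (whiskR f c)) = fcomp (whiskR (whiskL a f) c) (fass a (fdom f) c)"
    "fcomp (fass a b (fcod f)) (whiskL a (whiskL b f)) = fcomp (whiskL (WTen a b) f) (fass a b (fdom f))"
    "fcomp (frun (fcod f)) (whiskR f WUnit) = fcomp f (frun (fdom f))"
    "fcomp (flun (fcod f)) (whiskL WUnit f) = fcomp f (flun (fdom f))"
    "fcomp (fsym (fcod f) b) (whiskR f b) = fcomp (whiskL b f) (fsym (fdom f) b)"
    "fcomp (fsym a (fcod f)) (whiskL a f) = fcomp (whiskR f a) (fsym a (fdom f))"
    by (simp_all add: abs_farr_ops abs_farr_simps abs_farr_eq teq.ass_nat1 teq.ass_nat2 teq.ass_nat3
        teq.run_nat teq.lun_nat teq.sym_nat1 teq.sym_nat2)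
qed

lemma farr_coherence:
  "fcomp (fass (WTen a b) c d) (fass a b (WTen c d)) =
    fcomp (fcomp (whiskR (fass a b c) d) (fass a (WTen b c) d)) (whiskL a (fass b c d))"
  "fcomp (whiskR (frun a) b) (fass a WUnit b) = whiskL a (flun b)"
  "fcomp (fsym b a) (fsym a b) = fid (WTen a b)"
  "fcomp (flun a) (fsym a WUnit) = frun a"
  "fcomp (fcomp (fass c a b) (fsym (WTen a b) c)) (fass a b c) =
    fcomp (fcomp (whiskR (fsym a c) b) (fass a c b)) (whiskL a (fsym b c))"
  by (simp_all add: abs_farr_ops abs_farr_simps abs_farr_eq teq.pentagon teq.triangle teq.sym_sym
      teq.sym_unit teq.hexagon)

lemma free_smc_simps [simp]:
  "Obj free_smc = UNIV" "Arr free_smc = UNIV" "Dom free_smc = fdom" "Cod free_smc = fcod"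
  "\<one>\<^bsub>free_smc\<^esub> w = fid w" "g \<cdot>\<^bsub>free_smc\<^esub> f = fcomp g f" "\<I>\<^bsub>free_smc\<^esub> = WUnit"
  "w \<otimes>\<^bsub>free_smc\<^esub> w' = WTen w w'" "f \<boxtimes>\<^bsub>free_smc\<^esub> g = ften f g"
  "Ass free_smc = fass" "Run free_smc = frun" "Lun free_smc = flun" "Sym free_smc = fsym"
  by (simp_all add: free_smc_def)

lemma ften_id:
  "ften (fid a) f = whiskL a f" "ften f (fid a) = whiskR f a"
  using farr_cat(1)[of "whiskL a f"] farr_cat(2)[of "whiskR f a"] by (simp_all add: ften_eq farr_whisk)

lemma ften_typing [simp]:
  "fdom (ften f g) = WTen (fdom f) (fdom g)" "fcod (ften f g) = WTen (fcod f) (fcod g)"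
  by (simp_all add: ften_eq)

lemma ften_comp:
  assumes "fdom f' = fcod f" "fdom g' = fcod g"
  shows "ften (fcomp f' f) (fcomp g' g) = fcomp (ften f' g') (ften f g)"
proof -
  have "ften (fcomp f' f) (fcomp g' g) = fcomp (whiskR f' (fcod g'))
    (fcomp (fcomp (whiskR f (fcod g')) (whiskL (fdom f) g')) (whiskL (fdom f) g))"
    using assms by (simp add: ften_eq farr_whisk(3,4) farr_cat)
  also have "\<dots> = fcomp (ften f' g') (ften f g)"
    using assms by (subst farr_whisk(5)) (simp add: ften_eq farr_cat)
  finally show ?thesis .
qed

lemma fass_natural:
  "fcomp (fass (fcod f) (fcod g) (fcod h)) (ften f (ften g h)) =
    fcomp (ften (ften f g) h) (fass (fdom f) (fdom g) (fdom h))"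
proof -
  have "fcomp (fass (fcod f) (fcod g) (fcod h)) (ften f (ften g h)) =
    fcomp (fcomp (fass (fcod f) (fcod g) (fcod h)) (whiskR f (WTen (fcod g) (fcod h))))
      (fcomp (whiskL (fdom f) (whiskR g (fcod h))) (whiskL (fdom f) (whiskL (fdom g) h)))"
    by (simp add: ften_eq farr_whisk(3) farr_cat)
  also have "\<dots> = fcomp (whiskR (whiskR f (fcod g)) (fcod h))
    (fcomp (fcomp (fass (fdom f) (fcod g) (fcod h)) (whiskL (fdom f) (whiskR g (fcod h))))
      (whiskL (fdom f) (whiskL (fdom g) h)))"
    by (simp add: farr_natural(1) farr_cat)
  also have "\<dots> = fcomp (whiskR (whiskR f (fcod g)) (fcod h))
    (fcomp (whiskR (whiskL (fdom f) g) (fcod h))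
      (fcomp (fass (fdom f) (fdom g) (fcod h)) (whiskL (fdom f) (whiskL (fdom g) h))))"
    by (simp add: farr_natural(2) farr_cat)
  also have "\<dots> = fcomp (ften (ften f g) h) (fass (fdom f) (fdom g) (fdom h))"
    by (simp add: farr_natural(3) farr_cat ften_eq farr_whisk(4))
  finally show ?thesis .
qed

lemma fsym_natural:
  "fcomp (fsym (fcod f) (fcod g)) (ften f g) = fcomp (ften g f) (fsym (fdom f) (fdom g))"
proof -
  have "fcomp (fsym (fcod f) (fcod g)) (ften f g) =
    fcomp (fcomp (fsym (fcod f) (fcod g)) (whiskR f (fcod g))) (whiskL (fdom f) g)"
    by (simp add: ften_eq farr_cat)
  also have "\<dots> = fcomp (whiskL (fcod g) f) (fcomp (fsym (fdom f) (fcod g)) (whiskL (fdom f) g))"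
    by (simp add: farr_natural(6) farr_cat)
  also have "\<dots> = fcomp (fcomp (whiskL (fcod g) f) (whiskR g (fdom f))) (fsym (fdom f) (fdom g))"
    by (simp add: farr_natural(7) farr_cat)
  also have "\<dots> = fcomp (ften g f) (fsym (fdom f) (fdom g))"
    by (simp add: ften_eq farr_whisk(5))
  finally show ?thesis .
qed

lemma free_smc_isos:
  "inverse_arrows free_smc (fass a b c) (fass_inv a b c)"
  "inverse_arrows free_smc (frun a) (frun_inv a)"
  "inverse_arrows free_smc (flun a) (flun_inv a)"
  by (simp_all add: inverse_arrows_def Hom_iff farr_inverses)

theorem free_smc_symmetric_monoidal: "symmetric_monoidal_category free_smc"
proof (intro symmetric_monoidal_category.intro category.intro symmetric_monoidal_category_axioms.intro)
  fix a b c
  show "iso free_smc (Ass free_smc a b c)" "iso free_smc (Run free_smc a)" "iso free_smc (Lun free_smc a)"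
    unfolding iso_def free_smc_simps using free_smc_isos by blast+
qed (auto simp: Hom_iff farr_cat ften_id farr_whisk(1-4) ften_comp fass_natural fsym_natural farr_natural
    farr_coherence)

interpretation Free: symmetric_monoidal_category free_smc
  by (rule free_smc_symmetric_monoidal)

lemma free_smc_Inv:
  "Inv free_smc (fass a b c) = fass_inv a b c" "Inv free_smc (frun a) = frun_inv a"
  "Inv free_smc (flun a) = flun_inv a"
  using free_smc_isos by (simp_all add: Free.Inv_eq)

text \<open>
  Every arrow is represented by a well-formed term, and whiskering is the tensor with an identity.
\<close>

lemma free_smc_arrow_induct [case_names idt ass ass_inv run run_inv lun lun_inv sym cmp tenL tenR]:
  assumes "\<And>w. P (fid w)" "\<And>a b c. P (fass a b c)" "\<And>a b c. P (Inv free_smc (fass a b c))"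
    "\<And>a. P (frun a)" "\<And>a. P (Inv free_smc (frun a))"
    "\<And>a. P (flun a)" "\<And>a. P (Inv free_smc (flun a))" "\<And>a b. P (fsym a b)"
    and cmp: "\<And>g f. P g \<Longrightarrow> P f \<Longrightarrow> fdom g = fcod f \<Longrightarrow> P (fcomp g f)"
    and tenL: "\<And>w f. P f \<Longrightarrow> P (ften (fid w) f)" and tenR: "\<And>w f. P f \<Longrightarrow> P (ften f (fid w))"
  shows "P f"
proof -
  obtain t where t: "wf_term t" "f = abs_farr t"
    by (rule farr_cases)
  have "wf_term t \<Longrightarrow> P (abs_farr t)"
  proof (induction t)
    case (TComp t u)
    then show ?case
      using cmp[of "abs_farr t" "abs_farr u"] by (simp add: abs_farr_ops)
  next
    case (TenL w t)
    then show ?case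
      using tenL[of "abs_farr t" w] by (simp add: abs_farr_ops ften_id)
  next
    case (TenR t w)
    then show ?case
      using tenR[of "abs_farr t" w] by (simp add: abs_farr_ops ften_id)
  qed (simp_all add: assms(1-8)[unfolded free_smc_Inv, unfolded abs_farr_simps])
  then show ?thesis
    using t by simp
qed

section \<open>Functors out of the free symmetric monoidal category\<close>

context sm_functor
begin

lemma farr_iso [simp]:
  assumes "iso A f"
  shows "iso B (FArr F f)" "FArr F (Inv A f) = Inv B (FArr F f)"
proof -
  have "FArr F (Inv A f) \<cdot>\<^bsub>B\<^esub> FArr F f = \<one>\<^bsub>B\<^esub> (FObj F (Dom A f))"
    "FArr F f \<cdot>\<^bsub>B\<^esub> FArr F (Inv A f) = \<one>\<^bsub>B\<^esub> (FObj F (Cod A f))"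
    using assms by (simp_all flip: farr_cmp_simp)
  then show "iso B (FArr F f)" "FArr F (Inv A f) = Inv B (FArr F f)"
    using B.isoI[of "FArr F f" "FArr F (Inv A f)"] assms by simp_all
qed

end

context strict_sm_functor
begin

lemma strict_obj: "FObj F \<I>\<^bsub>A\<^esub> = \<I>\<^bsub>B\<^esub>"
  "x \<in> Obj A \<Longrightarrow> y \<in> Obj A \<Longrightarrow> FObj F (x \<otimes>\<^bsub>A\<^esub> y) = FObj F x \<otimes>\<^bsub>B\<^esub> FObj F y"
  using funit_simps(3) ften_simps(3)[of x y] by (simp_all add: funit_idt ften_idt)

lemma strict_tarr:
  "f \<in> Arr A \<Longrightarrow> g \<in> Arr A \<Longrightarrow> FArr F (f \<boxtimes>\<^bsub>A\<^esub> g) = FArr F f \<boxtimes>\<^bsub>B\<^esub> FArr F g"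
  using ften_nat[of f g "Cod A f" "Cod A g"] by (simp add: ften_idt strict_obj)

lemma strict_structure:
  "x \<in> Obj A \<Longrightarrow> y \<in> Obj A \<Longrightarrow> z \<in> Obj A \<Longrightarrow> FArr F (Ass A x y z) = Ass B (FObj F x) (FObj F y) (FObj F z)"
  "x \<in> Obj A \<Longrightarrow> FArr F (Run A x) = Run B (FObj F x)"
  "x \<in> Obj A \<Longrightarrow> FArr F (Lun A x) = Lun B (FObj F x)"
  "x \<in> Obj A \<Longrightarrow> y \<in> Obj A \<Longrightarrow> FArr F (Sym A x y) = Sym B (FObj F x) (FObj F y)"
  using ften_ass'[of x y z] ften_run'[of x] ften_lun'[of x] ften_sym[of x y]
  by (simp_all add: ften_idt funit_idt strict_obj)

end

text \<open>
  Words and terms are read in \<open>X\<close> with \<open>\<star>\<close> standing for \<open>x\<close>. Since this respects the relations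
  between terms (\<open>term_arr_teq\<close>), the representative that is picked in \<open>term_functor\<close> does not
  matter.
\<close>

primrec word_obj :: "('o, 'a) smc \<Rightarrow> 'o \<Rightarrow> word \<Rightarrow> 'o" where
  "word_obj X x WUnit = \<I>\<^bsub>X\<^esub>"
| "word_obj X x Star = x"
| "word_obj X x (WTen w w') = word_obj X x w \<otimes>\<^bsub>X\<^esub> word_obj X x w'"

primrec term_arr :: "('o, 'a) smc \<Rightarrow> 'o \<Rightarrow> aterm \<Rightarrow> 'a" where
  "term_arr X x (TId a) = \<one>\<^bsub>X\<^esub> (word_obj X x a)"
| "term_arr X x (TAss a b c) = Ass X (word_obj X x a) (word_obj X x b) (word_obj X x c)"
| "term_arr X x (TAssInv a b c) = Inv X (Ass X (word_obj X x a) (word_obj X x b) (word_obj X x c))"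
| "term_arr X x (TRun a) = Run X (word_obj X x a)"
| "term_arr X x (TRunInv a) = Inv X (Run X (word_obj X x a))"
| "term_arr X x (TLun a) = Lun X (word_obj X x a)"
| "term_arr X x (TLunInv a) = Inv X (Lun X (word_obj X x a))"
| "term_arr X x (TSym a b) = Sym X (word_obj X x a) (word_obj X x b)"
| "term_arr X x (TComp t u) = term_arr X x t \<cdot>\<^bsub>X\<^esub> term_arr X x u"
| "term_arr X x (TenL a t) = \<one>\<^bsub>X\<^esub> (word_obj X x a) \<boxtimes>\<^bsub>X\<^esub> term_arr X x t"
| "term_arr X x (TenR t a) = term_arr X x t \<boxtimes>\<^bsub>X\<^esub> \<one>\<^bsub>X\<^esub> (word_obj X x a)"

definition term_functor :: "('o, 'a) smc \<Rightarrow> 'o \<Rightarrow> (word, farr, 'o, 'a) smfun" where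
  "term_functor X x = \<lparr>FObj = word_obj X x, FArr = (\<lambda>f. term_arr X x (rep_farr f)), FUnit = \<one>\<^bsub>X\<^esub> \<I>\<^bsub>X\<^esub>,
     FTen = (\<lambda>(w, w'). \<one>\<^bsub>X\<^esub> (word_obj X x w \<otimes>\<^bsub>X\<^esub> word_obj X x w'))\<rparr>"

context symmetric_monoidal_category
begin

lemma word_obj_obj [simp]: "x \<in> Obj C \<Longrightarrow> word_obj C x w \<in> Obj C"
  by (induction w) auto

lemma term_arr_typed [simp]:
  assumes "x \<in> Obj C" "wf_term t"
  shows "term_arr C x t \<in> Arr C" "Dom C (term_arr C x t) = word_obj C x (tsrc t)"
    "Cod C (term_arr C x t) = word_obj C x (ttgt t)"
proof -
  have "term_arr C x t \<in> Arr C \<and> Dom C (term_arr C x t) = word_obj C x (tsrc t) \<and>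
    Cod C (term_arr C x t) = word_obj C x (ttgt t)"
    using assms(2) by (induction t) (use assms(1) in auto)
  then show "term_arr C x t \<in> Arr C" "Dom C (term_arr C x t) = word_obj C x (tsrc t)"
    "Cod C (term_arr C x t) = word_obj C x (ttgt t)"
    by auto
qed

lemma term_arr_teq:
  assumes "t \<approx> u" "x \<in> Obj C"
  shows "term_arr C x t = term_arr C x u"
  using assms(1)
proof (induction rule: teq.induct)
  case (pentagon a b c d)
  then show ?case
    using assms(2) symmetric_monoidal_category_axioms symmetric_monoidal_category.pentagon[of C] by simp
next
  case (ass_nat1 t b c)
  then show ?case
    using assms(2) ass_nat[of "term_arr C x t" "\<one> (word_obj C x b)" "\<one> (word_obj C x c)", OF _ _ _ HOL.refl HOL.refl HOL.refl] by simp
next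
  case (hexagon c a b)
  then show ?case
    using assms(2) symmetric_monoidal_category_axioms symmetric_monoidal_category.hexagon[of C] by simp
qed (use assms(2) in \<open>simp_all add: ass_nat run_nat lun_nat sym_nat triangle sym_sym sym_unit\<close>)

lemma term_functor_abs:
  assumes "x \<in> Obj C" "wf_term t"
  shows "FArr (term_functor C x) (abs_farr t) = term_arr C x t"
proof -
  have "rep_farr (abs_farr t) \<approx> t"
    using rep_abs_rsp_left[OF Quotient3_farr] assms(2) teq.refl by blast
  then show ?thesis
    using term_arr_teq assms(1) by (simp add: term_functor_def)
qed

lemma term_functor_strict:
  assumes "x \<in> Obj C"
  shows "strict_sm_functor free_smc C (term_functor C x)"
proof -
  let ?F = "term_functor C x"
  have obj [simp]: "FObj ?F = word_obj C x" "FUnit ?F = \<one> \<I>"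
    "FTen ?F (w, w') = \<one> (word_obj C x w \<otimes> word_obj C x w')" for w w'
    by (simp_all add: term_functor_def)
  have typed: "FArr ?F f \<in> Arr C" "Dom C (FArr ?F f) = word_obj C x (fdom f)"
    "Cod C (FArr ?F f) = word_obj C x (fcod f)" for f
    using assms by (cases f rule: farr_cases; simp add: term_functor_abs abs_farr_ops)+
  have cmp: "FArr ?F (fcomp g f) = FArr ?F g \<cdot> FArr ?F f" if "fdom g = fcod f" for f g
    using assms that
    by (cases f rule: farr_cases; cases g rule: farr_cases) (simp add: term_functor_abs abs_farr_ops)
  have ten: "FArr ?F (ften f g) = FArr ?F f \<boxtimes> FArr ?F g" for f g
    using assms
    by (cases f rule: farr_cases; cases g rule: farr_cases)
      (simp add: term_functor_abs abs_farr_ops ften_eq)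
  have str: "FArr ?F (fid a) = \<one> (word_obj C x a)"
    "FArr ?F (fass a b c) = Ass C (word_obj C x a) (word_obj C x b) (word_obj C x c)"
    "FArr ?F (frun a) = Run C (word_obj C x a)" "FArr ?F (flun a) = Lun C (word_obj C x a)"
    "FArr ?F (fsym a b) = Sym C (word_obj C x a) (word_obj C x b)" for a b c
    using assms by (simp_all add: abs_farr_simps term_functor_abs)
  show ?thesis
    by (intro strict_sm_functor.intro sm_functor.intro sm_functor_axioms.intro strict_sm_functor_axioms.intro
        free_smc_symmetric_monoidal symmetric_monoidal_category_axioms)
      (use assms in \<open>auto simp: Hom_iff typed cmp ten str\<close>)
qed

end

text \<open>
  A strict functor preserves all the operations by which words and arrows are generated from \<open>\<star>\<close>.
\<close>

lemma strict_functor_unique: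
  assumes "strict_sm_functor free_smc X F" "strict_sm_functor free_smc X G" "FObj F Star = FObj G Star"
  shows "F = G"
proof (rule smfun_eqI[where X = UNIV and Y = UNIV])
  interpret F: strict_sm_functor free_smc X F by fact
  interpret G: strict_sm_functor free_smc X G by fact
  show obj: "FObj F w = FObj G w" for w
    using assms(3) F.strict_obj G.strict_obj by (induction w) simp_all
  show "FUnit F = FUnit G" "FTen F (w, w') = FTen G (w, w')" for w w'
    by (simp_all add: F.funit_idt G.funit_idt F.ften_idt G.ften_idt obj)
  show "FArr F f = FArr G f" for f
  proof (induction f rule: free_smc_arrow_induct)
    case (cmp g f)
    then show ?case
      using F.farr_cmp_simp[of f g] G.farr_cmp_simp[of f g] by simp
  next
    case (tenL w f)
    then show ?case
      using F.strict_tarr[of "fid w" f] G.strict_tarr[of "fid w" f] F.farr_idt[of w] G.farr_idt[of w] obj by simp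
  next
    case (tenR w f)
    then show ?case
      using F.strict_tarr[of f "fid w"] G.strict_tarr[of f "fid w"] F.farr_idt[of w] G.farr_idt[of w] obj by simp
  qed (use F.strict_structure G.strict_structure F.farr_idt G.farr_idt
      Free.ass_iso Free.run_iso Free.lun_iso obj in simp_all)
qed auto

theorem free_ext_strict:
  assumes "symmetric_monoidal_category X" "x \<in> Obj X"
  shows "strict_sm_functor free_smc X (free_ext X x)" "FObj (free_ext X x) Star = x"
proof -
  interpret X: symmetric_monoidal_category X by fact
  have "\<exists>!F. strict_sm_functor free_smc X F \<and> FObj F Star = x"
  proof (rule ex1I[where a = "term_functor X x"])
    show "strict_sm_functor free_smc X (term_functor X x) \<and> FObj (term_functor X x) Star = x"
      using X.term_functor_strict[OF assms(2)] by (simp add: term_functor_def)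
  qed (use X.term_functor_strict[OF assms(2)] in \<open>auto simp: term_functor_def intro: strict_functor_unique\<close>)
  from theI'[OF this] show "strict_sm_functor free_smc X (free_ext X x)" "FObj (free_ext X x) Star = x"
    unfolding free_ext_def by blast+
qed

text \<open>
  The monoidality axioms express the component at \<open>I\<close>, and that at \<open>w \<otimes> w'\<close> by those at \<open>w\<close> and
  \<open>w'\<close>, after precomposition with the structure arrows of the source; these can be cancelled if
  the source is strong.
\<close>

theorem transformation_unique:
  assumes "sm_transformation free_smc X \<sigma>" "sm_transformation free_smc X \<tau>"
    "TSrc \<sigma> = S" "TSrc \<tau> = S" "TTgt \<sigma> = TTgt \<tau>"
    and strong: "iso X (FUnit S)" "\<And>w w'. iso X (FTen S (w, w'))"
    and "TCmp \<sigma> Star = TCmp \<tau> Star"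
  shows "\<sigma> = \<tau>"
proof (rule smtrans_eqI[where X = UNIV])
  interpret S: sm_transformation free_smc X \<sigma> by fact
  interpret T: sm_transformation free_smc X \<tau> by fact
  show "TCmp \<sigma> w = TCmp \<tau> w" for w
  proof (induction w)
    case WUnit
    have "TCmp \<sigma> WUnit \<cdot>\<^bsub>X\<^esub> FUnit S = TCmp \<tau> WUnit \<cdot>\<^bsub>X\<^esub> FUnit S"
      using S.tcmp_unit T.tcmp_unit assms(3-5) by simp
    then show ?case
      by (rule S.F.B.iso_epi[OF _ strong(1)])
        (use S.tcmp_simps[of WUnit] T.tcmp_simps[of WUnit] S.F.funit_simps assms(3-5) in simp_all)
  next
    case Star
    show ?case by fact
  next
    case (WTen w w')
    have "TCmp \<sigma> (WTen w w') \<cdot>\<^bsub>X\<^esub> FTen S (w, w') = TCmp \<tau> (WTen w w') \<cdot>\<^bsub>X\<^esub> FTen S (w, w')"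
      using S.tcmp_ten[of w w'] T.tcmp_ten[of w w'] WTen assms(3-5) by simp
    then show ?case
      by (rule S.F.B.iso_epi[OF _ strong(2)])
        (use S.tcmp_simps[of "WTen w w'"] T.tcmp_simps[of "WTen w w'"] S.F.ften_simps[of w w'] assms(3-5) in simp_all)
  qed
qed (use assms in auto)

text \<open>
  For a strict source the monoidality axioms leave no other choice of components.
\<close>

primrec extension_cmp :: "('o, 'a) smc \<Rightarrow> (word, farr, 'o, 'a) smfun \<Rightarrow> 'a \<Rightarrow> word \<Rightarrow> 'a" where
  "extension_cmp X F g WUnit = FUnit F"
| "extension_cmp X F g Star = g"
| "extension_cmp X F g (WTen w w') = FTen F (w, w') \<cdot>\<^bsub>X\<^esub> (extension_cmp X F g w \<boxtimes>\<^bsub>X\<^esub> extension_cmp X F g w')"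

text \<open>
  The components are monoidal by construction. The arrows at which they are natural are closed
  under composition, tensor and inversion; and naturality at each of \<open>Ass\<close>, \<open>Run\<close>, \<open>Lun\<close> and \<open>Sym\<close>
  is the corresponding axiom for the lax functor \<open>F\<close>, combined with naturality of that arrow in
  \<open>X\<close>.
\<close>

theorem extension_transformation:
  assumes "strict_sm_functor free_smc X S" "sm_functor free_smc X F"
    and g: "g \<in> Hom X (FObj S Star) (FObj F Star)"
  shows "sm_transformation free_smc X \<lparr>TSrc = S, TTgt = F, TCmp = extension_cmp X F g\<rparr>"
proof -
  interpret S: strict_sm_functor free_smc X S by fact
  interpret F: sm_functor free_smc X F by fact
  let ?e = "extension_cmp X F g"
  note Ss [simp] = S.strict_obj[simplified] S.farr_simps[simplified] S.fobj_simp[simplified]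
  note Fs [simp] = F.farr_simps[simplified] F.fobj_simp[simplified] F.funit_simps[simplified] F.ften_simps[simplified]
  have typed [simp]: "?e w \<in> Arr X" "Dom X (?e w) = FObj S w" "Cod X (?e w) = FObj F w" for w
    by (induction w) (use g in \<open>simp_all add: Hom_iff\<close>)
  have inv: "?e (fcod (Inv free_smc f)) \<cdot>\<^bsub>X\<^esub> FArr S (Inv free_smc f) =
      FArr F (Inv free_smc f) \<cdot>\<^bsub>X\<^esub> ?e (fdom (Inv free_smc f))"
    if "?e (fcod f) \<cdot>\<^bsub>X\<^esub> FArr S f = FArr F f \<cdot>\<^bsub>X\<^esub> ?e (fdom f)" "iso free_smc f" for f
  proof -
    have "Inv X (FArr F f) \<cdot>\<^bsub>X\<^esub> ?e (fcod f) =
      Inv X (FArr F f) \<cdot>\<^bsub>X\<^esub> ((?e (fcod f) \<cdot>\<^bsub>X\<^esub> FArr S f) \<cdot>\<^bsub>X\<^esub> Inv X (FArr S f))"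
      using that(2) by simp
    also have "\<dots> = ?e (fdom f) \<cdot>\<^bsub>X\<^esub> Inv X (FArr S f)"
      unfolding that(1) using that(2) by simp
    finally show ?thesis
      using Free.iso_simps(3,4)[OF that(2)] that(2) by simp
  qed
  have ass: "?e (WTen (WTen a b) c) \<cdot>\<^bsub>X\<^esub> FArr S (fass a b c) = FArr F (fass a b c) \<cdot>\<^bsub>X\<^esub> ?e (WTen a (WTen b c))" for a b c
  proof -
    have "?e (WTen (WTen a b) c) \<cdot>\<^bsub>X\<^esub> FArr S (fass a b c) =
      FTen F (WTen a b, c) \<cdot>\<^bsub>X\<^esub> ((FTen F (a, b) \<boxtimes>\<^bsub>X\<^esub> \<one>\<^bsub>X\<^esub> (FObj F c)) \<cdot>\<^bsub>X\<^esub>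
        (((?e a \<boxtimes>\<^bsub>X\<^esub> ?e b) \<boxtimes>\<^bsub>X\<^esub> ?e c) \<cdot>\<^bsub>X\<^esub> Ass X (FObj S a) (FObj S b) (FObj S c)))"
      using S.strict_structure(1)[of a b c] by simp
    also have "((?e a \<boxtimes>\<^bsub>X\<^esub> ?e b) \<boxtimes>\<^bsub>X\<^esub> ?e c) \<cdot>\<^bsub>X\<^esub> Ass X (FObj S a) (FObj S b) (FObj S c) =
      Ass X (FObj F a) (FObj F b) (FObj F c) \<cdot>\<^bsub>X\<^esub> (?e a \<boxtimes>\<^bsub>X\<^esub> (?e b \<boxtimes>\<^bsub>X\<^esub> ?e c))"
      by (simp add: S.B.ass_nat)
    also have "FTen F (WTen a b, c) \<cdot>\<^bsub>X\<^esub> ((FTen F (a, b) \<boxtimes>\<^bsub>X\<^esub> \<one>\<^bsub>X\<^esub> (FObj F c)) \<cdot>\<^bsub>X\<^esub> \<dots>) =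
      (FTen F (WTen a b, c) \<cdot>\<^bsub>X\<^esub> ((FTen F (a, b) \<boxtimes>\<^bsub>X\<^esub> \<one>\<^bsub>X\<^esub> (FObj F c)) \<cdot>\<^bsub>X\<^esub>
        Ass X (FObj F a) (FObj F b) (FObj F c))) \<cdot>\<^bsub>X\<^esub> (?e a \<boxtimes>\<^bsub>X\<^esub> (?e b \<boxtimes>\<^bsub>X\<^esub> ?e c))"
      by simp
    also have "\<dots> = (FArr F (fass a b c) \<cdot>\<^bsub>X\<^esub> (FTen F (a, WTen b c) \<cdot>\<^bsub>X\<^esub> (\<one>\<^bsub>X\<^esub> (FObj F a) \<boxtimes>\<^bsub>X\<^esub> FTen F (b, c)))) \<cdot>\<^bsub>X\<^esub>
        (?e a \<boxtimes>\<^bsub>X\<^esub> (?e b \<boxtimes>\<^bsub>X\<^esub> ?e c))"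
      using F.ften_ass'[of a b c] by simp
    also have "\<dots> = FArr F (fass a b c) \<cdot>\<^bsub>X\<^esub> ?e (WTen a (WTen b c))"
      by simp
    finally show ?thesis .
  qed
  have run: "?e a \<cdot>\<^bsub>X\<^esub> FArr S (frun a) = FArr F (frun a) \<cdot>\<^bsub>X\<^esub> ?e (WTen a WUnit)" for a
  proof -
    have "?e a \<cdot>\<^bsub>X\<^esub> FArr S (frun a) = Run X (FObj F a) \<cdot>\<^bsub>X\<^esub> (?e a \<boxtimes>\<^bsub>X\<^esub> \<one>\<^bsub>X\<^esub> \<I>\<^bsub>X\<^esub>)"
      using S.strict_structure(2)[of a] by (simp add: S.B.run_nat)
    also have "\<dots> = (FArr F (frun a) \<cdot>\<^bsub>X\<^esub> (FTen F (a, WUnit) \<cdot>\<^bsub>X\<^esub> (\<one>\<^bsub>X\<^esub> (FObj F a) \<boxtimes>\<^bsub>X\<^esub> FUnit F))) \<cdot>\<^bsub>X\<^esub> (?e a \<boxtimes>\<^bsub>X\<^esub> \<one>\<^bsub>X\<^esub> \<I>\<^bsub>X\<^esub>)"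
      using F.ften_run'[of a] by simp
    also have "\<dots> = FArr F (frun a) \<cdot>\<^bsub>X\<^esub> ?e (WTen a WUnit)"
      by simp
    finally show ?thesis .
  qed
  have lun: "?e a \<cdot>\<^bsub>X\<^esub> FArr S (flun a) = FArr F (flun a) \<cdot>\<^bsub>X\<^esub> ?e (WTen WUnit a)" for a
  proof -
    have "?e a \<cdot>\<^bsub>X\<^esub> FArr S (flun a) = Lun X (FObj F a) \<cdot>\<^bsub>X\<^esub> (\<one>\<^bsub>X\<^esub> \<I>\<^bsub>X\<^esub> \<boxtimes>\<^bsub>X\<^esub> ?e a)"
      using S.strict_structure(3)[of a] by (simp add: S.B.lun_nat)
    also have "\<dots> = (FArr F (flun a) \<cdot>\<^bsub>X\<^esub> (FTen F (WUnit, a) \<cdot>\<^bsub>X\<^esub> (FUnit F \<boxtimes>\<^bsub>X\<^esub> \<one>\<^bsub>X\<^esub> (FObj F a)))) \<cdot>\<^bsub>X\<^esub> (\<one>\<^bsub>X\<^esub> \<I>\<^bsub>X\<^esub> \<boxtimes>\<^bsub>X\<^esub> ?e a)"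
      using F.ften_lun'[of a] by simp
    also have "\<dots> = FArr F (flun a) \<cdot>\<^bsub>X\<^esub> ?e (WTen WUnit a)"
      by simp
    finally show ?thesis .
  qed
  have sym: "?e (WTen b a) \<cdot>\<^bsub>X\<^esub> FArr S (fsym a b) = FArr F (fsym a b) \<cdot>\<^bsub>X\<^esub> ?e (WTen a b)" for a b
  proof -
    have "?e (WTen b a) \<cdot>\<^bsub>X\<^esub> FArr S (fsym a b) = FTen F (b, a) \<cdot>\<^bsub>X\<^esub> (Sym X (FObj F a) (FObj F b) \<cdot>\<^bsub>X\<^esub> (?e a \<boxtimes>\<^bsub>X\<^esub> ?e b))"
      using S.strict_structure(4)[of a b] by (simp add: S.B.sym_nat)
    also have "\<dots> = (FTen F (b, a) \<cdot>\<^bsub>X\<^esub> Sym X (FObj F a) (FObj F b)) \<cdot>\<^bsub>X\<^esub> (?e a \<boxtimes>\<^bsub>X\<^esub> ?e b)"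
      by simp
    also have "\<dots> = (FArr F (fsym a b) \<cdot>\<^bsub>X\<^esub> FTen F (a, b)) \<cdot>\<^bsub>X\<^esub> (?e a \<boxtimes>\<^bsub>X\<^esub> ?e b)"
      using F.ften_sym[of a b] by simp
    finally show ?thesis by simp
  qed
  have tarr: "?e (fcod (ften f h)) \<cdot>\<^bsub>X\<^esub> FArr S (ften f h) = FArr F (ften f h) \<cdot>\<^bsub>X\<^esub> ?e (fdom (ften f h))"
    if "?e (fcod f) \<cdot>\<^bsub>X\<^esub> FArr S f = FArr F f \<cdot>\<^bsub>X\<^esub> ?e (fdom f)"
      "?e (fcod h) \<cdot>\<^bsub>X\<^esub> FArr S h = FArr F h \<cdot>\<^bsub>X\<^esub> ?e (fdom h)" for f h
  proof -
    have "?e (fcod (ften f h)) \<cdot>\<^bsub>X\<^esub> FArr S (ften f h) =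
      FTen F (fcod f, fcod h) \<cdot>\<^bsub>X\<^esub> ((?e (fcod f) \<cdot>\<^bsub>X\<^esub> FArr S f) \<boxtimes>\<^bsub>X\<^esub> (?e (fcod h) \<cdot>\<^bsub>X\<^esub> FArr S h))"
      using S.strict_tarr[of f h] by simp
    also have "\<dots> = (FTen F (fcod f, fcod h) \<cdot>\<^bsub>X\<^esub> (FArr F f \<boxtimes>\<^bsub>X\<^esub> FArr F h)) \<cdot>\<^bsub>X\<^esub> (?e (fdom f) \<boxtimes>\<^bsub>X\<^esub> ?e (fdom h))"
      unfolding that by simp
    also have "\<dots> = FArr F (ften f h) \<cdot>\<^bsub>X\<^esub> ?e (fdom (ften f h))"
      using F.ften_nat[of f h "fcod f" "fcod h"] by simp
    finally show ?thesis .
  qed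
  have idt: "?e w \<cdot>\<^bsub>X\<^esub> FArr S (fid w) = FArr F (fid w) \<cdot>\<^bsub>X\<^esub> ?e w" for w
    using S.farr_idt[of w] F.farr_idt[of w] by simp
  have nat: "?e (fcod f) \<cdot>\<^bsub>X\<^esub> FArr S f = FArr F f \<cdot>\<^bsub>X\<^esub> ?e (fdom f)" for f
  proof (induction f rule: free_smc_arrow_induct)
    case (cmp h f)
    have "?e (fcod (fcomp h f)) \<cdot>\<^bsub>X\<^esub> FArr S (fcomp h f) = (?e (fcod h) \<cdot>\<^bsub>X\<^esub> FArr S h) \<cdot>\<^bsub>X\<^esub> FArr S f"
      using S.farr_cmp_simp[of f h] cmp(3) by simp
    also have "\<dots> = FArr F h \<cdot>\<^bsub>X\<^esub> (?e (fcod f) \<cdot>\<^bsub>X\<^esub> FArr S f)"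
      unfolding cmp(1) using cmp(3) by simp
    also have "\<dots> = FArr F (fcomp h f) \<cdot>\<^bsub>X\<^esub> ?e (fdom (fcomp h f))"
      unfolding cmp(2) using F.farr_cmp_simp[of f h] cmp(3) by simp
    finally show ?case .
  next
    case (ass_inv a b c)
    show ?case
      using Free.ass_iso[of a b c] ass by (intro inv) simp_all
  next
    case (run_inv a)
    show ?case
      using Free.run_iso[of a] run by (intro inv) simp_all
  next
    case (lun_inv a)
    show ?case
      using Free.lun_iso[of a] lun by (intro inv) simp_all
  next
    case (tenL w f)
    then show ?case
      using tarr[of "fid w" f] idt by simp
  next
    case (tenR w f)
    then show ?case
      using tarr[of f "fid w"] idt by simp
  qed (use ass run lun sym idt in simp_all)
  have "sm_transformation free_smc X \<lparr>TSrc = S, TTgt = F, TCmp = (\<lambda>w\<in>Obj free_smc. ?e w)\<rparr>"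
    by (intro sm_transformationI S.sm_functor_axioms F.sm_functor_axioms)
      (use nat in \<open>simp_all add: S.funit_idt S.ften_idt\<close>)
  then show ?thesis
    by (simp add: restrict_def)
qed

section \<open>Composition, evaluation and duality\<close>

lemma id_fun_simps [simp]:
  "x \<in> Obj A \<Longrightarrow> FObj (id_fun A) x = x" "f \<in> Arr A \<Longrightarrow> FArr (id_fun A) f = f"
  "FUnit (id_fun A) = \<one>\<^bsub>A\<^esub> \<I>\<^bsub>A\<^esub>"
  "x \<in> Obj A \<Longrightarrow> y \<in> Obj A \<Longrightarrow> FTen (id_fun A) (x, y) = \<one>\<^bsub>A\<^esub> (x \<otimes>\<^bsub>A\<^esub> y)"
  by (simp_all add: id_fun_def)

lemma comp_fun_simps [simp]:
  "x \<in> Obj A \<Longrightarrow> FObj (comp_fun A C G F) x = FObj G (FObj F x)"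
  "f \<in> Arr A \<Longrightarrow> FArr (comp_fun A C G F) f = FArr G (FArr F f)"
  "FUnit (comp_fun A C G F) = FArr G (FUnit F) \<cdot>\<^bsub>C\<^esub> FUnit G"
  "x \<in> Obj A \<Longrightarrow> y \<in> Obj A \<Longrightarrow> FTen (comp_fun A C G F) (x, y) =
    FArr G (FTen F (x, y)) \<cdot>\<^bsub>C\<^esub> FTen G (FObj F x, FObj F y)"
  by (simp_all add: comp_fun_def)

lemma ev_simps [simp]:
  "sm_functor A B F \<Longrightarrow> FObj (ev A B a) F = FObj F a"
  "sm_transformation A B \<sigma> \<Longrightarrow> FArr (ev A B a) \<sigma> = TCmp \<sigma> a"
  "FUnit (ev A B a) = \<one>\<^bsub>B\<^esub> \<I>\<^bsub>B\<^esub>"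
  "sm_functor A B F \<Longrightarrow> sm_functor A B G \<Longrightarrow>
    FTen (ev A B a) (F, G) = \<one>\<^bsub>B\<^esub> (FObj F a \<otimes>\<^bsub>B\<^esub> FObj G a)"
  by (simp_all add: ev_def)

lemma id_fun_strict:
  assumes "symmetric_monoidal_category A"
  shows "strict_sm_functor A A (id_fun A)"
proof -
  interpret symmetric_monoidal_category A by fact
  show ?thesis
    by (intro strict_sm_functor.intro sm_functor.intro sm_functor_axioms.intro strict_sm_functor_axioms.intro assms)
      (auto simp: Hom_iff id_fun_def)
qed

lemma (in sm_functor) comp_id: "comp_fun A B F (id_fun A) = F" "comp_fun A B (id_fun B) F = F"
  using fobj farr_ext ften_ext
  by (auto simp: comp_fun_def id_fun_def PiE_iff intro!: smfun_eqI[where X = "Obj A" and Y = "Arr A"])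

text \<open>
  In the associativity and unit axioms, naturality of \<open>G\<^sup>2\<close> brings together the arrows of \<open>F\<close>
  under \<open>G\<close>, where the axiom for \<open>F\<close> applies; what remains is the axiom for \<open>G\<close>.
\<close>

lemma comp_fun_functor:
  assumes "sm_functor A B F" "sm_functor B C G"
  shows "sm_functor A C (comp_fun A C G F)"
proof -
  interpret F: sm_functor A B F by fact
  interpret G: sm_functor B C G by fact
  let ?K = "comp_fun A C G F"
  have nat: "FTen ?K (Cod A f, Cod A g) \<cdot>\<^bsub>C\<^esub> (FArr ?K f \<boxtimes>\<^bsub>C\<^esub> FArr ?K g) = FArr ?K (f \<boxtimes>\<^bsub>A\<^esub> g) \<cdot>\<^bsub>C\<^esub> FTen ?K (Dom A f, Dom A g)"
    if o: "f \<in> Arr A" "g \<in> Arr A" for f g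
  proof -
    have "FTen ?K (Cod A f, Cod A g) \<cdot>\<^bsub>C\<^esub> (FArr ?K f \<boxtimes>\<^bsub>C\<^esub> FArr ?K g) =
      FArr G (FTen F (Cod A f, Cod A g)) \<cdot>\<^bsub>C\<^esub> (FTen G (FObj F (Cod A f), FObj F (Cod A g)) \<cdot>\<^bsub>C\<^esub>
        (FArr G (FArr F f) \<boxtimes>\<^bsub>C\<^esub> FArr G (FArr F g)))"
      using o by simp
    also have "\<dots> = FArr G (FTen F (Cod A f, Cod A g) \<cdot>\<^bsub>B\<^esub> (FArr F f \<boxtimes>\<^bsub>B\<^esub> FArr F g)) \<cdot>\<^bsub>C\<^esub>
      FTen G (FObj F (Dom A f), FObj F (Dom A g))"
      using o by (subst G.ften_nat) simp_all
    also have "\<dots> = FArr ?K (f \<boxtimes>\<^bsub>A\<^esub> g) \<cdot>\<^bsub>C\<^esub> FTen ?K (Dom A f, Dom A g)"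
      using o by (subst F.ften_nat) simp_all
    finally show ?thesis .
  qed
  have ass: "FArr ?K (Ass A x y z) \<cdot>\<^bsub>C\<^esub> FTen ?K (x, y \<otimes>\<^bsub>A\<^esub> z) \<cdot>\<^bsub>C\<^esub> (\<one>\<^bsub>C\<^esub> (FObj ?K x) \<boxtimes>\<^bsub>C\<^esub> FTen ?K (y, z)) =
    FTen ?K (x \<otimes>\<^bsub>A\<^esub> y, z) \<cdot>\<^bsub>C\<^esub> (FTen ?K (x, y) \<boxtimes>\<^bsub>C\<^esub> \<one>\<^bsub>C\<^esub> (FObj ?K z)) \<cdot>\<^bsub>C\<^esub> Ass C (FObj ?K x) (FObj ?K y) (FObj ?K z)"
    (is "?lhs = ?rhs") if o: "x \<in> Obj A" "y \<in> Obj A" "z \<in> Obj A" for x y z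
  proof -
    let ?x = "FObj F x" and ?y = "FObj F y" and ?z = "FObj F z"
    let ?u = "FTen G (?x, ?y \<otimes>\<^bsub>B\<^esub> ?z) \<cdot>\<^bsub>C\<^esub> (\<one>\<^bsub>C\<^esub> (FObj G ?x) \<boxtimes>\<^bsub>C\<^esub> FTen G (?y, ?z))"
    let ?w = "(FTen G (?x, ?y) \<boxtimes>\<^bsub>C\<^esub> \<one>\<^bsub>C\<^esub> (FObj G ?z)) \<cdot>\<^bsub>C\<^esub> Ass C (FObj G ?x) (FObj G ?y) (FObj G ?z)"
    have "?lhs = FArr G (FArr F (Ass A x y z) \<cdot>\<^bsub>B\<^esub> FTen F (x, y \<otimes>\<^bsub>A\<^esub> z)) \<cdot>\<^bsub>C\<^esub>
      ((FTen G (?x, FObj F (y \<otimes>\<^bsub>A\<^esub> z)) \<cdot>\<^bsub>C\<^esub> (FArr G (\<one>\<^bsub>B\<^esub> ?x) \<boxtimes>\<^bsub>C\<^esub> FArr G (FTen F (y, z)))) \<cdot>\<^bsub>C\<^esub>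
        (\<one>\<^bsub>C\<^esub> (FObj G ?x) \<boxtimes>\<^bsub>C\<^esub> FTen G (?y, ?z)))"
      using o by simp
    also have "\<dots> = FArr G (FArr F (Ass A x y z) \<cdot>\<^bsub>B\<^esub> (FTen F (x, y \<otimes>\<^bsub>A\<^esub> z) \<cdot>\<^bsub>B\<^esub> (\<one>\<^bsub>B\<^esub> ?x \<boxtimes>\<^bsub>B\<^esub> FTen F (y, z)))) \<cdot>\<^bsub>C\<^esub> ?u"
      using o by (subst G.ften_nat) simp_all
    also have "\<dots> = FArr G (FTen F (x \<otimes>\<^bsub>A\<^esub> y, z) \<cdot>\<^bsub>B\<^esub> (FTen F (x, y) \<boxtimes>\<^bsub>B\<^esub> \<one>\<^bsub>B\<^esub> ?z)) \<cdot>\<^bsub>C\<^esub> (FArr G (Ass B ?x ?y ?z) \<cdot>\<^bsub>C\<^esub> ?u)"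
      using o by (subst F.ften_ass') simp_all
    also have "\<dots> = FArr G (FTen F (x \<otimes>\<^bsub>A\<^esub> y, z)) \<cdot>\<^bsub>C\<^esub>
      ((FArr G (FTen F (x, y) \<boxtimes>\<^bsub>B\<^esub> \<one>\<^bsub>B\<^esub> ?z) \<cdot>\<^bsub>C\<^esub> FTen G (?x \<otimes>\<^bsub>B\<^esub> ?y, ?z)) \<cdot>\<^bsub>C\<^esub> ?w)"
      using o by (subst G.ften_ass') simp_all
    also have "FArr G (FTen F (x, y) \<boxtimes>\<^bsub>B\<^esub> \<one>\<^bsub>B\<^esub> ?z) \<cdot>\<^bsub>C\<^esub> FTen G (?x \<otimes>\<^bsub>B\<^esub> ?y, ?z) =
      FTen G (FObj F (x \<otimes>\<^bsub>A\<^esub> y), ?z) \<cdot>\<^bsub>C\<^esub> (FArr G (FTen F (x, y)) \<boxtimes>\<^bsub>C\<^esub> FArr G (\<one>\<^bsub>B\<^esub> ?z))"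
      using o by (subst G.ften_nat) simp_all
    also have "FArr G (FTen F (x \<otimes>\<^bsub>A\<^esub> y, z)) \<cdot>\<^bsub>C\<^esub> (\<dots> \<cdot>\<^bsub>C\<^esub> ?w) = ?rhs"
      using o by simp
    finally show ?thesis .
  qed
  have run: "FArr ?K (Run A x) \<cdot>\<^bsub>C\<^esub> FTen ?K (x, \<I>\<^bsub>A\<^esub>) \<cdot>\<^bsub>C\<^esub> (\<one>\<^bsub>C\<^esub> (FObj ?K x) \<boxtimes>\<^bsub>C\<^esub> FUnit ?K) = Run C (FObj ?K x)"
    (is "?lhs = _") if o: "x \<in> Obj A" for x
  proof -
    let ?x = "FObj F x"
    have "?lhs = FArr G (FArr F (Run A x) \<cdot>\<^bsub>B\<^esub> FTen F (x, \<I>\<^bsub>A\<^esub>)) \<cdot>\<^bsub>C\<^esub>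
      ((FTen G (?x, FObj F \<I>\<^bsub>A\<^esub>) \<cdot>\<^bsub>C\<^esub> (FArr G (\<one>\<^bsub>B\<^esub> ?x) \<boxtimes>\<^bsub>C\<^esub> FArr G (FUnit F))) \<cdot>\<^bsub>C\<^esub> (\<one>\<^bsub>C\<^esub> (FObj G ?x) \<boxtimes>\<^bsub>C\<^esub> FUnit G))"
      using o by simp
    also have "\<dots> = FArr G (FArr F (Run A x) \<cdot>\<^bsub>B\<^esub> (FTen F (x, \<I>\<^bsub>A\<^esub>) \<cdot>\<^bsub>B\<^esub> (\<one>\<^bsub>B\<^esub> ?x \<boxtimes>\<^bsub>B\<^esub> FUnit F))) \<cdot>\<^bsub>C\<^esub>
      (FTen G (?x, \<I>\<^bsub>B\<^esub>) \<cdot>\<^bsub>C\<^esub> (\<one>\<^bsub>C\<^esub> (FObj G ?x) \<boxtimes>\<^bsub>C\<^esub> FUnit G))"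
      using o by (subst G.ften_nat) simp_all
    also have "\<dots> = Run C (FObj ?K x)"
      using o by (subst F.ften_run') (simp_all add: G.ften_run')
    finally show ?thesis .
  qed
  have lun: "FArr ?K (Lun A x) \<cdot>\<^bsub>C\<^esub> FTen ?K (\<I>\<^bsub>A\<^esub>, x) \<cdot>\<^bsub>C\<^esub> (FUnit ?K \<boxtimes>\<^bsub>C\<^esub> \<one>\<^bsub>C\<^esub> (FObj ?K x)) = Lun C (FObj ?K x)"
    (is "?lhs = _") if o: "x \<in> Obj A" for x
  proof -
    let ?x = "FObj F x"
    have "?lhs = FArr G (FArr F (Lun A x) \<cdot>\<^bsub>B\<^esub> FTen F (\<I>\<^bsub>A\<^esub>, x)) \<cdot>\<^bsub>C\<^esub>
      ((FTen G (FObj F \<I>\<^bsub>A\<^esub>, ?x) \<cdot>\<^bsub>C\<^esub> (FArr G (FUnit F) \<boxtimes>\<^bsub>C\<^esub> FArr G (\<one>\<^bsub>B\<^esub> ?x))) \<cdot>\<^bsub>C\<^esub> (FUnit G \<boxtimes>\<^bsub>C\<^esub> \<one>\<^bsub>C\<^esub> (FObj G ?x)))"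
      using o by simp
    also have "\<dots> = FArr G (FArr F (Lun A x) \<cdot>\<^bsub>B\<^esub> (FTen F (\<I>\<^bsub>A\<^esub>, x) \<cdot>\<^bsub>B\<^esub> (FUnit F \<boxtimes>\<^bsub>B\<^esub> \<one>\<^bsub>B\<^esub> ?x))) \<cdot>\<^bsub>C\<^esub>
      (FTen G (\<I>\<^bsub>B\<^esub>, ?x) \<cdot>\<^bsub>C\<^esub> (FUnit G \<boxtimes>\<^bsub>C\<^esub> \<one>\<^bsub>C\<^esub> (FObj G ?x)))"
      using o by (subst G.ften_nat) simp_all
    also have "\<dots> = Lun C (FObj ?K x)"
      using o by (subst F.ften_lun') (simp_all add: G.ften_lun')
    finally show ?thesis .
  qed
  have sym: "FArr ?K (Sym A x y) \<cdot>\<^bsub>C\<^esub> FTen ?K (x, y) = FTen ?K (y, x) \<cdot>\<^bsub>C\<^esub> Sym C (FObj ?K x) (FObj ?K y)"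
    if o: "x \<in> Obj A" "y \<in> Obj A" for x y
  proof -
    have "FArr ?K (Sym A x y) \<cdot>\<^bsub>C\<^esub> FTen ?K (x, y) =
      FArr G (FArr F (Sym A x y) \<cdot>\<^bsub>B\<^esub> FTen F (x, y)) \<cdot>\<^bsub>C\<^esub> FTen G (FObj F x, FObj F y)"
      using o by simp
    also have "\<dots> = FArr G (FTen F (y, x)) \<cdot>\<^bsub>C\<^esub> (FArr G (Sym B (FObj F x) (FObj F y)) \<cdot>\<^bsub>C\<^esub> FTen G (FObj F x, FObj F y))"
      using o by (subst F.ften_sym) simp_all
    also have "\<dots> = FTen ?K (y, x) \<cdot>\<^bsub>C\<^esub> Sym C (FObj ?K x) (FObj ?K y)"
      using o by (subst G.ften_sym) simp_all
    finally show ?thesis .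
  qed
  show ?thesis
  proof (intro sm_functor.intro sm_functor_axioms.intro F.A.symmetric_monoidal_category_axioms
      G.B.symmetric_monoidal_category_axioms ass run lun sym)
    show "FObj ?K \<in> Obj A \<rightarrow>\<^sub>E Obj C" "FArr ?K \<in> extensional (Arr A)" "FTen ?K \<in> extensional (Obj A \<times> Obj A)"
      by (auto simp: comp_fun_def)
    fix f g x x' y y'
    assume "f \<in> Hom A x x'" "g \<in> Hom A y y'"
    then show "FTen ?K (x', y') \<cdot>\<^bsub>C\<^esub> (FArr ?K f \<boxtimes>\<^bsub>C\<^esub> FArr ?K g) = FArr ?K (f \<boxtimes>\<^bsub>A\<^esub> g) \<cdot>\<^bsub>C\<^esub> FTen ?K (x, y)"
      using nat by (auto simp: Hom_iff simp del: comp_fun_simps)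
  qed (auto simp: Hom_iff)
qed

lemma (in smc_pair) ev_strict:
  assumes "a \<in> Obj A"
  shows "strict_sm_functor (hom_smc A B) B (ev A B a)"
proof -
  interpret H: symmetric_monoidal_category "hom_smc A B"
    by (rule hom_smc_symmetric_monoidal)
  note [simp] = transformation_typed functor_obj box_functor const_fun_functor
    hom_idt hom_cmp hom_tarr hom_ass hom_run hom_lun hom_sym
  show ?thesis
    by (intro strict_sm_functor.intro sm_functor.intro sm_functor_axioms.intro strict_sm_functor_axioms.intro
        H.symmetric_monoidal_category_axioms B.symmetric_monoidal_category_axioms)
      (use assms in \<open>auto simp: Hom_iff\<close>, auto simp: ev_def)
qed

text \<open>
  The values of \<open>F\<close> are functors in the variable \<open>b\<close>, and its structure consists of
  transformations in \<open>b\<close>. Dualising reads the axioms of these in the other variable: naturality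
  and monoidality in \<open>b\<close> of the structure of \<open>F\<close> become naturality and monoidality in \<open>a\<close> of the
  structure of the dual.
\<close>

locale hom_valued_functor =
  A: symmetric_monoidal_category A + BC: smc_pair B C + F: sm_functor A "hom_smc B C" F
  for A :: "('o, 'a) smc" and B :: "('p, 'b) smc" and C :: "('q, 'c) smc" and F
begin

sublocale AC: smc_pair A C ..

lemma dual_obj_simps [simp]:
  "a \<in> Obj A \<Longrightarrow> FObj (dual_obj A F b) a = FObj (FObj F a) b"
  "f \<in> Arr A \<Longrightarrow> FArr (dual_obj A F b) f = TCmp (FArr F f) b"
  "FUnit (dual_obj A F b) = TCmp (FUnit F) b"
  "a \<in> Obj A \<Longrightarrow> a' \<in> Obj A \<Longrightarrow> FTen (dual_obj A F b) (a, a') = TCmp (FTen F (a, a')) b"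
  by (simp_all add: dual_obj_def)

lemma value_cells:
  "a \<in> Obj A \<Longrightarrow> sm_functor B C (FObj F a)" "f \<in> Arr A \<Longrightarrow> sm_transformation B C (FArr F f)"
  "sm_transformation B C (FUnit F)"
  "a \<in> Obj A \<Longrightarrow> a' \<in> Obj A \<Longrightarrow> sm_transformation B C (FTen F (a, a'))"
  using F.fobj_simp F.farr_simps F.funit_simps F.ften_simps by simp_all

lemma value_typing [simp]:
  "f \<in> Arr A \<Longrightarrow> TSrc (FArr F f) = FObj F (Dom A f)" "f \<in> Arr A \<Longrightarrow> TTgt (FArr F f) = FObj F (Cod A f)"
  "TSrc (FUnit F) = const_fun B C" "TTgt (FUnit F) = FObj F \<I>\<^bsub>A\<^esub>"
  "a \<in> Obj A \<Longrightarrow> a' \<in> Obj A \<Longrightarrow> TSrc (FTen F (a, a')) = box_fun B C (FObj F a) (FObj F a')"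
  "a \<in> Obj A \<Longrightarrow> a' \<in> Obj A \<Longrightarrow> TTgt (FTen F (a, a')) = FObj F (a \<otimes>\<^bsub>A\<^esub> a')"
  using F.farr_simps F.funit_simps F.ften_simps by simp_all

text \<open>
  Each value of the dual is the composite of \<open>F\<close> with an evaluation functor.
\<close>

lemma dual_obj_functor:
  assumes "b \<in> Obj B"
  shows "sm_functor A C (dual_obj A F b)"
proof -
  interpret E: strict_sm_functor "hom_smc B C" C "ev B C b"
    by (rule BC.ev_strict[OF assms])
  have "dual_obj A F b = comp_fun A C (ev B C b) F"
    using assms by (auto simp: dual_obj_def comp_fun_def value_cells sm_transformation.tcmp_simps[OF value_cells(3)]
        sm_transformation.tcmp_simps[OF value_cells(4)] BC.functor_obj intro!: restrict_ext)
  then show ?thesis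
    using comp_fun_functor[OF F.sm_functor_axioms E.sm_functor_axioms] by simp
qed

lemma dual_arr:
  assumes "g \<in> Arr B"
  shows "sm_transformation A C \<lparr>TSrc = dual_obj A F (Dom B g), TTgt = dual_obj A F (Cod B g),
    TCmp = (\<lambda>a\<in>Obj A. FArr (FObj F a) g)\<rparr>"
  by (intro sm_transformationI dual_obj_functor)
    (use assms sm_functor.farr_simps[OF value_cells(1)] sm_transformation.tcmp_nat[OF value_cells(2), of _ g]
      sm_transformation.tcmp_nat[OF value_cells(3), of g] sm_transformation.tcmp_nat[OF value_cells(4), of _ _ g]
      sm_transformation.tcmp_simps[OF value_cells(3)] in simp_all)

lemma dual_unit:
  "sm_transformation A C \<lparr>TSrc = const_fun A C, TTgt = dual_obj A F \<I>\<^bsub>B\<^esub>,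
    TCmp = (\<lambda>a\<in>Obj A. FUnit (FObj F a))\<rparr>"
proof -
  have run: "FUnit (FObj F (x \<otimes>\<^bsub>A\<^esub> y)) \<cdot>\<^bsub>C\<^esub> Run C \<I>\<^bsub>C\<^esub> =
    TCmp (FTen F (x, y)) \<I>\<^bsub>B\<^esub> \<cdot>\<^bsub>C\<^esub> (FUnit (FObj F x) \<boxtimes>\<^bsub>C\<^esub> FUnit (FObj F y))"
    if o: "x \<in> Obj A" "y \<in> Obj A" for x y
    unfolding value_typing(6)[OF o, symmetric] sm_transformation.tcmp_unit[OF value_cells(4)[OF o], symmetric]
    using o sm_functor.funit_simps[OF value_cells(1)] sm_transformation.tcmp_simps[OF value_cells(4)]
    by simp
  show ?thesis
    by (intro sm_transformationI dual_obj_functor AC.const_fun_functor)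
      (use sm_functor.funit_simps[OF value_cells(1)] sm_transformation.tcmp_unit[OF value_cells(2)]
        sm_transformation.tcmp_unit[OF value_cells(3)] sm_transformation.tcmp_simps[OF value_cells(3)] run in simp_all)
qed

text \<open>
  Monoidality of \<open>F\<^sup>2\<close> in \<open>b\<close> contains the interchange for the pointwise tensor in \<open>[B, C]\<close>, while
  the statement contains the one for the pointwise tensor in \<open>[A, C]\<close>. The two have their middle
  factors exchanged, so they are inverse to each other.
\<close>

lemma dual_ten:
  assumes "b \<in> Obj B" "b' \<in> Obj B"
  shows "sm_transformation A C \<lparr>TSrc = box_fun A C (dual_obj A F b) (dual_obj A F b'),
    TTgt = dual_obj A F (b \<otimes>\<^bsub>B\<^esub> b'), TCmp = (\<lambda>a\<in>Obj A. FTen (FObj F a) (b, b'))\<rparr>"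
proof -
  note typed = sm_functor.ften_simps[OF value_cells(1), OF _ assms] sm_functor.fobj_simp[OF value_cells(1)]
    sm_transformation.tcmp_simps[OF value_cells(3)] sm_transformation.tcmp_simps[OF value_cells(4)]
  have unit: "FTen (FObj F \<I>\<^bsub>A\<^esub>) (b, b') \<cdot>\<^bsub>C\<^esub> ((TCmp (FUnit F) b \<boxtimes>\<^bsub>C\<^esub> TCmp (FUnit F) b') \<cdot>\<^bsub>C\<^esub> Inv C (Run C \<I>\<^bsub>C\<^esub>)) =
    TCmp (FUnit F) (b \<otimes>\<^bsub>B\<^esub> b')"
  proof -
    have "(FTen (FObj F \<I>\<^bsub>A\<^esub>) (b, b') \<cdot>\<^bsub>C\<^esub> (TCmp (FUnit F) b \<boxtimes>\<^bsub>C\<^esub> TCmp (FUnit F) b')) \<cdot>\<^bsub>C\<^esub> Inv C (Run C \<I>\<^bsub>C\<^esub>) =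
      (TCmp (FUnit F) (b \<otimes>\<^bsub>B\<^esub> b') \<cdot>\<^bsub>C\<^esub> Run C \<I>\<^bsub>C\<^esub>) \<cdot>\<^bsub>C\<^esub> Inv C (Run C \<I>\<^bsub>C\<^esub>)"
      using sm_transformation.tcmp_ten[OF value_cells(3) assms] assms by simp
    then show ?thesis
      using typed assms by simp
  qed
  have ten: "FTen (FObj F (x \<otimes>\<^bsub>A\<^esub> y)) (b, b') \<cdot>\<^bsub>C\<^esub> ((TCmp (FTen F (x, y)) b \<boxtimes>\<^bsub>C\<^esub> TCmp (FTen F (x, y)) b') \<cdot>\<^bsub>C\<^esub>
      interchange C (FObj (FObj F x) b) (FObj (FObj F x) b') (FObj (FObj F y) b) (FObj (FObj F y) b')) =
    TCmp (FTen F (x, y)) (b \<otimes>\<^bsub>B\<^esub> b') \<cdot>\<^bsub>C\<^esub> (FTen (FObj F x) (b, b') \<boxtimes>\<^bsub>C\<^esub> FTen (FObj F y) (b, b'))"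
    (is "_ \<cdot>\<^bsub>C\<^esub> (_ \<cdot>\<^bsub>C\<^esub> ?m) = _") if o: "x \<in> Obj A" "y \<in> Obj A" for x y
  proof -
    let ?m' = "interchange C (FObj (FObj F x) b) (FObj (FObj F y) b) (FObj (FObj F x) b') (FObj (FObj F y) b')"
    have "FTen (FObj F (x \<otimes>\<^bsub>A\<^esub> y)) (b, b') \<cdot>\<^bsub>C\<^esub> ((TCmp (FTen F (x, y)) b \<boxtimes>\<^bsub>C\<^esub> TCmp (FTen F (x, y)) b') \<cdot>\<^bsub>C\<^esub> ?m) =
      (FTen (FObj F (x \<otimes>\<^bsub>A\<^esub> y)) (b, b') \<cdot>\<^bsub>C\<^esub> (TCmp (FTen F (x, y)) b \<boxtimes>\<^bsub>C\<^esub> TCmp (FTen F (x, y)) b')) \<cdot>\<^bsub>C\<^esub> ?m"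
      using o assms typed by simp
    also have "\<dots> = (TCmp (FTen F (x, y)) (b \<otimes>\<^bsub>B\<^esub> b') \<cdot>\<^bsub>C\<^esub>
        ((FTen (FObj F x) (b, b') \<boxtimes>\<^bsub>C\<^esub> FTen (FObj F y) (b, b')) \<cdot>\<^bsub>C\<^esub> ?m')) \<cdot>\<^bsub>C\<^esub> ?m"
      using sm_transformation.tcmp_ten[OF value_cells(4)[OF o] assms] o assms by simp
    also have "\<dots> = TCmp (FTen F (x, y)) (b \<otimes>\<^bsub>B\<^esub> b') \<cdot>\<^bsub>C\<^esub> (FTen (FObj F x) (b, b') \<boxtimes>\<^bsub>C\<^esub> FTen (FObj F y) (b, b'))"
      using o assms typed by (simp add: BC.B.interchange_involution)
    finally show ?thesis .
  qed
  show ?thesis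
    by (intro sm_transformationI dual_obj_functor AC.box_functor)
      (use assms typed sm_transformation.tcmp_ten[OF value_cells(2) assms] unit ten in simp_all)
qed

lemma dual_simps [simp]:
  "b \<in> Obj B \<Longrightarrow> FObj (dual A B C F) b = dual_obj A F b"
  "g \<in> Arr B \<Longrightarrow> FArr (dual A B C F) g = \<lparr>TSrc = dual_obj A F (Dom B g), TTgt = dual_obj A F (Cod B g),
    TCmp = (\<lambda>a\<in>Obj A. FArr (FObj F a) g)\<rparr>"
  "FUnit (dual A B C F) = \<lparr>TSrc = const_fun A C, TTgt = dual_obj A F \<I>\<^bsub>B\<^esub>, TCmp = (\<lambda>a\<in>Obj A. FUnit (FObj F a))\<rparr>"
  "b \<in> Obj B \<Longrightarrow> b' \<in> Obj B \<Longrightarrow> FTen (dual A B C F) (b, b') =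
    \<lparr>TSrc = box_fun A C (dual_obj A F b) (dual_obj A F b'), TTgt = dual_obj A F (b \<otimes>\<^bsub>B\<^esub> b'),
     TCmp = (\<lambda>a\<in>Obj A. FTen (FObj F a) (b, b'))\<rparr>"
  by (simp_all add: dual_def)

theorem dual_functor: "sm_functor B (hom_smc A C) (dual A B C F)"
proof (intro sm_functor.intro sm_functor_axioms.intro BC.A.symmetric_monoidal_category_axioms
      AC.hom_smc_symmetric_monoidal)
  show "FObj (dual A B C F) \<in> Obj B \<rightarrow>\<^sub>E Obj (hom_smc A C)" "FArr (dual A B C F) \<in> extensional (Arr B)"
    "FTen (dual A B C F) \<in> extensional (Obj B \<times> Obj B)"
    using dual_obj_functor by (auto simp: dual_def)
qed (use dual_obj_functor dual_arr dual_unit dual_ten sm_functor.fobj_simp[OF value_cells(1)] sm_functor.farr_simps[OF value_cells(1)]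
    sm_functor.funit_simps[OF value_cells(1)] sm_functor.ften_simps[OF value_cells(1)] sm_functor.farr_cmp_simp[OF value_cells(1)] sm_functor.farr_idt[OF value_cells(1)]
    sm_functor.ften_nat[OF value_cells(1)] sm_functor.ften_ass'[OF value_cells(1)] sm_functor.ften_run'[OF value_cells(1)]
    sm_functor.ften_lun'[OF value_cells(1)] sm_functor.ften_sym[OF value_cells(1)] in \<open>auto simp: Hom_iff intro!: restrict_ext\<close>)

end

section \<open>The adjunction\<close>

locale dual_of_free =
  A: symmetric_monoidal_category A for A :: "('o, 'a) smc"
begin

abbreviation "HA \<equiv> hom_smc A A"
abbreviation "HI \<equiv> hom_smc free_smc A"
abbreviation "vstar \<equiv> dual free_smc A A (v_fun A)"
abbreviation "ev_star \<equiv> ev free_smc A Star"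

sublocale AA: smc_pair A A ..

sublocale Free: symmetric_monoidal_category free_smc
  by (rule free_smc_symmetric_monoidal)

sublocale IA: smc_pair free_smc A ..

sublocale HI: symmetric_monoidal_category HI
  by (rule IA.hom_smc_symmetric_monoidal)

sublocale v: strict_sm_functor free_smc HA "v_fun A"
  unfolding v_fun_def
  by (rule free_ext_strict)
    (use AA.hom_smc_symmetric_monoidal id_fun_strict[OF A.symmetric_monoidal_category_axioms]
      in \<open>simp_all add: strict_sm_functor_def\<close>)

lemma v_Star [simp]: "FObj (v_fun A) Star = id_fun A"
  unfolding v_fun_def
  by (rule free_ext_strict)
    (use AA.hom_smc_symmetric_monoidal id_fun_strict[OF A.symmetric_monoidal_category_axioms]
      in \<open>simp_all add: strict_sm_functor_def\<close>)

sublocale V: hom_valued_functor free_smc A A "v_fun A" ..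

sublocale L: sm_functor A HI vstar
  by (rule V.dual_functor)

sublocale R: strict_sm_functor HI A ev_star
  by (rule IA.ev_strict) simp

text \<open>
  The value of \<open>v\<^sup>*\<close> at \<open>a\<close>, which sends a word to the tensor power of \<open>a\<close> of that shape.
\<close>

definition tensor_power :: "'o \<Rightarrow> (word, farr, 'o, 'a) smfun" where
  "tensor_power a = dual_obj free_smc (v_fun A) a"

\<comment> \<open>The values of \<open>v\<^sup>*\<close> stay folded, so that the lemmas on strict and strong functors apply to them.\<close>
declare V.dual_simps [simp del] V.dual_obj_simps [simp del]

lemmas vstar_simps [simp] = V.dual_simps[folded tensor_power_def]
  and tensor_power_functor [simp] = V.dual_obj_functor[folded tensor_power_def]
  and vstar_arr = V.dual_arr[folded tensor_power_def]
  and vstar_unit = V.dual_unit[folded tensor_power_def]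
  and vstar_ten = V.dual_ten[folded tensor_power_def]

lemma tensor_power_Star [simp]: "a \<in> Obj A \<Longrightarrow> FObj (tensor_power a) Star = a"
  by (simp add: tensor_power_def dual_obj_def)

text \<open>
  Its structure arrows are components of those of the strict functor \<open>v\<close>.
\<close>

lemma tensor_power_strict:
  assumes "a \<in> Obj A"
  shows "strict_sm_functor free_smc A (tensor_power a)"
proof -
  have "FUnit (tensor_power a) = \<one>\<^bsub>A\<^esub> \<I>\<^bsub>A\<^esub>"
    using assms by (simp add: tensor_power_def dual_obj_def v.funit_idt)
  moreover have "FTen (tensor_power a) (w, w') = \<one>\<^bsub>A\<^esub> (FObj (tensor_power a) w \<otimes>\<^bsub>A\<^esub> FObj (tensor_power a) w')" for w w'
    using assms by (simp add: tensor_power_def dual_obj_def v.ften_idt)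
  ultimately show ?thesis
    using tensor_power_functor[OF assms] by (simp add: strict_sm_functor_def strict_sm_functor_axioms_def)
qed

lemma tensor_power_strong:
  assumes "a \<in> Obj A"
  shows "iso A (FUnit (tensor_power a))" "iso A (FTen (tensor_power a) (w, w'))"
proof -
  interpret P: strict_sm_functor free_smc A "tensor_power a"
    by (rule tensor_power_strict[OF assms])
  show "iso A (FUnit (tensor_power a))" "iso A (FTen (tensor_power a) (w, w'))"
    using P.fobj_simp[of w] P.fobj_simp[of w'] by (simp_all add: P.funit_idt P.ften_idt)
qed

text \<open>
  Evaluating the dual at \<open>\<star>\<close> recovers the functor \<open>v(\<star>)\<close>, which is the identity.
\<close>

lemma ev_dual: "comp_fun A A ev_star vstar = id_fun A"
proof (rule smfun_eqI[where X = "Obj A" and Y = "Arr A"])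
  show "FObj (comp_fun A A ev_star vstar) x = FObj (id_fun A) x" if "x \<in> Obj A" for x
    using that by simp
  show "FArr (comp_fun A A ev_star vstar) f = FArr (id_fun A) f" if "f \<in> Arr A" for f
    using that vstar_arr[OF that] by simp
  show "FUnit (comp_fun A A ev_star vstar) = FUnit (id_fun A)"
    using vstar_unit by simp
  show "FTen (comp_fun A A ev_star vstar) (x, y) = FTen (id_fun A) (x, y)" if "x \<in> Obj A" "y \<in> Obj A" for x y
    using that vstar_ten[OF that] by simp
qed (auto simp: comp_fun_def id_fun_def)

text \<open>
  The transformation \<open>v\<^sup>*(F \<star>) \<rightarrow> F\<close> that extends the identity of \<open>F \<star>\<close>.
\<close>

definition counit_at :: "(word, farr, 'o, 'a) smfun \<Rightarrow> (word, farr, 'o, 'a) smtrans" where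
  "counit_at F = \<lparr>TSrc = tensor_power (FObj F Star), TTgt = F,
     TCmp = extension_cmp A F (\<one>\<^bsub>A\<^esub> (FObj F Star))\<rparr>"

lemma counit_at_simps [simp]:
  "TSrc (counit_at F) = tensor_power (FObj F Star)" "TTgt (counit_at F) = F"
  "TCmp (counit_at F) Star = \<one>\<^bsub>A\<^esub> (FObj F Star)"
  by (simp_all add: counit_at_def)

lemma counit_at_transformation:
  assumes "sm_functor free_smc A F"
  shows "sm_transformation free_smc A (counit_at F)"
proof -
  have F: "FObj F Star \<in> Obj A"
    using IA.functor_obj[OF assms] by simp
  show ?thesis
    unfolding counit_at_def
    by (rule extension_transformation[OF tensor_power_strict[OF F] assms]) (simp add: Hom_iff F)
qed

definition counit where
  "counit = \<lparr>TSrc = comp_fun HI HI vstar ev_star, TTgt = id_fun HI, TCmp = (\<lambda>F\<in>Obj HI. counit_at F)\<rparr>"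

lemma Star_obj [simp]: "sm_functor free_smc A F \<Longrightarrow> FObj F Star \<in> Obj A"
  by (rule IA.functor_obj) simp_all

text \<open>
  Both sides have a strict source, and at \<open>\<star>\<close> both are the component of \<open>\<sigma>\<close>.
\<close>

lemma counit_natural:
  assumes "sm_transformation free_smc A \<sigma>"
  shows "counit_at (TTgt \<sigma>) \<cdot>\<^bsub>HI\<^esub> FArr vstar (TCmp \<sigma> Star) = \<sigma> \<cdot>\<^bsub>HI\<^esub> counit_at (TSrc \<sigma>)"
proof -
  interpret S: sm_transformation free_smc A \<sigma> by fact
  note typed = S.tcmp_simps[of Star, simplified] IA.transformation_typed(1,2)[OF assms]
  have l: "sm_transformation free_smc A (FArr vstar (TCmp \<sigma> Star))"
    using L.farr_simps(1)[of "TCmp \<sigma> Star"] typed by simp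
  have "sm_transformation free_smc A (counit_at (TTgt \<sigma>) \<cdot>\<^bsub>HI\<^esub> FArr vstar (TCmp \<sigma> Star))"
    using IA.hom_cmp[OF l counit_at_transformation] typed by simp
  moreover have "sm_transformation free_smc A (\<sigma> \<cdot>\<^bsub>HI\<^esub> counit_at (TSrc \<sigma>))"
    using IA.hom_cmp[OF counit_at_transformation assms] typed by simp
  ultimately show ?thesis
    by (rule transformation_unique[where S = "tensor_power (FObj (TSrc \<sigma>) Star)"])
      (use tensor_power_strong typed in simp_all)
qed

lemma counit_unit: "counit_at (const_fun free_smc A) \<cdot>\<^bsub>HI\<^esub> FUnit vstar = \<one>\<^bsub>HI\<^esub> (const_fun free_smc A)"
proof -
  have "sm_transformation free_smc A (counit_at (const_fun free_smc A) \<cdot>\<^bsub>HI\<^esub> FUnit vstar)"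
    using IA.hom_cmp[OF vstar_unit counit_at_transformation[OF IA.const_fun_functor]] by simp
  moreover have "sm_transformation free_smc A (\<one>\<^bsub>HI\<^esub> (const_fun free_smc A))"
    using IA.hom_idt[OF IA.const_fun_functor] by simp
  ultimately show ?thesis
    by (rule transformation_unique[where S = "const_fun free_smc A"]) simp_all
qed

text \<open>
  The source is a tensor of strict functors. It is strong, since its structure arrows are
  interchanges and inverses of \<open>Run\<close>; so again it suffices to look at \<open>\<star>\<close>.
\<close>

lemma counit_tensor:
  assumes "sm_functor free_smc A F" "sm_functor free_smc A G"
  shows "counit_at (box_fun free_smc A F G) \<cdot>\<^bsub>HI\<^esub> FTen vstar (FObj F Star, FObj G Star) =
    counit_at F \<boxtimes>\<^bsub>HI\<^esub> counit_at G"
proof -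
  let ?f = "FObj F Star" and ?g = "FObj G Star"
  have fg: "?f \<in> Obj A" "?g \<in> Obj A"
    using assms by simp_all
  have "sm_transformation free_smc A (counit_at (box_fun free_smc A F G) \<cdot>\<^bsub>HI\<^esub> FTen vstar (?f, ?g))"
    using IA.hom_cmp[OF vstar_ten[OF fg] counit_at_transformation[OF IA.box_functor[OF assms]]] fg by simp
  moreover have "sm_transformation free_smc A (counit_at F \<boxtimes>\<^bsub>HI\<^esub> counit_at G)"
    using IA.hom_tarr[OF counit_at_transformation counit_at_transformation] assms by simp
  ultimately show ?thesis
  proof (rule transformation_unique[where S = "box_fun free_smc A (tensor_power ?f) (tensor_power ?g)"])
    interpret P: strict_sm_functor free_smc A "tensor_power ?f" by (rule tensor_power_strict[OF fg(1)])
    interpret Q: strict_sm_functor free_smc A "tensor_power ?g" by (rule tensor_power_strict[OF fg(2)])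
    note strict = P.funit_idt Q.funit_idt P.ften_idt[simplified] Q.ften_idt[simplified]
      P.fobj_simp[simplified] Q.fobj_simp[simplified]
    show "iso A (FUnit (box_fun free_smc A (tensor_power ?f) (tensor_power ?g)))"
      by (simp add: strict)
    show "iso A (FTen (box_fun free_smc A (tensor_power ?f) (tensor_power ?g)) (w, w'))" for w w'
      by (simp add: strict)
  qed (use fg in simp_all)
qed

lemma counit_power:
  assumes "a \<in> Obj A"
  shows "counit_at (tensor_power a) = \<one>\<^bsub>HI\<^esub> (tensor_power a)"
proof (rule transformation_unique[where S = "tensor_power a"])
  show "sm_transformation free_smc A (counit_at (tensor_power a))"
    by (rule counit_at_transformation[OF tensor_power_functor[OF assms]])
  show "sm_transformation free_smc A (\<one>\<^bsub>HI\<^esub> (tensor_power a))"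
    using IA.hom_idt[OF tensor_power_functor[OF assms]] by simp
qed (use assms tensor_power_strong in simp_all)

text \<open>
  The laws of a monoidal category are used in \<open>HI\<close>, whose composites therefore stay folded: the
  rules that expose components are switched off.
\<close>

lemma counit_transformation:
  "sm_transformation HI HI \<lparr>TSrc = comp_fun HI HI vstar ev_star, TTgt = id_fun HI, TCmp = (\<lambda>F\<in>Obj HI. counit_at F)\<rparr>"
proof (intro sm_transformationI)
  show "sm_functor HI HI (comp_fun HI HI vstar ev_star)"
    by (rule comp_fun_functor[OF R.sm_functor_axioms L.sm_functor_axioms])
  show "sm_functor HI HI (id_fun HI)"
    using id_fun_strict[OF HI.symmetric_monoidal_category_axioms] by (simp add: strict_sm_functor_def)
  show "counit_at (Cod HI \<sigma>) \<cdot>\<^bsub>HI\<^esub> FArr (comp_fun HI HI vstar ev_star) \<sigma> = FArr (id_fun HI) \<sigma> \<cdot>\<^bsub>HI\<^esub> counit_at (Dom HI \<sigma>)"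
    if "\<sigma> \<in> Arr HI" for \<sigma>
    using that counit_natural[of \<sigma>] by (simp del: vstar_simps hom_smc_simps(5-))
  show "counit_at \<I>\<^bsub>HI\<^esub> \<cdot>\<^bsub>HI\<^esub> FUnit (comp_fun HI HI vstar ev_star) = FUnit (id_fun HI)"
    using counit_unit L.farr_idt[of "\<I>\<^bsub>A\<^esub>"] L.funit_simps
    by (simp del: vstar_simps hom_smc_simps(5,6))
  show "counit_at (F \<otimes>\<^bsub>HI\<^esub> G) \<cdot>\<^bsub>HI\<^esub> FTen (comp_fun HI HI vstar ev_star) (F, G) =
    FTen (id_fun HI) (F, G) \<cdot>\<^bsub>HI\<^esub> (counit_at F \<boxtimes>\<^bsub>HI\<^esub> counit_at G)"
    if o: "F \<in> Obj HI" "G \<in> Obj HI" for F G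
  proof -
    have f: "sm_functor free_smc A F" "sm_functor free_smc A G"
      using o by simp_all
    have "FTen (comp_fun HI HI vstar ev_star) (F, G) =
      FArr vstar (\<one>\<^bsub>A\<^esub> (FObj F Star \<otimes>\<^bsub>A\<^esub> FObj G Star)) \<cdot>\<^bsub>HI\<^esub> FTen vstar (FObj F Star, FObj G Star)"
      using o f by (simp del: vstar_simps hom_smc_simps(5-))
    also have "\<dots> = FTen vstar (FObj F Star, FObj G Star)"
      using f L.ften_simps[of "FObj F Star" "FObj G Star"] by (simp del: vstar_simps hom_smc_simps)
    finally have "counit_at (F \<otimes>\<^bsub>HI\<^esub> G) \<cdot>\<^bsub>HI\<^esub> FTen (comp_fun HI HI vstar ev_star) (F, G) =
      counit_at F \<boxtimes>\<^bsub>HI\<^esub> counit_at G"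
      using counit_tensor[OF f] by (simp del: vstar_simps hom_smc_simps(5-) add: hom_smc_simps(8))
    also have "\<dots> = FTen (id_fun HI) (F, G) \<cdot>\<^bsub>HI\<^esub> (counit_at F \<boxtimes>\<^bsub>HI\<^esub> counit_at G)"
    proof -
      have "counit_at F \<in> Arr HI" "counit_at G \<in> Arr HI" "Cod HI (counit_at F) = F" "Cod HI (counit_at G) = G"
        using counit_at_transformation f by simp_all
      then show ?thesis
        using o by (simp del: hom_smc_simps)
    qed
    finally show ?thesis .
  qed
qed (auto intro: counit_at_transformation)

lemma unit_idt: "\<one>\<^bsub>HA\<^esub> (id_fun A) \<in> Hom HA (id_fun A) (comp_fun A A ev_star vstar)"
  using AA.hom_idt[of "id_fun A"] id_fun_strict[OF A.symmetric_monoidal_category_axioms]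
  by (simp add: ev_dual Hom_iff strict_sm_functor_def)

theorem adjunction: "sm_adjunction A HI vstar ev_star (\<one>\<^bsub>HA\<^esub> (id_fun A)) counit"
proof (intro sm_adjunction.intro sm_adjunction_axioms.intro L.sm_functor_axioms R.sm_functor_axioms unit_idt)
  show "counit \<in> Hom (hom_smc HI HI) (comp_fun HI HI vstar ev_star) (id_fun HI)"
    using counit_transformation by (simp add: Hom_iff counit_def)
  show "whisker_right A HI counit vstar \<cdot>\<^bsub>hom_smc A HI\<^esub> whisker_left A HI vstar (\<one>\<^bsub>HA\<^esub> (id_fun A)) = \<one>\<^bsub>hom_smc A HI\<^esub> vstar"
  proof -
    have "TCmp counit (FObj vstar a) \<cdot>\<^bsub>HI\<^esub> FArr vstar (\<one>\<^bsub>A\<^esub> a) = \<one>\<^bsub>HI\<^esub> (FObj vstar a)" if a: "a \<in> Obj A" for a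
    proof -
      have "TCmp counit (FObj vstar a) = \<one>\<^bsub>HI\<^esub> (FObj vstar a)"
        using a counit_power[OF a] by (simp add: counit_def)
      then show ?thesis
        using a by (simp del: vstar_simps hom_smc_simps)
    qed
    then show ?thesis
      by (auto simp: whisker_left_def whisker_right_def counit_def L.comp_id
          hom_smc_simps(5,6)[where A = A and B = HI] hom_smc_simps(5)[where A = A and B = A]
          simp del: vstar_simps hom_smc_simps intro!: restrict_ext)
  qed
  show "whisker_left HI A ev_star counit \<cdot>\<^bsub>hom_smc HI A\<^esub> whisker_right HI A (\<one>\<^bsub>HA\<^esub> (id_fun A)) ev_star = \<one>\<^bsub>hom_smc HI A\<^esub> ev_star"
    using counit_at_transformation
    by (auto simp: whisker_left_def whisker_right_def counit_def R.comp_id intro!: restrict_ext)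
qed

end

theorem proposition18p1:
  fixes A :: "('o, 'a) smc"
  assumes "symmetric_monoidal_category A"
  shows "has_right_adjoint A (hom_smc free_smc A)
           (dual free_smc A A (v_fun A)) (ev free_smc A Star)
         \<and> comp_fun A A (ev free_smc A Star) (dual free_smc A A (v_fun A)) = id_fun A"
proof -
  interpret dual_of_free A
    by (rule dual_of_free.intro[OF assms])
  show ?thesis
    unfolding has_right_adjoint_def using adjunction ev_dual by blast
qed

end
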